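(* Let $|\gamma|<1$ and assume $\mu$ is not normalized Lebesgue measure. For $f\in L^2(\mu)$ write $\Phi_\gamma^*f=(g_1,g_2)\in\mathcal K_{\theta_\gamma}$ and put $g_-^\gamma:=\overline{\theta_\gamma}g_1+\Delta_\gamma g_2$ (which lies in $H^2_-=L^2\ominus H^2$). Then, a.e. on $\mathbb T$, $$g_-^\gamma=(1-|\gamma|^2)^{-1/2}\big(\overline{\theta_\gamma}+\overline\gamma\big)\frac{T_-f}{T_-\mathbf 1}=\frac{(1-|\gamma|^2)^{1/2}\,\overline{\theta_0}}{1-\gamma\overline{\theta_0}}\cdot\frac{T_-f}{T_-\mathbf 1}.$$
   Context: $\mathbb T=\{|z|=1\}$, normalized Lebesgue measure. Let $\mu$ be a Borel probability measure on $\mathbb T$, $U=M_\xi$ on $L^2(\mu)$, $b=\mathbf 1$, $b_1(\xi)=\overline\xi$, $U_\gamma=U+(\gamma-1)(\,\cdot\,,b_1)_{L^2(\mu)}b$. For $\lambda\in\mathbb D$, $R_2\mu(\lambda)=\int\frac{1+\overline\xi\lambda}{1-\overline\xi\lambda}d\mu(\xi)$, $\theta_\gamma=\frac{(1-\gamma)R_2\mu-(1+\gamma)}{(1-\overline\gamma)R_2\mu+(1+\overline\gamma)}$ (boundary values also denoted $\theta_\gamma$), $\Delta_\gamma=(1-|\theta_\gamma|^2)^{1/2}$ on $\mathbb T$. Model space $\mathcal K_\theta=(H^2\oplus\operatorname{clos}\Delta L^2)\ominus\{(\theta h,\Delta h):h\in H^2\}$, model operator $\mathcal M_\theta=P_{\mathcal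 K_\theta}M_z|_{\mathcal K_\theta}$. Defect vectors $c^\gamma(z)=(1-|\theta_\gamma(0)|^2)^{-1/2}(1-\overline{\theta_\gamma(0)}\theta_\gamma(z),-\overline{\theta_\gamma(0)}\Delta_\gamma(z))^T$, $c_1^\gamma(z)=(1-|\theta_\gamma(0)|^2)^{-1/2}(z^{-1}(\theta_\gamma(z)-\theta_\gamma(0)),z^{-1}\Delta_\gamma(z))^T$. $\Phi_\gamma^*:L^2(\mu)\to\mathcal K_{\theta_\gamma}$ is the unitary operator with $\Phi_\gamma^*U_\gamma=\mathcal M_{\theta_\gamma}\Phi_\gamma^*$, $\Phi_\gamma^*b=c^\gamma$, $\Phi_\gamma^*b_1=c_1^\gamma$. $T_rf(z)=\int\frac{f(\xi)d\mu(\xi)}{1-r\overline\xi z}$ ($r\ne1$) and $T_-f=\lim_{r\to1^+}T_rf$ Lebesgue-a.e. *)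

theory Defs
  imports "HOL-Probability.Probability"
begin

definition mT :: "complex measure" where
  "mT = distr (uniform_measure lborel {0..2*pi}) borel cis"

definition sq_int :: "complex measure \<Rightarrow> (complex \<Rightarrow> complex) \<Rightarrow> bool" where
  "sq_int M f \<longleftrightarrow> f \<in> borel_measurable M \<and> integrable M (\<lambda>x. (cmod (f x))^2)"

definition L2inner :: "complex measure \<Rightarrow> (complex \<Rightarrow> complex) \<Rightarrow> (complex \<Rightarrow> complex) \<Rightarrow> complex" where
  "L2inner M f g = (\<integral>x. f x * cnj (g x) \<partial>M)"

definition L2norm :: "complex measure \<Rightarrow> (complex \<Rightarrow> complex) \<Rightarrow> real" where
  "L2norm M f = sqrt (\<integral>x. (cmod (f x))^2 \<partial>M)"

text \<open>Hardy space H2 inside L2(T): negative Fourier coefficients vanish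
  (the coefficient of index -k is the integral of f(z) z^k).\<close>
definition H2 :: "(complex \<Rightarrow> complex) set" where
  "H2 = {f. sq_int mT f \<and> (\<forall>k::nat. k \<ge> 1 \<longrightarrow> (\<integral>z. f z * z ^ k \<partial>mT) = 0)}"

definition H2minus :: "(complex \<Rightarrow> complex) set" where
  "H2minus = {g. sq_int mT g \<and> (\<forall>h\<in>H2. L2inner mT g h = 0)}"

definition R2 :: "complex measure \<Rightarrow> complex \<Rightarrow> complex" where
  "R2 M w = (\<integral>\<xi>. (1 + cnj \<xi> * w) / (1 - cnj \<xi> * w) \<partial>M)"

definition theta :: "complex measure \<Rightarrow> complex \<Rightarrow> complex \<Rightarrow> complex" where
  "theta M \<gamma> w = ((1 - \<gamma>) * R2 M w - (1 + \<gamma>)) / ((1 - cnj \<gamma>) * R2 M w + (1 + cnj \<gamma>))"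

definition bval :: "(complex \<Rightarrow> complex) \<Rightarrow> complex \<Rightarrow> complex" where
  "bval F \<zeta> = Lim (at_left (1::real)) (\<lambda>r. F (of_real r * \<zeta>))"

definition Delta :: "(complex \<Rightarrow> complex) \<Rightarrow> complex \<Rightarrow> complex" where
  "Delta tb \<zeta> = complex_of_real (sqrt (1 - (cmod (tb \<zeta>))^2))"

definition closDeltaL2 :: "(complex \<Rightarrow> complex) \<Rightarrow> (complex \<Rightarrow> complex) set" where
  "closDeltaL2 D = {g. sq_int mT g \<and>
     (\<forall>e>0. \<exists>h. sq_int mT h \<and> L2norm mT (\<lambda>z. g z - D z * h z) < e)}"

type_synonym pairfun = "(complex \<Rightarrow> complex) \<times> (complex \<Rightarrow> complex)"

definition Kinner :: "pairfun \<Rightarrow> pairfun \<Rightarrow> complex" where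
  "Kinner x y = L2inner mT (fst x) (fst y) + L2inner mT (snd x) (snd y)"

definition Kspace :: "(complex \<Rightarrow> complex) \<Rightarrow> pairfun set" where
  "Kspace tb = {x. fst x \<in> H2 \<and> snd x \<in> closDeltaL2 (Delta tb) \<and>
     (\<forall>h\<in>H2. Kinner x (\<lambda>z. tb z * h z, \<lambda>z. Delta tb z * h z) = 0)}"

definition ae_eq_pair :: "pairfun \<Rightarrow> pairfun \<Rightarrow> bool" where
  "ae_eq_pair x y \<longleftrightarrow> (AE z in mT. fst x z = fst y z) \<and> (AE z in mT. snd x z = snd y z)"

definition Ugamma :: "complex measure \<Rightarrow> complex \<Rightarrow> (complex \<Rightarrow> complex) \<Rightarrow> (complex \<Rightarrow> complex)" where
  "Ugamma M \<gamma> f = (\<lambda>\<xi>. \<xi> * f \<xi> + (\<gamma> - 1) * L2inner M f (\<lambda>\<xi>. cnj \<xi>) * 1)"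

definition cvec :: "complex measure \<Rightarrow> complex \<Rightarrow> pairfun" where
  "cvec M \<gamma> = (let tb = bval (theta M \<gamma>); t0 = theta M \<gamma> 0;
      s = complex_of_real (1 / sqrt (1 - (cmod t0)^2)) in
     (\<lambda>z. s * (1 - cnj t0 * tb z), \<lambda>z. s * (- cnj t0 * Delta tb z)))"

definition c1vec :: "complex measure \<Rightarrow> complex \<Rightarrow> pairfun" where
  "c1vec M \<gamma> = (let tb = bval (theta M \<gamma>); t0 = theta M \<gamma> 0;
      s = complex_of_real (1 / sqrt (1 - (cmod t0)^2)) in
     (\<lambda>z. s * (inverse z * (tb z - t0)), \<lambda>z. s * (inverse z * Delta tb z)))"

text \<open>Phi is the unitary operator L2(M) \<rightarrow> K_theta_gamma with
  Phi U_gamma = M_theta Phi (M_theta = P_K M_z restricted to K),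
  Phi 1 = c^gamma and Phi (conj xi) = c1^gamma.  Elements are represented by
  functions, equality being a.e. equality.\<close>
definition clark_Phi :: "complex measure \<Rightarrow> complex \<Rightarrow> ((complex \<Rightarrow> complex) \<Rightarrow> pairfun) \<Rightarrow> bool" where
  "clark_Phi M \<gamma> \<Phi> \<longleftrightarrow>
    (let K = Kspace (bval (theta M \<gamma>)) in
     (\<forall>f. sq_int M f \<longrightarrow> \<Phi> f \<in> K) \<and>
     (\<forall>f g a. sq_int M f \<longrightarrow> sq_int M g \<longrightarrow>
        ae_eq_pair (\<Phi> (\<lambda>x. a * f x + g x))
          (\<lambda>z. a * fst (\<Phi> f) z + fst (\<Phi> g) z, \<lambda>z. a * snd (\<Phi> f) z + snd (\<Phi> g) z)) \<and>
     (\<forall>f g. sq_int M f \<longrightarrow> sq_int M g \<longrightarrow> Kinner (\<Phi> f) (\<Phi> g) = L2inner M f g) \<and>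
     (\<forall>k\<in>K. \<exists>f. sq_int M f \<and> ae_eq_pair (\<Phi> f) k) \<and>
     (\<forall>f. sq_int M f \<longrightarrow> (\<forall>k\<in>K.
        Kinner (\<lambda>z. z * fst (\<Phi> f) z - fst (\<Phi> (Ugamma M \<gamma> f)) z,
                \<lambda>z. z * snd (\<Phi> f) z - snd (\<Phi> (Ugamma M \<gamma> f)) z) k = 0)) \<and>
     ae_eq_pair (\<Phi> (\<lambda>_. 1)) (cvec M \<gamma>) \<and>
     ae_eq_pair (\<Phi> (\<lambda>\<xi>. cnj \<xi>)) (c1vec M \<gamma>))"

definition Tr :: "complex measure \<Rightarrow> real \<Rightarrow> (complex \<Rightarrow> complex) \<Rightarrow> complex \<Rightarrow> complex" where
  "Tr M r f z = (\<integral>\<xi>. f \<xi> / (1 - of_real r * cnj \<xi> * z) \<partial>M)"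

definition Tminus :: "complex measure \<Rightarrow> (complex \<Rightarrow> complex) \<Rightarrow> complex \<Rightarrow> complex" where
  "Tminus M f z = Lim (at_right (1::real)) (\<lambda>r. Tr M r f z)"

end

theory Submission
  imports Defs "HOL-Complex_Analysis.Complex_Analysis" "HOL-Real_Asymp.Real_Asymp"
begin

text \<open>Put \<open>G f = cnj \<theta> g\<^sub>1 + \<Delta> g\<^sub>2\<close> for \<open>\<Phi> f = (g\<^sub>1, g\<^sub>2)\<close>. Membership in the model space says
  that \<open>G f\<close> is orthogonal to \<open>H\<^sup>2\<close>, and the intertwining relation turns into
  \<open>G (\<xi> f) = z G f - \<langle>f, b\<^sub>1\<rangle> \<kappa>\<close> with a function \<open>\<kappa>\<close> that does not depend on \<open>f\<close>. Applying this to
  \<open>f / (1 - cnj \<xi> w)\<close> and evaluating the Cauchy integral at the point \<open>w\<close> outside the disc gives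
  \<open>G f (w) = - \<kappa>(w) T f (w)\<close>, where \<open>T\<close> is the Cauchy transform with respect to \<open>M\<close>. For \<open>f = 1\<close> the left
  side is explicit, which determines \<open>\<kappa>\<close> in terms of \<open>\<theta>\<close>. Radial limits exist almost everywhere by
  Fatou's theorem on Poisson integrals, and the limits of \<open>\<kappa>\<close> and \<open>T 1\<close> do not vanish by the uniqueness
  theorem for bounded holomorphic functions; for \<open>T 1\<close> this is where \<open>M \<noteq> mT\<close> enters.\<close>

text \<open>The obstacle is that the boundary function \<open>\<phi>\<close> is a
  \<open>Lim\<close>, of unknown value where no limit exists, while the given defect vectors already
  contain it. Fatou's theorem is therefore not applied to \<open>theta\<close>. That
  \<open>\<phi>\<close> lies in \<open>H2\<close> is read off from the image of \<open>b_1\<close>,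
  and the bound 1 comes from the norms of the two defect vectors. Radial limits of
  \<open>theta\<close> are obtained only at the end, from the exterior limits of \<open>G 1\<close>.
  The function \<open>\<kappa>\<close> has two sources. Projecting z times the image of f back to
  the model space removes a multiple of \<open>(\<phi>, \<Delta>)\<close>; since
  \<open>cnj \<phi> * \<phi> + \<Delta> * \<Delta> = 1\<close>, \<open>G\<close> sees a constant,
  and pairing with the second defect vector shows that this is \<open>b1 f\<close> times the square
  root of \<open>1 - |\<gamma>|^2\<close>. The rank one perturbation adds
  \<open>(\<gamma> - 1) * G 1\<close>. The exterior is the natural side: \<open>G f\<close> has only
  negative frequencies, so its Cauchy integral recovers it from outside, where \<open>Tminus\<close>
  is also taken.\<close>

section \<open>Normalized Lebesgue measure on the circle\<close>

lemma borel_measurable_cis [measurable]: "cis \<in> borel_measurable borel"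
proof -
  have "continuous_on UNIV (\<lambda>x. cis x)" by (intro continuous_intros)
  then show ?thesis by (rule borel_measurable_continuous_onI)
qed

lemma prob_space_mT: "prob_space mT"
proof -
  have "prob_space (uniform_measure lborel {0..2*pi::real})"
    by (rule prob_space_uniform_measure) auto
  then show ?thesis
    unfolding mT_def by (rule prob_space.prob_space_distr) measurable
qed

interpretation mT: prob_space mT
  by (rule prob_space_mT)

lemma sets_mT [measurable_cong, simp]: "sets mT = sets borel"
  by (simp add: mT_def)

lemma space_mT [simp]: "space mT = UNIV"
  by (simp add: mT_def)

lemma borel_measurable_cnj [measurable (raw)]:
  "f \<in> borel_measurable N \<Longrightarrow> (\<lambda>x. cnj (f x)) \<in> borel_measurable N"
  by (rule borel_measurable_continuous_on[OF continuous_on_cnj[OF continuous_on_id]])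

lemma AE_mT_iff:
  assumes [measurable]: "{z. P z} \<in> sets borel"
  shows "(AE z in mT. P z) \<longleftrightarrow> (AE t in lborel. t \<in> {0..2*pi} \<longrightarrow> P (cis t))"
proof -
  have "(AE z in mT. P z) \<longleftrightarrow> (AE t in uniform_measure lborel {0..2*pi}. P (cis t))"
    unfolding mT_def by (rule AE_distr_iff) auto
  also have "\<dots> \<longleftrightarrow> (AE t in lborel. t \<in> {0..2*pi} \<longrightarrow> P (cis t))"
    by (rule AE_uniform_measure) auto
  finally show ?thesis .
qed

lemma AE_mT_circle: "AE z in mT. cmod z = 1"
  by (subst AE_mT_iff) auto

text \<open>\<open>Arg2pi\<close> is continuous off the closed ray of nonnegative reals and is 0 on
  that ray.\<close>

lemma borel_measurable_Arg2pi [measurable]: "Arg2pi \<in> borel_measurable borel"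
proof -
  have "(\<lambda>z. if z \<in> \<real>\<^sub>\<ge>\<^sub>0 then 0 else Arg2pi z) \<in> borel_measurable borel"
    by (intro borel_measurable_continuous_on_if continuous_at_imp_continuous_on ballI continuous_at_Arg2pi)
      (auto intro: borel_closed closed_nonneg_Reals_complex)
  also have "(\<lambda>z. if z \<in> \<real>\<^sub>\<ge>\<^sub>0 then 0 else Arg2pi z) = Arg2pi"
    by (auto simp: Arg2pi_eq_0 complex_nonneg_Reals_iff complex_is_Real_iff)
  finally show ?thesis .
qed

text \<open>\<open>P\<close> need not be measurable: the exceptional set is contained in the preimage of a Borel null set
  under the Borel function \<^term>\<open>Arg2pi\<close>.\<close>

lemma AE_mT_I:
  assumes "AE t in lborel. t \<in> {0..2*pi} \<longrightarrow> P (cis t)"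
  shows "AE z in mT. P z"
proof -
  obtain N where N: "N \<in> null_sets lborel" "{t. \<not> (t \<in> {0..2*pi} \<longrightarrow> P (cis t))} \<subseteq> N"
    using assms unfolding eventually_ae_filter by auto
  have [measurable]: "N \<in> sets borel" using N by auto
  \<comment> \<open>The point 2*pi is discarded because \<open>Arg2pi (cis t)\<close> returns t only
    for t < 2*pi.\<close>
  have "AE t in lborel. t \<notin> N \<and> t \<noteq> 2*pi"
    using N by (intro AE_conjI AE_not_in AE_lborel_singleton)
  then have "AE t in lborel. t \<in> {0..2*pi} \<longrightarrow> Arg2pi (cis t) \<notin> N"
  proof eventually_elim
    case (elim t)
    then show ?case
      using Arg2pi_unique[of 1 t "cis t"] by (auto simp: cis_conv_exp)
  qed
  then have "AE z in mT. Arg2pi z \<notin> N"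
    by (subst AE_mT_iff) measurable
  with AE_mT_circle show ?thesis
  proof eventually_elim
    case (elim z)
    then have "z = cis (Arg2pi z)" "Arg2pi z \<in> {0..2*pi}"
      using Arg2pi_eq[of z] Arg2pi_lt_2pi[of z] Arg2pi_ge_0[of z]  by (auto simp: cis_conv_exp)
    then show ?case using N elim by auto
  qed
qed

text \<open>A real density replaces the \<open>ennreal\<close> quotient in
  \<open>uniform_measure\<close>, so that Bochner integrals can be rewritten by
  \<open>integral_density\<close> and \<open>integrable_density\<close>.\<close>

lemma mT_eq_distr_density:
  "mT = distr (density lborel (\<lambda>t. ennreal (inverse (2*pi) * indicator {0..2*pi} t))) borel cis"
proof -
  have "indicator {0..2*pi} t / emeasure lborel {0..2*pi} = ennreal (inverse (2*pi) * indicator {0..2*pi} t)"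
    for t :: real
  proof (cases "t \<in> {0..2*pi}")
    case True
    have "(1::ennreal) / ennreal (2*pi) = ennreal (inverse (2*pi))"
      by (subst ennreal_1[symmetric], subst divide_ennreal) (simp_all add: inverse_eq_divide)
    with True show ?thesis by simp
  qed simp
  then show ?thesis
    unfolding mT_def uniform_measure_def by simp
qed

lemma integral_mT:
  fixes f :: "complex \<Rightarrow> 'b::{banach, second_countable_topology}"
  assumes [measurable]: "f \<in> borel_measurable borel"
  shows "(\<integral>z. f z \<partial>mT) = (\<integral>t\<in>{0..2*pi}. f (cis t) \<partial>lborel) /\<^sub>R (2*pi)"
proof -
  have "(\<integral>z. f z \<partial>mT) =
      (\<integral>t. f (cis t) \<partial>density lborel (\<lambda>t. ennreal (inverse (2*pi) * indicator {0..2*pi} t)))"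
    unfolding mT_eq_distr_density by (rule integral_distr) measurable
  also have "\<dots> = (\<integral>t. (inverse (2*pi) * indicator {0..2*pi} t) *\<^sub>R f (cis t) \<partial>lborel)"
    by (rule integral_density) simp_all
  also have "\<dots> = (\<integral>t\<in>{0..2*pi}. f (cis t) \<partial>lborel) /\<^sub>R (2*pi)"
    unfolding scaleR_scaleR[symmetric] integral_scaleR_right set_lebesgue_integral_def ..
  finally show ?thesis .
qed

lemma set_integrable_mT:
  fixes f :: "complex \<Rightarrow> 'b::{banach, second_countable_topology}"
  assumes "integrable mT f"
  shows "set_integrable lborel {0..2*pi} (\<lambda>t. f (cis t))"
proof -
  have [measurable]: "f \<in> borel_measurable borel"
    using borel_measurable_integrable[OF assms] by simp
  have "integrable (density lborel (\<lambda>t. ennreal (inverse (2*pi) * indicator {0..2*pi} t))) (\<lambda>t. f (cis t))"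
    using assms unfolding mT_eq_distr_density by (rule integrable_distr[rotated]) measurable
  then have "integrable lborel (\<lambda>t. (inverse (2*pi) * indicator {0..2*pi} t) *\<^sub>R f (cis t))"
    by (subst (asm) integrable_density) simp_all
  then show ?thesis
    using integrable_scaleR_right[of "2*pi" lborel "\<lambda>t. (inverse (2*pi) * indicator {0..2*pi} t) *\<^sub>R f (cis t)"]
    unfolding set_integrable_def scaleR_scaleR by (simp add: mult.assoc[symmetric])
qed

lemma integral_mT_power:
  assumes "n > 0"
  shows "(\<integral>z. z ^ n \<partial>mT) = 0"
proof -
  have "(\<integral>z. z ^ n \<partial>mT) = (\<integral>t\<in>{0..2*pi}. cis t ^ n \<partial>lborel) /\<^sub>R (2*pi)"
    by (rule integral_mT) simp
  also have "(\<integral>t\<in>{0..2*pi}. cis t ^ n \<partial>lborel) = (\<integral>t\<in>{0..2*pi}. cis (real n * t) \<partial>lborel)"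
    by (simp only: Complex.DeMoivre)
  also have "\<dots> = integral {0..2*pi} (\<lambda>t. cis (real n * t))"
  proof (rule set_borel_integral_eq_integral(2))
    show "set_integrable lborel {0..2*pi} (\<lambda>t. cis (real n * t))"
      by (rule borel_integrable_atLeastAtMost') (intro continuous_intros)
  qed
  also have "\<dots> = cis (real n * (2*pi)) / (\<i> * n) - cis (real n * 0) / (\<i> * n)"
  proof (intro integral_unique fundamental_theorem_of_calculus)
    fix t :: real assume "t \<in> {0..2*pi}"
    have "((\<lambda>t. cis (real n * t) / (\<i> * n)) has_vector_derivative
        (real n *\<^sub>R (\<i> * cis (real n * t))) / (\<i> * n)) (at t within {0..2*pi})"
      using \<open>n > 0\<close>
      by (auto intro!: derivative_eq_intros simp: has_vector_derivative_def scaleR_conv_of_real fun_eq_iff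
          mult.left_commute[of "complex_of_real _" \<i>])
    also have "(real n *\<^sub>R (\<i> * cis (real n * t))) / (\<i> * n) = cis (real n * t)"
      using \<open>n > 0\<close> by (simp add: scaleR_conv_of_real)
    finally show "((\<lambda>t. cis (real n * t) / (\<i> * n)) has_vector_derivative cis (real n * t))
      (at t within {0..2*pi})" .
  qed simp
  also have "cis (real n * (2*pi)) = 1"
    using cis_multiple_2pi[of "real n"] by (simp add: mult.commute)
  finally show ?thesis by simp
qed

lemma integral_mT_cnj_power:
  assumes "n > 0"
  shows "(\<integral>z. cnj z ^ n \<partial>mT) = 0"
  using integral_mT_power[OF assms] Bochner_Integration.integral_cnj[of mT "\<lambda>z. z ^ n"] by simp

subsection \<open>Square integrable functions\<close>

lemma sq_intD:
  assumes "sq_int N f"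
  shows "f \<in> borel_measurable N" "integrable N (\<lambda>x. (cmod (f x))^2)"
  using assms by (auto simp: sq_int_def)

lemma sq_int_add:
  assumes "sq_int N f" "sq_int N g"
  shows "sq_int N (\<lambda>x. f x + g x)"
proof -
  note [measurable] = sq_intD(1)[OF assms(1)] sq_intD(1)[OF assms(2)]
  have "integrable N (\<lambda>x. (cmod (f x + g x))^2)"
  proof (rule Bochner_Integration.integrable_bound)
    show "integrable N (\<lambda>x. 2 * (cmod (f x))^2 + 2 * (cmod (g x))^2)"
      using assms by (auto simp: sq_int_def)
    show "AE x in N. norm ((cmod (f x + g x))^2) \<le> norm (2 * (cmod (f x))^2 + 2 * (cmod (g x))^2)"
    proof (rule AE_I2)
      fix x
      have "(cmod (f x + g x))^2 \<le> (cmod (f x) + cmod (g x))^2"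
        by (intro power_mono norm_triangle_ineq) auto
      also have "\<dots> \<le> 2 * (cmod (f x))^2 + 2 * (cmod (g x))^2"
        using sum_squares_bound[of "cmod (f x)" "cmod (g x)"] by (simp add: power2_sum)
      finally show "norm ((cmod (f x + g x))^2) \<le> norm (2 * (cmod (f x))^2 + 2 * (cmod (g x))^2)"
        by simp
    qed
  qed simp
  then show ?thesis by (simp add: sq_int_def)
qed

lemma sq_int_mult_bounded:
  assumes f: "sq_int N f" and [measurable]: "b \<in> borel_measurable N"
    and bound: "AE x in N. cmod (b x) \<le> B"
  shows "sq_int N (\<lambda>x. b x * f x)"
proof -
  note [measurable] = sq_intD(1)[OF f]
  have "integrable N (\<lambda>x. (cmod (b x * f x))^2)"
  proof (rule Bochner_Integration.integrable_bound)
    show "integrable N (\<lambda>x. B^2 * (cmod (f x))^2)"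
      using f by (auto simp: sq_int_def)
    show "AE x in N. norm ((cmod (b x * f x))^2) \<le> norm (B^2 * (cmod (f x))^2)"
      using bound
    proof eventually_elim
      case (elim x)
      then have "(cmod (b x))^2 * (cmod (f x))^2 \<le> B^2 * (cmod (f x))^2"
        by (intro mult_right_mono power_mono) auto
      then show ?case by (simp add: norm_mult power_mult_distrib)
    qed
  qed simp
  then show ?thesis by (simp add: sq_int_def)
qed

lemma sq_int_cmult: "sq_int N f \<Longrightarrow> sq_int N (\<lambda>x. c * f x)"
  by (rule sq_int_mult_bounded[where B = "cmod c"]) auto

lemma sq_int_uminus: "sq_int N f \<Longrightarrow> sq_int N (\<lambda>x. - f x)"
  by (simp add: sq_int_def)

lemma sq_int_diff: "sq_int N f \<Longrightarrow> sq_int N g \<Longrightarrow> sq_int N (\<lambda>x. f x - g x)"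
  using sq_int_add[of N f "\<lambda>x. - g x"] by (simp add: sq_int_uminus)

lemma sq_int_cnj: "sq_int N f \<Longrightarrow> sq_int N (\<lambda>x. cnj (f x))"
  using borel_measurable_cnj[of f N] by (simp add: sq_int_def)

lemma sq_int_const: "finite_measure N \<Longrightarrow> sq_int N (\<lambda>x. c)"
  by (simp add: sq_int_def finite_measure.integrable_const)

lemma sq_int_bounded:
  assumes "finite_measure N" "b \<in> borel_measurable N" "AE x in N. cmod (b x) \<le> B"
  shows "sq_int N b"
  using sq_int_mult_bounded[OF sq_int_const[OF assms(1), of 1] assms(2,3)] by simp

lemma sq_int_cong_AE:
  assumes "sq_int N f" "g \<in> borel_measurable N" "AE x in N. f x = g x"
  shows "sq_int N g"
proof -
  note [measurable] = sq_intD(1)[OF assms(1)] assms(2)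
  have "integrable N (\<lambda>x. (cmod (f x))^2) \<longleftrightarrow> integrable N (\<lambda>x. (cmod (g x))^2)"
    using assms(3) by (intro integrable_cong_AE) auto
  then show ?thesis using assms by (simp add: sq_int_def)
qed

lemma integrable_mult_sq_int:
  assumes "sq_int N f" "sq_int N g"
  shows "integrable N (\<lambda>x. f x * g x)"
proof (rule Bochner_Integration.integrable_bound)
  note [measurable] = sq_intD(1)[OF assms(1)] sq_intD(1)[OF assms(2)]
  show "(\<lambda>x. f x * g x) \<in> borel_measurable N" by simp
  show "integrable N (\<lambda>x. (cmod (f x))^2 + (cmod (g x))^2)"
    using assms by (auto simp: sq_int_def)
  have "cmod (f x) * cmod (g x) \<le> (cmod (f x))^2 + (cmod (g x))^2" for x
  proof -
    have "2 * (cmod (f x) * cmod (g x)) \<le> (cmod (f x))^2 + (cmod (g x))^2"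
      using sum_squares_bound[of "cmod (f x)" "cmod (g x)"] by simp
    moreover have "0 \<le> cmod (f x) * cmod (g x)" by simp
    ultimately show ?thesis by linarith
  qed
  then show "AE x in N. norm (f x * g x) \<le> norm ((cmod (f x))^2 + (cmod (g x))^2)"
    by (simp add: norm_mult)
qed

lemma integrable_mult_cnj_sq_int:
  "sq_int N f \<Longrightarrow> sq_int N g \<Longrightarrow> integrable N (\<lambda>x. f x * cnj (g x))"
  by (intro integrable_mult_sq_int sq_int_cnj)

lemma integrable_sq_int: "finite_measure N \<Longrightarrow> sq_int N f \<Longrightarrow> integrable N f"
  using integrable_mult_sq_int[OF _ sq_int_const[of N 1], of f] by simp

lemma L2inner_self: "L2inner N f f = complex_of_real (\<integral>x. (cmod (f x))^2 \<partial>N)"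
  unfolding L2inner_def integral_complex_of_real[symmetric]
  by (rule Bochner_Integration.integral_cong) (simp_all only: complex_norm_square)

lemma L2inner_self_eq_0D:
  assumes "sq_int N f" "(\<integral>x. (cmod (f x))^2 \<partial>N) = 0"
  shows "AE x in N. f x = 0"
  using integral_nonneg_eq_0_iff_AE[of N "\<lambda>x. (cmod (f x))^2"] assms
  by (auto simp: sq_int_def)

subsection \<open>Radial limits of Poisson integrals\<close>

text \<open>Choose an open \<open>U\<close> around \<open>N\<close> of small \<nu>-measure. The
  balls in \<open>U\<close> whose length is at most \<open>2 / c\<close> times their \<nu>-measure
  form a Vitali cover of the set, and a disjoint subfamily that covers almost all of it has total
  length at most \<open>2 / c\<close> times the measure of \<open>U\<close>.\<close>

lemma negligible_positive_density:
  fixes \<nu> :: "real measure"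
  assumes \<nu>: "finite_measure \<nu>" "sets \<nu> = sets borel" and N: "N \<in> null_sets \<nu>" and "c > 0"
  shows "negligible {x \<in> N. \<forall>d>0. \<exists>r. 0 < r \<and> r < d \<and> c * r < measure \<nu> (ball x r)}"
    (is "negligible ?S")
proof -
  interpret finite_measure \<nu> by fact
  have [measurable_cong]: "sets \<nu> = sets borel" by fact
  have "\<exists>T. ?S \<subseteq> T \<and> T \<in> lmeasurable \<and> measure lebesgue T \<le> e" if "e > 0" for e
  proof -
    have "(INF U \<in> {U. N \<subseteq> U \<and> open U}. emeasure \<nu> U) = emeasure \<nu> N"
      using N \<nu> by (intro outer_regular[symmetric]) (auto simp: emeasure_eq_measure)
    \<comment> \<open>A selected ball has length \<open>2 * r\<close> and measure above
      \<open>c * r\<close>, hence the factor \<open>2 / c\<close>, which \<open>e * c / 2\<close>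
      compensates.\<close>
    also have "\<dots> < ennreal (e * c / 2)"
      using N \<open>e > 0\<close> \<open>c > 0\<close> by (simp add: null_setsD1)
    finally obtain U where U: "N \<subseteq> U" "open U" "emeasure \<nu> U < ennreal (e * c / 2)"
      by (auto simp: INF_less_iff)
    define K where "K = {(x, r). ball x r \<subseteq> U \<and> 0 < r \<and> c * r < measure \<nu> (ball x r)}"
    have "\<exists>i. i \<in> K \<and> x \<in> ball (fst i) (snd i) \<and> snd i < d" if x: "x \<in> ?S" and "0 < d" for x d
    proof -
      obtain d' where d': "d' > 0" "ball x d' \<subseteq> U"
      proof -
        have "x \<in> U" using U(1) x by blast
        then show ?thesis using \<open>open U\<close> that open_contains_ball by blast
      qed
      obtain r where r: "0 < r" "r < min d d'" "c * r < measure \<nu> (ball x r)"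
        using x \<open>0 < d\<close> d' by (auto dest: spec[of _ "min d d'"])
      then have "(x, r) \<in> K"
        using d' subset_ball[of r d' x] by (auto simp: K_def)
      with r show ?thesis by (intro exI[of _ "(x, r)"]) auto
    qed
    then obtain C where C: "countable C" "C \<subseteq> K"
        and pw: "pairwise (\<lambda>i j. disjnt (ball (fst i) (snd i)) (ball (fst j) (snd j))) C"
        and neg: "negligible (?S - (\<Union>i\<in>C. ball (fst i) (snd i)))"
      by (rule Vitali_covering_theorem_balls[of ?S K fst snd])
    have disj: "disjoint_family_on (\<lambda>i. ball (fst i) (snd i)) C"
      using pw by (auto simp: disjoint_family_on_def pairwise_def disjnt_def)
    let ?V = "\<Union>i\<in>C. ball (fst i) (snd i)"
    have "emeasure lborel ?V = (\<integral>\<^sup>+i. emeasure lborel (ball (fst i) (snd i)) \<partial>count_space C)"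
      using C disj by (intro emeasure_UN_countable) auto
    also have "\<dots> \<le> (\<integral>\<^sup>+i. ennreal (2 / c) * emeasure \<nu> (ball (fst i) (snd i)) \<partial>count_space C)"
    proof (intro nn_integral_mono)
      fix i assume "i \<in> space (count_space C)"
      then have i: "0 < snd i" "c * snd i < measure \<nu> (ball (fst i) (snd i))"
        using C by (auto simp: K_def)
      have "emeasure lborel (ball (fst i) (snd i)) = ennreal (2 * snd i)"
        using i by (simp add: ball_eq_greaterThanLessThan)
      also have "\<dots> \<le> ennreal (2 / c * measure \<nu> (ball (fst i) (snd i)))"
        using i \<open>c > 0\<close> by (intro ennreal_leI) (simp add: field_simps)
      also have "\<dots> = ennreal (2 / c) * emeasure \<nu> (ball (fst i) (snd i))"
        using \<open>c > 0\<close> unfolding emeasure_eq_measure by (intro ennreal_mult) simp_all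
      finally show "emeasure lborel (ball (fst i) (snd i)) \<le> ennreal (2 / c) * emeasure \<nu> (ball (fst i) (snd i))" .
    qed
    also have "\<dots> = ennreal (2 / c) * (\<integral>\<^sup>+i. emeasure \<nu> (ball (fst i) (snd i)) \<partial>count_space C)"
      by (intro nn_integral_cmult) auto
    finally have V0: "emeasure lborel ?V \<le> ennreal (2 / c) * (\<integral>\<^sup>+i. emeasure \<nu> (ball (fst i) (snd i)) \<partial>count_space C)" .
    have "(\<integral>\<^sup>+i. emeasure \<nu> (ball (fst i) (snd i)) \<partial>count_space C) = emeasure \<nu> ?V"
      using C disj by (intro emeasure_UN_countable[symmetric]) auto
    also have "\<dots> \<le> emeasure \<nu> U"
    proof (intro emeasure_mono UN_least)
      fix i assume "i \<in> C"
      then show "ball (fst i) (snd i) \<subseteq> U" using C(2) by (cases i) (auto simp: K_def)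
    qed (use U \<nu> in auto)
    also have "\<dots> \<le> ennreal (e * c / 2)"
      using U by simp
    finally have "ennreal (2 / c) * (\<integral>\<^sup>+i. emeasure \<nu> (ball (fst i) (snd i)) \<partial>count_space C)
        \<le> ennreal (2 / c) * ennreal (e * c / 2)"
      by (rule mult_left_mono) simp
    also have "\<dots> = ennreal e"
      using \<open>c > 0\<close> \<open>e > 0\<close> ennreal_mult[of "2 / c" "e * c / 2"] by simp
    finally have V: "emeasure lborel ?V \<le> ennreal e"
      using V0 by (rule order_trans[rotated])
    have Vm: "?V \<in> sets lborel" using C by auto
    then have V': "?V \<in> lmeasurable" "measure lebesgue ?V \<le> e"
    proof -
      have "emeasure lebesgue ?V \<le> ennreal e" using V Vm by simp
      then show "measure lebesgue ?V \<le> e" "?V \<in> lmeasurable"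
        using Vm \<open>e > 0\<close> unfolding measure_def
        by (auto intro!: enn2real_leI fmeasurableI intro: le_less_trans[OF _ ennreal_less_top])
    qed
    show ?thesis
    proof (intro exI[of _ "?V \<union> (?S - ?V)"] conjI)
      show "?V \<union> (?S - ?V) \<in> lmeasurable"
        using V' neg by (intro fmeasurable.Un) (auto intro: negligible_imp_measurable)
      have "measure lebesgue (?V \<union> (?S - ?V)) \<le> measure lebesgue ?V + measure lebesgue (?S - ?V)"
        using V' neg by (intro measure_Un_le) (auto intro: negligible_imp_measurable fmeasurableD)
      then show "measure lebesgue (?V \<union> (?S - ?V)) \<le> e"
        using V' neg by (simp add: negligible_imp_measure0)
    qed auto
  qed
  then show ?thesis
    unfolding negligible_outer_le by blast
qed

text \<open>If the limit fails, some threshold \<open>1 / (n + 1)\<close> is exceeded at arbitrarily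
  small radii, so the exceptional set is a countable union of negligible sets.\<close>

lemma AE_density_zero:
  fixes \<nu> :: "real measure"
  assumes \<nu>: "finite_measure \<nu>" "sets \<nu> = sets borel" and N: "N \<in> null_sets \<nu>"
  shows "AE x in lborel. x \<in> N \<longrightarrow> ((\<lambda>r. measure \<nu> (ball x r) / r) \<longlongrightarrow> 0) (at_right 0)"
proof -
  define c :: "nat \<Rightarrow> real" where "c n = inverse (real (Suc n))" for n
  define S where "S n = {x \<in> N. \<forall>d>0. \<exists>r. 0 < r \<and> r < d \<and> c n * r < measure \<nu> (ball x r)}" for n
  have S: "negligible (S n)" for n
    unfolding S_def by (intro negligible_positive_density assms) (simp add: c_def)
  have "negligible (\<Union>n. S n)"
    using S by (intro negligible_countable_Union[of "range S"]) blast+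
  then have "AE x in lebesgue. x \<notin> (\<Union>n. S n)"
    unfolding negligible_iff_null_sets by (rule AE_not_in)
  then have "AE x in lborel. x \<notin> (\<Union>n. S n)"
    by (simp only: AE_completion_iff)
  then show ?thesis
  proof eventually_elim
    case (elim x)
    show ?case
    proof
      assume "x \<in> N"
      show "((\<lambda>r. measure \<nu> (ball x r) / r) \<longlongrightarrow> 0) (at_right 0)"
      proof (rule tendstoI)
        fix e :: real assume "e > 0"
        then obtain n where n: "c n < e"
          using reals_Archimedean[of e] by (auto simp: c_def)
        obtain d where d: "d > 0" "\<And>r. 0 < r \<Longrightarrow> r < d \<Longrightarrow> measure \<nu> (ball x r) \<le> c n * r"
        proof -
          have "x \<notin> S n" using elim by blast
          then show ?thesis using that \<open>x \<in> N\<close> by (force simp: S_def not_less)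
        qed
        have "dist (measure \<nu> (ball x r) / r) 0 < e" if "0 < r" "r < d" for r
        proof -
          have "measure \<nu> (ball x r) / r \<le> c n"
            using d(2)[OF that] that by (simp add: field_simps)
          with n that show ?thesis by simp
        qed
        then show "\<forall>\<^sub>F r in at_right 0. dist (measure \<nu> (ball x r) / r) 0 < e"
          using \<open>d > 0\<close> by (auto simp: eventually_at_right_field)
      qed
    qed
  qed
qed

text \<open>The chord equals \<open>|s - t|\<close> times the modulus of \<open>sinc\<close> at half
  the difference. As t is interior, half the difference stays inside (-pi, pi), where
  \<open>sinc\<close> has no zero, and compactness gives a positive minimum. An endpoint t would
  fail, since 0 and 2*pi give the same point.\<close>

lemma chord_lower_bound:
  assumes "0 < t" "t < 2*pi"
  obtains c where "c > 0" "\<And>s. s \<in> {0..2*pi} \<Longrightarrow> c * \<bar>s - t\<bar> \<le> cmod (cis s - cis t)"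
proof -
  let ?q = "\<lambda>s. \<bar>sinc ((s - t) / 2)\<bar>"
  have chord: "cmod (cis s - cis t) = 2 * \<bar>sin ((s - t) / 2)\<bar>" for s
  proof -
    have "sin ((t - s) / 2) = - sin ((s - t) / 2)"
      by (subst sin_minus[symmetric], rule arg_cong[where f = sin]) (simp add: field_simps)
    then have eq: "cis s - cis t = cis ((s + t) / 2) * (2 * \<i> * sin ((s - t) / 2))"
      by (simp add: complex_eq_iff cos_diff_cos sin_diff_sin)
    show ?thesis unfolding eq by (simp add: norm_mult)
  qed
  have "compact {0..2*pi}" "{0..2*pi} \<noteq> {}" by auto
  moreover have "continuous_on {0..2*pi} ?q"
    by (intro continuous_on_rabs continuous_on_sinc continuous_intros) auto
  ultimately obtain u where u: "u \<in> {0..2*pi}" "\<And>s. s \<in> {0..2*pi} \<Longrightarrow> ?q u \<le> ?q s"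
    using continuous_attains_inf[of "{0..2*pi}" ?q] by blast
  have "?q u > 0"
  proof (cases "u = t")
    case False
    have "sin (\<bar>u - t\<bar> / 2) > 0"
      using False u(1) assms by (intro sin_gt_zero) auto
    then have "sin ((u - t) / 2) \<noteq> 0"
      using sin_minus[of "(u - t) / 2"] by (auto simp: abs_if minus_divide_left split: if_splits)
    then show ?thesis using False by simp
  qed simp
  moreover have "?q u * \<bar>s - t\<bar> \<le> cmod (cis s - cis t)" if "s \<in> {0..2*pi}" for s
  proof (cases "s = t")
    case False
    have "?q u * \<bar>s - t\<bar> \<le> ?q s * \<bar>s - t\<bar>"
      using u that by (intro mult_right_mono) auto
    also have "\<dots> = cmod (cis s - cis t)"
      using False by (simp add: chord abs_divide)
    finally show ?thesis .
  qed simp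
  ultimately show ?thesis using that by blast
qed

text \<open>Pull h back to a density on [0, 2*pi]. The zero set of this density is null for the
  measure that it defines, so \<open>AE_density_zero\<close> applies to it;
  \<open>chord_lower_bound\<close> then compares balls around a point of the circle with intervals
  around its parameter.\<close>

lemma AE_mT_density_zero:
  fixes h :: "complex \<Rightarrow> real"
  assumes h: "integrable mT h" "\<And>z. 0 \<le> h z"
  shows "AE z in mT. h z = 0 \<longrightarrow>
    ((\<lambda>r. (\<integral>\<xi>. indicator (ball z r) \<xi> * h \<xi> \<partial>mT) / r) \<longlongrightarrow> 0) (at_right 0)"
proof -
  have [measurable]: "h \<in> borel_measurable borel"
    using h(1) by (auto dest: borel_measurable_integrable)
  define D where "D s = indicator {0..2*pi} s * h (cis s)" for s
  have [measurable]: "D \<in> borel_measurable borel" unfolding D_def by simp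
  have D0: "0 \<le> D s" for s by (simp add: D_def h)
  have D: "integrable lborel D"
    using set_integrable_mT[OF h(1)] by (simp add: set_integrable_def D_def[abs_def])
  have int: "integrable lborel (\<lambda>s. indicator A s * D s)" if "A \<in> sets borel" for A
    using integrable_real_mult_indicator[of A lborel D] that D by (simp add: mult.commute[of "D _"])
  define \<nu> where "\<nu> = density lborel (\<lambda>s. ennreal (D s))"
  have measure_\<nu>: "emeasure \<nu> A = ennreal (\<integral>s. indicator A s * D s \<partial>lborel)" if [measurable]: "A \<in> sets borel" for A
  proof -
    have "emeasure \<nu> A = (\<integral>\<^sup>+s. ennreal (indicator A s * D s) \<partial>lborel)"
      unfolding \<nu>_def by (subst emeasure_density) (auto intro!: nn_integral_cong split: split_indicator)
    also have "\<dots> = ennreal (\<integral>s. indicator A s * D s \<partial>lborel)"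
      using D0 by (intro nn_integral_eq_integral int AE_I2) simp_all
    finally show ?thesis .
  qed
  have "space \<nu> = UNIV" by (simp add: \<nu>_def)
  then have fin: "finite_measure \<nu>"
    using measure_\<nu>[of UNIV] by (intro finite_measureI) simp
  have sets: "sets \<nu> = sets borel" by (simp add: \<nu>_def)
  define N where "N = {s. D s = 0}"
  have [measurable]: "N \<in> sets borel" unfolding N_def by measurable
  have "(\<integral>s. indicator N s * D s \<partial>lborel) = 0"
    by (rule integral_eq_zero_AE) (auto simp: N_def split: split_indicator)
  then have "N \<in> null_sets \<nu>" by (simp add: null_sets_def sets measure_\<nu>)
  from AE_density_zero[OF fin sets this]
  have "AE t in lborel. t \<in> N \<longrightarrow> ((\<lambda>r. measure \<nu> (ball t r) / r) \<longlongrightarrow> 0) (at_right 0)" .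
  moreover have "AE t in lborel. t \<noteq> 0 \<and> t \<noteq> 2*pi"
    by (intro AE_conjI AE_lborel_singleton)
  ultimately have "AE t in lborel. t \<in> {0..2*pi} \<longrightarrow> (h (cis t) = 0 \<longrightarrow>
    ((\<lambda>r. (\<integral>\<xi>. indicator (ball (cis t) r) \<xi> * h \<xi> \<partial>mT) / r) \<longlongrightarrow> 0) (at_right 0))"
  proof eventually_elim
    case (elim t)
    show ?case
    proof (intro impI)
      assume t: "t \<in> {0..2*pi}" "h (cis t) = 0"
      then have "t \<in> N" by (simp add: N_def D_def)
      with elim have lim: "((\<lambda>r. measure \<nu> (ball t r) / r) \<longlongrightarrow> 0) (at_right 0)" by simp
      obtain c where c: "c > 0" "\<And>s. s \<in> {0..2*pi} \<Longrightarrow> c * \<bar>s - t\<bar> \<le> cmod (cis s - cis t)"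
      proof -
        have "0 < t" "t < 2*pi" using t elim by simp_all
        then show ?thesis using chord_lower_bound that by blast
      qed
      have "filterlim (\<lambda>r. r / c) (at_right 0) (at_right 0)"
        using \<open>c > 0\<close> unfolding filterlim_at
        by (auto intro!: tendsto_eq_intros eventually_mono[OF eventually_at_right_less[of "0::real"]])
      from tendsto_mult_left[OF filterlim_compose[OF lim this], of "1 / c"]
      have lim': "((\<lambda>r. measure \<nu> (ball t (r / c)) / r) \<longlongrightarrow> 0) (at_right 0)"
        using \<open>c > 0\<close> by simp
      have bound: "(\<integral>\<xi>. indicator (ball (cis t) r) \<xi> * h \<xi> \<partial>mT) \<le> measure \<nu> (ball t (r / c))" for r
      proof -
        have "(\<integral>\<xi>. indicator (ball (cis t) r) \<xi> * h \<xi> \<partial>mT) =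
            (\<integral>s. indicator {0..2*pi} s * (indicator (ball (cis t) r) (cis s) * h (cis s)) \<partial>lborel) / (2*pi)"
        proof -
          have [measurable]: "(\<lambda>\<xi>. indicator (ball (cis t) r) \<xi> * h \<xi>) \<in> borel_measurable borel"
            by (intro borel_measurable_times borel_measurable_indicator) simp_all
          show ?thesis
            by (subst integral_mT) (simp_all only: set_lebesgue_integral_def divide_inverse real_scaleR_def
              mult.commute[of "inverse _"], measurable)
        qed
        also have "\<dots> \<le> (\<integral>s. indicator {0..2*pi} s * (indicator (ball (cis t) r) (cis s) * h (cis s)) \<partial>lborel)"
        proof -
          have "x / (2*pi) \<le> x" if "0 \<le> x" for x
            using that pi_gt3 mult_left_mono[of 1 "2*pi" x] by (simp add: field_simps)
          moreover have "0 \<le> (\<integral>s. indicator {0..2*pi} s * (indicator (ball (cis t) r) (cis s) * h (cis s)) \<partial>lborel)"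
            by (intro integral_nonneg_AE) (simp add: h)
          ultimately show ?thesis by blast
        qed
        also have "\<dots> \<le> (\<integral>s. indicator (ball t (r / c)) s * D s \<partial>lborel)"
        proof (rule Bochner_Integration.integral_mono')
          show "integrable lborel (\<lambda>s. indicator (ball t (r / c)) s * D s)"
            by (rule int) simp
          fix s
          have "s \<in> ball t (r / c)" if "s \<in> {0..2*pi}" "cis s \<in> ball (cis t) r"
          proof -
            have "c * \<bar>s - t\<bar> < r"
              using c(2)[OF that(1)] that(2) by (simp add: dist_norm norm_minus_commute)
            then have "\<bar>s - t\<bar> < r / c"
              using \<open>c > 0\<close> by (simp add: pos_less_divide_eq mult.commute)
            then show ?thesis by (simp add: dist_real_def abs_minus_commute)
          qed
          then show "indicator {0..2*pi} s * (indicator (ball (cis t) r) (cis s) * h (cis s))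
              \<le> indicator (ball t (r / c)) s * D s"
            using h by (auto simp: D_def split: split_indicator)
          show "0 \<le> indicator (ball t (r / c)) s * D s" by (simp add: D0)
        qed
        also have "\<dots> = measure \<nu> (ball t (r / c))"
          using measure_\<nu>[of "ball t (r / c)"] D0
          by (simp add: measure_def Bochner_Integration.integral_nonneg)
        finally show ?thesis .
      qed
      show "((\<lambda>r. (\<integral>\<xi>. indicator (ball (cis t) r) \<xi> * h \<xi> \<partial>mT) / r) \<longlongrightarrow> 0) (at_right 0)"
      proof (rule tendsto_sandwich[OF _ _ tendsto_const lim'])
        show "\<forall>\<^sub>F r in at_right 0. 0 \<le> (\<integral>\<xi>. indicator (ball (cis t) r) \<xi> * h \<xi> \<partial>mT) / r"
          using eventually_at_right_less[of "0::real"]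
          by eventually_elim (intro divide_nonneg_pos Bochner_Integration.integral_nonneg mult_nonneg_nonneg h, simp_all)
        show "\<forall>\<^sub>F r in at_right 0. (\<integral>\<xi>. indicator (ball (cis t) r) \<xi> * h \<xi> \<partial>mT) / r
            \<le> measure \<nu> (ball t (r / c)) / r"
          using eventually_at_right_less[of "0::real"]
          by eventually_elim (intro divide_right_mono bound, simp)
      qed
    qed
  qed
  then show ?thesis by (rule AE_mT_I)
qed

section \<open>Cauchy integrals inside the disc\<close>

text \<open>Expand the kernel into a geometric series; on the circle the n-th term has norm
  \<open>|f| * |w| ^ n\<close>, which justifies termwise integration. The measure is general because
  both \<open>mT\<close> and the spectral measure occur.\<close>

lemma cauchy_integral_sums:
  fixes N :: "complex measure"
  assumes f: "integrable N f" and circle: "AE \<xi> in N. cmod \<xi> = 1" and sets: "sets N = sets borel"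
    and w: "cmod w < 1"
  shows "(\<lambda>n. (\<integral>\<xi>. f \<xi> * cnj \<xi> ^ n \<partial>N) * w ^ n) sums (\<integral>\<xi>. f \<xi> / (1 - cnj \<xi> * w) \<partial>N)"
proof -
  note [measurable_cong] = sets
  note [measurable] = borel_measurable_integrable[OF f]
  let ?g = "\<lambda>n \<xi>. f \<xi> * cnj \<xi> ^ n * w ^ n"
  have norm_g: "AE \<xi> in N. norm (?g n \<xi>) = norm (f \<xi>) * norm w ^ n" for n
    using circle by eventually_elim (simp add: norm_mult norm_power)
  have g: "integrable N (?g n)" for n
  proof (rule Bochner_Integration.integrable_bound)
    show "integrable N (\<lambda>\<xi>. norm (f \<xi>) * norm w ^ n)"
      using f by (intro integrable_mult_left) simp
    show "AE \<xi> in N. norm (?g n \<xi>) \<le> norm (norm (f \<xi>) * norm w ^ n)"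
      using norm_g[of n] by eventually_elim simp
  qed measurable
  have "(\<lambda>n. integral\<^sup>L N (?g n)) sums (\<integral>\<xi>. (\<Sum>n. ?g n \<xi>) \<partial>N)"
  proof (rule sums_integral[OF g])
    show "AE \<xi> in N. summable (\<lambda>n. norm (?g n \<xi>))"
      using circle
    proof eventually_elim
      case (elim \<xi>)
      have "summable (\<lambda>n. norm (f \<xi>) * norm w ^ n)"
        using w by (intro summable_mult summable_geometric) simp
      then show ?case using elim by (simp add: norm_mult norm_power)
    qed
    have "(\<integral>\<xi>. norm (?g n \<xi>) \<partial>N) = (\<integral>\<xi>. norm (f \<xi>) \<partial>N) * norm w ^ n" for n
    proof -
      have "(\<integral>\<xi>. norm (?g n \<xi>) \<partial>N) = (\<integral>\<xi>. norm (f \<xi>) * norm w ^ n \<partial>N)"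
        using norm_g[of n] by (intro integral_cong_AE) measurable
      then show ?thesis by simp
    qed
    then show "summable (\<lambda>n. \<integral>\<xi>. norm (?g n \<xi>) \<partial>N)"
      using w by (simp only:) (intro summable_mult summable_geometric, simp)
  qed
  moreover have "integral\<^sup>L N (?g n) = (\<integral>\<xi>. f \<xi> * cnj \<xi> ^ n \<partial>N) * w ^ n" for n
    by simp
  moreover have "(\<integral>\<xi>. (\<Sum>n. ?g n \<xi>) \<partial>N) = (\<integral>\<xi>. f \<xi> / (1 - cnj \<xi> * w) \<partial>N)"
  proof (rule integral_cong_AE)
    show "AE \<xi> in N. (\<Sum>n. ?g n \<xi>) = f \<xi> / (1 - cnj \<xi> * w)"
      using circle
    proof eventually_elim
      case (elim \<xi>)
      then have "cmod (cnj \<xi> * w) < 1" using w by (simp add: norm_mult)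
      from sums_mult[OF geometric_sums[OF this], of "f \<xi>"]
      show ?case by (simp add: sums_iff power_mult_distrib mult.assoc)
    qed
  qed measurable
  ultimately show ?thesis by simp
qed

lemma integral_mT_cauchy_one:
  assumes "cmod w < 1"
  shows "(\<integral>\<xi>. 1 / (1 - cnj \<xi> * w) \<partial>mT) = 1"
proof -
  have "(\<lambda>n. (\<integral>\<xi>. 1 * cnj \<xi> ^ n \<partial>mT) * w ^ n) sums (\<integral>\<xi>. 1 / (1 - cnj \<xi> * w) \<partial>mT)"
    using assms by (intro cauchy_integral_sums AE_mT_circle) simp_all
  moreover have "(\<integral>\<xi>. 1 * cnj \<xi> ^ n \<partial>mT) * w ^ n = (if n = 0 then 1 else 0)" for n
    using integral_mT_cnj_power[of n] mT.prob_space by (cases "n = 0") auto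
  ultimately have "(\<lambda>n. if n = 0 then 1 else 0) sums (\<integral>\<xi>. 1 / (1 - cnj \<xi> * w) \<partial>mT)"
    by simp
  then show ?thesis
    using sums_unique2[OF _ sums_single[of 0 "\<lambda>_. 1::complex"]] by simp
qed

lemma integrable_bounded_mult:
  fixes f :: "'a \<Rightarrow> 'b::{real_normed_field, banach, second_countable_topology}"
  assumes f: "integrable N f" and [measurable]: "b \<in> borel_measurable N"
    and bound: "AE x in N. norm (b x) \<le> B"
  shows "integrable N (\<lambda>x. b x * f x)"
proof (rule Bochner_Integration.integrable_bound)
  note [measurable] = borel_measurable_integrable[OF f]
  show "(\<lambda>x. b x * f x) \<in> borel_measurable N" by simp
  show "integrable N (\<lambda>x. B * norm (f x))" using f by simp
  show "AE x in N. norm (b x * f x) \<le> norm (B * norm (f x))"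
    using bound
  proof eventually_elim
    case (elim x)
    then have "norm (b x) * norm (f x) \<le> \<bar>B\<bar> * norm (f x)"
      by (intro mult_right_mono) auto
    then show ?case by (simp add: norm_mult abs_mult)
  qed
qed

section \<open>Poisson kernel estimates and Fatou's theorem\<close>

definition poisson :: "real \<Rightarrow> complex \<Rightarrow> complex \<Rightarrow> real" where
  "poisson \<rho> z \<xi> = (1 - \<rho>\<^sup>2) / (cmod (\<xi> - of_real \<rho> * z))\<^sup>2"

lemma borel_measurable_poisson [measurable]: "poisson \<rho> z \<in> borel_measurable borel"
  unfolding poisson_def[abs_def] by measurable

lemma poisson_nonneg: "0 \<le> \<rho> \<Longrightarrow> \<rho> < 1 \<Longrightarrow> 0 \<le> poisson \<rho> z \<xi>"
  by (auto simp: poisson_def power_le_one intro!: divide_nonneg_nonneg)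

text \<open>The Poisson kernel is the real part of (1 + x) / (1 - x) = 2 / (1 - x) - 1 with x =
  \<open>cnj \<xi> * (of_real \<rho> * z)\<close>. This reduces its integrals to Cauchy
  integrals.\<close>

lemma poisson_eq:
  assumes "0 \<le> \<rho>" "\<rho> < 1" "cmod z = 1" "cmod \<xi> = 1"
  shows "poisson \<rho> z \<xi> = 2 * Re (1 / (1 - cnj \<xi> * (of_real \<rho> * z))) - 1"
proof -
  define x where "x = cnj \<xi> * (of_real \<rho> * z)"
  have x: "cmod x = \<rho>" using assms by (simp add: x_def norm_mult)
  have "\<xi> * cnj \<xi> = 1" using assms complex_norm_square[of \<xi>] by simp
  then have "\<xi> - of_real \<rho> * z = \<xi> * (1 - x)" by (simp add: x_def algebra_simps)
  then have 1: "cmod (\<xi> - of_real \<rho> * z) = cmod (1 - x)" using assms by (simp add: norm_mult)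
  have ne: "(cmod (1 - x))\<^sup>2 \<noteq> 0" using x assms by auto
  have sq: "(cmod (1 - x))\<^sup>2 = 1 - 2 * Re x + \<rho>\<^sup>2"
    using x cmod_power2[of x] by (simp add: cmod_power2 power2_diff)
  have "Re (1 / (1 - x)) = (1 - Re x) / (cmod (1 - x))\<^sup>2"
    by (simp add: Re_divide cmod_power2)
  then have "2 * Re (1 / (1 - x)) - 1 = (2 * (1 - Re x) - (cmod (1 - x))\<^sup>2) / (cmod (1 - x))\<^sup>2"
    using ne by (simp add: diff_divide_distrib)
  also have "2 * (1 - Re x) - (cmod (1 - x))\<^sup>2 = 1 - \<rho>\<^sup>2" by (simp add: sq)
  finally show ?thesis unfolding poisson_def 1 by (simp add: x_def)
qed

text \<open>The numerator is at most \<open>2 * (1 - \<rho>)\<close>. The distance from \<xi> to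
  \<open>\<rho> * z\<close> is at least \<open>1 - \<rho>\<close>, and also at least half of the
  chord from \<xi> to z, because passing from \<open>\<rho> * z\<close> to z costs only
  \<open>1 - \<rho>\<close>. The half, squared, turns 2 into 8.\<close>

lemma
  assumes "0 \<le> \<rho>" "\<rho> < 1" "cmod z = 1" "cmod \<xi> = 1"
  shows poisson_le: "poisson \<rho> z \<xi> \<le> 2 / (1 - \<rho>)"
    and poisson_le_chord: "\<xi> \<noteq> z \<Longrightarrow> poisson \<rho> z \<xi> \<le> 8 * (1 - \<rho>) / (cmod (\<xi> - z))\<^sup>2"
proof -
  let ?d = "cmod (\<xi> - of_real \<rho> * z)"
  have norm_z: "cmod ((1 - of_real \<rho>) * z) = 1 - \<rho>"
    using assms norm_of_real[of "1 - \<rho>", where 'a = complex] by (simp add: norm_mult)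
  have d1: "1 - \<rho> \<le> ?d"
    using norm_triangle_ineq2[of \<xi> "of_real \<rho> * z"] assms by (simp add: norm_mult)
  have "cmod (\<xi> - z) \<le> ?d + cmod ((1 - of_real \<rho>) * z)"
    using norm_triangle_ineq4[of "\<xi> - of_real \<rho> * z" "(1 - of_real \<rho>) * z"] by (simp add: algebra_simps)
  then have d2: "cmod (\<xi> - z) \<le> 2 * ?d" using d1 norm_z by simp
  have pos: "0 < ?d" using d1 assms by linarith
  have num: "1 - \<rho>\<^sup>2 \<le> 2 * (1 - \<rho>)"
    using assms power_one_right mult_nonneg_nonneg[of "1 - \<rho>" "1 - \<rho>"] by (simp add: power2_eq_square algebra_simps)
  have "poisson \<rho> z \<xi> \<le> 2 * (1 - \<rho>) / ?d\<^sup>2"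
    unfolding poisson_def using num by (rule divide_right_mono) simp
  also have "\<dots> \<le> 2 * (1 - \<rho>) / (1 - \<rho>)\<^sup>2"
    using d1 assms pos by (intro divide_left_mono power_mono mult_pos_pos zero_less_power) auto
  also have "\<dots> = 2 / (1 - \<rho>)"
    using assms unfolding power2_eq_square by (intro mult_divide_mult_cancel_right) simp
  finally show "poisson \<rho> z \<xi> \<le> 2 / (1 - \<rho>)" .
  assume "\<xi> \<noteq> z"
  have "poisson \<rho> z \<xi> \<le> 2 * (1 - \<rho>) / ?d\<^sup>2"
    unfolding poisson_def using num by (rule divide_right_mono) simp
  also have "\<dots> \<le> 2 * (1 - \<rho>) / (cmod (\<xi> - z) / 2)\<^sup>2"
    using d2 assms pos \<open>\<xi> \<noteq> z\<close> by (intro divide_left_mono power_mono mult_pos_pos zero_less_power) auto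
  finally show "poisson \<rho> z \<xi> \<le> 8 * (1 - \<rho>) / (cmod (\<xi> - z))\<^sup>2"
    by (simp add: power_divide)
qed

lemma integrable_poisson_mult:
  fixes g :: "complex \<Rightarrow> real"
  assumes "0 \<le> \<rho>" "\<rho> < 1" "cmod z = 1" and g: "integrable mT g"
  shows "integrable mT (\<lambda>\<xi>. poisson \<rho> z \<xi> * g \<xi>)"
proof (rule integrable_bounded_mult[OF g])
  show "AE \<xi> in mT. norm (poisson \<rho> z \<xi>) \<le> 2 / (1 - \<rho>)"
    using AE_mT_circle
    by eventually_elim (use assms poisson_le poisson_nonneg in simp)
qed measurable

lemma integrable_of_real_poisson_mult:
  fixes g :: "complex \<Rightarrow> complex"
  assumes "0 \<le> \<rho>" "\<rho> < 1" "cmod z = 1" and g: "integrable mT g"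
  shows "integrable mT (\<lambda>\<xi>. of_real (poisson \<rho> z \<xi>) * g \<xi>)"
proof (rule integrable_bounded_mult[OF g])
  show "AE \<xi> in mT. norm (complex_of_real (poisson \<rho> z \<xi>)) \<le> 2 / (1 - \<rho>)"
    using AE_mT_circle
    by eventually_elim (use assms poisson_le poisson_nonneg in simp)
qed measurable

lemma cauchy_kernel_bound:
  assumes "cmod w < 1"
  shows "AE \<xi> in mT. norm (1 / (1 - cnj \<xi> * w)) \<le> 1 / (1 - cmod w)"
  using AE_mT_circle
proof eventually_elim
  case (elim \<xi>)
  have "1 - cmod w \<le> cmod (1 - cnj \<xi> * w)"
    using norm_triangle_ineq2[of 1 "cnj \<xi> * w"] elim by (simp add: norm_mult)
  then show ?case
    unfolding norm_divide norm_one using assms by (intro divide_left_mono mult_pos_pos) auto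
qed

lemma integrable_cauchy_kernel_mult:
  assumes "integrable mT g" "cmod w < 1"
  shows "integrable mT (\<lambda>\<xi>. g \<xi> / (1 - cnj \<xi> * w))"
  using integrable_bounded_mult[OF assms(1) _ cauchy_kernel_bound[OF assms(2)]] by simp

lemma integral_poisson:
  assumes "0 \<le> \<rho>" "\<rho> < 1" "cmod z = 1"
  shows "(\<integral>\<xi>. poisson \<rho> z \<xi> \<partial>mT) = 1"
proof -
  let ?w = "of_real \<rho> * z"
  have w: "cmod ?w < 1" using assms by (simp add: norm_mult)
  have int: "integrable mT (\<lambda>\<xi>. 1 / (1 - cnj \<xi> * ?w))"
    using w by (intro integrable_cauchy_kernel_mult) simp_all
  have "(\<integral>\<xi>. poisson \<rho> z \<xi> \<partial>mT) = (\<integral>\<xi>. 2 * Re (1 / (1 - cnj \<xi> * ?w)) - 1 \<partial>mT)"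
    using AE_mT_circle assms by (intro integral_cong_AE) (auto simp: poisson_eq)
  also have "\<dots> = 2 * (\<integral>\<xi>. Re (1 / (1 - cnj \<xi> * ?w)) \<partial>mT) - 1"
    using int mT.prob_space by (subst Bochner_Integration.integral_diff) (auto intro!: integrable_Re integrable_mult_right simp del: Re_divide_numeral)
  also have "(\<integral>\<xi>. Re (1 / (1 - cnj \<xi> * ?w)) \<partial>mT) = 1"
    unfolding integral_Re[OF int] integral_mT_cauchy_one[OF w] by simp
  finally show ?thesis by simp
qed

lemma eventually_at_left_1: "\<forall>\<^sub>F \<rho> in at_left 1. 0 < \<rho> \<and> \<rho> < (1::real)"
  unfolding eventually_at_left_field by (rule exI[of _ 0]) simp

text \<open>Cut the circle into dyadic shells around z of scale \<open>2 ^ k * (1 - \<rho>)\<close>.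
  On a shell the chord bound is used at the inner radius, half of the outer one, whence 8 * 4 = 32.
  Beyond the last shell the distance is at least \<open>R / 2\<close>, which gives the same
  constant.\<close>

lemma poisson_dyadic_bound:
  assumes \<rho>: "0 \<le> \<rho>" "\<rho> < 1" and circle: "cmod z = 1" "cmod \<xi> = 1"
    and R: "0 < R" "R / 2 \<le> 2 ^ K * (1 - \<rho>)"
  shows "poisson \<rho> z \<xi> \<le>
    32 * (\<Sum>k\<le>K. indicator (ball z (2 ^ k * (1 - \<rho>))) \<xi> / (4 ^ k * (1 - \<rho>))) + 32 * (1 - \<rho>) / R\<^sup>2"
proof -
  define \<delta> where "\<delta> = 1 - \<rho>"
  have \<delta>: "\<delta> > 0" using \<rho> by (simp add: \<delta>_def)
  let ?d = "cmod (\<xi> - z)"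
  let ?t = "\<lambda>k. indicator (ball z (2 ^ k * \<delta>)) \<xi> / (4 ^ k * \<delta>) :: real"
  have t: "?t k = 1 / (4 ^ k * \<delta>)" if "?d < 2 ^ k * \<delta>" for k
    using that by (simp add: dist_norm norm_minus_commute)
  have sum_ge: "?t k \<le> (\<Sum>k\<le>K. ?t k)" if "k \<le> K" for k
    using that \<delta> by (intro member_le_sum) auto
  have far: "poisson \<rho> z \<xi> \<le> 8 * \<delta> / b\<^sup>2" if "0 < b" "b \<le> ?d" for b
  proof -
    have "poisson \<rho> z \<xi> \<le> 8 * \<delta> / ?d\<^sup>2"
    proof -
      have "\<xi> \<noteq> z" using that by auto
      then show ?thesis using poisson_le_chord[OF \<rho> circle] by (simp add: \<delta>_def)
    qed
    also have "\<dots> \<le> 8 * \<delta> / b\<^sup>2"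
      using that \<delta> by (intro divide_left_mono power_mono mult_pos_pos zero_less_power) auto
    finally show ?thesis .
  qed
  have "poisson \<rho> z \<xi> \<le> 32 * (\<Sum>k\<le>K. ?t k) + 32 * \<delta> / R\<^sup>2"
  proof (cases "\<exists>k\<le>K. ?d < 2 ^ k * \<delta>")
    case True
    \<comment> \<open>For the least such k the point lies outside the preceding ball, which bounds
      its distance from below.\<close>
    define k where "k = (LEAST k. ?d < 2 ^ k * \<delta>)"
    from True obtain k0 where "k0 \<le> K" "?d < 2 ^ k0 * \<delta>" by blast
    then have k: "?d < 2 ^ k * \<delta>" "k \<le> K"
      unfolding k_def using LeastI[of "\<lambda>k. ?d < 2 ^ k * \<delta>" k0] Least_le[of "\<lambda>k. ?d < 2 ^ k * \<delta>" k0] by auto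
    have "poisson \<rho> z \<xi> \<le> 32 / (4 ^ k * \<delta>)"
    proof (cases k)
      case 0
      have "poisson \<rho> z \<xi> \<le> 2 / \<delta>" using poisson_le[OF \<rho> circle] by (simp add: \<delta>_def)
      also have "\<dots> \<le> 32 / \<delta>" using \<delta> by (intro divide_right_mono) auto
      finally show ?thesis using 0 by simp
    next
      case (Suc j)
      then have "2 ^ j * \<delta> \<le> ?d"
        unfolding k_def using not_less_Least[of j "\<lambda>k. ?d < 2 ^ k * \<delta>"] by simp
      from far[OF _ this] have "poisson \<rho> z \<xi> \<le> 8 * \<delta> / (2 ^ j * \<delta>)\<^sup>2"
        using \<delta> by simp
      also have "(2 ^ j * \<delta>)\<^sup>2 = 4 ^ j * \<delta> * \<delta>"
        by (simp add: power2_eq_square power_mult_distrib[symmetric])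
      also have "8 * \<delta> / (4 ^ j * \<delta> * \<delta>) = 32 / (4 ^ k * \<delta>)"
        using \<delta> Suc by simp
      finally show ?thesis .
    qed
    also have "\<dots> = 32 * ?t k" using t[OF k(1)] by simp
    also have "\<dots> \<le> 32 * (\<Sum>k\<le>K. ?t k)" using sum_ge[OF k(2)] by simp
    also have "\<dots> \<le> 32 * (\<Sum>k\<le>K. ?t k) + 32 * \<delta> / R\<^sup>2" using \<delta> by simp
    finally show ?thesis .
  next
    case False
    then have "R / 2 \<le> ?d" using R(2) by (force simp: \<delta>_def not_less)
    from far[OF _ this] have "poisson \<rho> z \<xi> \<le> 32 * \<delta> / R\<^sup>2"
      using R by (simp add: power_divide)
    moreover have "0 \<le> 32 * (\<Sum>k\<le>K. ?t k)" using \<delta> by (simp add: sum_nonneg)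
    ultimately show ?thesis by simp
  qed
  then show ?thesis by (simp add: \<delta>_def)
qed

text \<open>The last dyadic radius has to reach \<open>R / 2\<close> to control the far part, and to
  stay below R so that every ball lies in the range where the density quotient is small. Minimality
  of K gives the upper bound.\<close>

lemma dyadic_scale:
  fixes \<delta> R :: real
  assumes "0 < \<delta>" "\<delta> \<le> R"
  obtains K where "R / 2 \<le> 2 ^ K * \<delta>" "2 ^ K * \<delta> \<le> R"
proof -
  define K where "K = (LEAST k. R / 2 \<le> 2 ^ k * \<delta>)"
  obtain n where "R / 2 / \<delta> < 2 ^ n" using real_arch_pow[of 2] by auto
  then have "R / 2 \<le> 2 ^ n * \<delta>" using assms by (simp add: field_simps)
  then have 1: "R / 2 \<le> 2 ^ K * \<delta>" unfolding K_def by (rule LeastI)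
  have "2 ^ K * \<delta> \<le> R"
  proof (cases K)
    case (Suc j)
    then have "2 ^ j * \<delta> < R / 2"
      unfolding K_def using not_less_Least[of j "\<lambda>k. R / 2 \<le> 2 ^ k * \<delta>"] by simp
    then show ?thesis using Suc by simp
  qed (use assms in simp)
  with 1 show ?thesis by (rule that)
qed

text \<open>The k-th shell contributes 32 * (1/2)^k times the density quotient at radius
  \<open>2 ^ k * \<delta>\<close>, so a small quotient below R makes the whole sum small by a
  geometric series, whatever the number of shells. The far term carries the factor \<delta>.\<close>

lemma poisson_tendsto_zero:
  fixes h :: "complex \<Rightarrow> real"
  assumes h: "integrable mT h" "\<And>z. 0 \<le> h z" and z: "cmod z = 1"
    and lim: "((\<lambda>r. (\<integral>\<xi>. indicator (ball z r) \<xi> * h \<xi> \<partial>mT) / r) \<longlongrightarrow> 0) (at_right 0)"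
  shows "((\<lambda>\<rho>. \<integral>\<xi>. poisson \<rho> z \<xi> * h \<xi> \<partial>mT) \<longlongrightarrow> 0) (at_left 1)"
proof (rule tendstoI)
  fix e :: real assume "e > 0"
  let ?A = "\<lambda>r. \<integral>\<xi>. indicator (ball z r) \<xi> * h \<xi> \<partial>mT"
  let ?H = "\<integral>\<xi>. h \<xi> \<partial>mT"
  have H: "0 \<le> ?H" using h by simp
  have int: "integrable mT (\<lambda>\<xi>. indicator B \<xi> * h \<xi>)" if "B \<in> sets borel" for B
    using integrable_real_mult_indicator[of B mT h] that h(1) by (simp add: mult.commute[of "h _"])
  have "\<forall>\<^sub>F r in at_right 0. dist (?A r / r) 0 < e / 128"
    using lim \<open>e > 0\<close> by (intro tendstoD) auto
  then obtain b where b: "b > 0" "\<And>r. 0 < r \<Longrightarrow> r < b \<Longrightarrow> \<bar>?A r / r\<bar> < e / 128"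
    by (auto simp: eventually_at_right_field)
  \<comment> \<open>\<open>R \<le> 1\<close> keeps \<rho> nonnegative, and \<open>R < b\<close> lets
    the bound e / 128 apply to every dyadic ball: 32 * e / 128 times a geometric sum of at most 2
    gives e / 2.\<close>
  define R where "R = min 1 (b / 2)"
  have R: "0 < R" "R < b" "R \<le> 1" using b by (auto simp: R_def)
  \<comment> \<open>This choice keeps the far term below e / 2; the summand 1 keeps the denominator
    positive.\<close>
  define d where "d = min R (e * R\<^sup>2 / (64 * (?H + 1)))"
  have "0 < d" using R \<open>e > 0\<close> H by (auto simp: d_def)
  have main: "dist (\<integral>\<xi>. poisson \<rho> z \<xi> * h \<xi> \<partial>mT) 0 < e" if \<rho>: "1 - d < \<rho>" "\<rho> < 1" for \<rho>
  proof -
    define \<delta> where "\<delta> = 1 - \<rho>"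
    have \<delta>: "0 < \<delta>" "\<delta> \<le> R" "\<delta> < e * R\<^sup>2 / (64 * (?H + 1))" "0 \<le> \<rho>"
      using \<rho> R by (auto simp: \<delta>_def d_def)
    obtain K where K: "R / 2 \<le> 2 ^ K * \<delta>" "2 ^ K * \<delta> \<le> R"
      using dyadic_scale[OF \<delta>(1,2)] .
    have "(\<integral>\<xi>. poisson \<rho> z \<xi> * h \<xi> \<partial>mT) \<le> (\<integral>\<xi>. (\<Sum>k\<le>K. 32 / (4 ^ k * \<delta>) *
        (indicator (ball z (2 ^ k * \<delta>)) \<xi> * h \<xi>)) + 32 * \<delta> / R\<^sup>2 * h \<xi> \<partial>mT)"
    proof (rule integral_mono_AE)
      show "integrable mT (\<lambda>\<xi>. poisson \<rho> z \<xi> * h \<xi>)"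
        using \<rho> \<delta> z h by (intro integrable_poisson_mult) auto
      show "integrable mT (\<lambda>\<xi>. (\<Sum>k\<le>K. 32 / (4 ^ k * \<delta>) *
        (indicator (ball z (2 ^ k * \<delta>)) \<xi> * h \<xi>)) + 32 * \<delta> / R\<^sup>2 * h \<xi>)"
        using h by (intro Bochner_Integration.integrable_add Bochner_Integration.integrable_sum
          integrable_mult_right int) auto
      show "AE \<xi> in mT. poisson \<rho> z \<xi> * h \<xi> \<le> (\<Sum>k\<le>K. 32 / (4 ^ k * \<delta>) *
        (indicator (ball z (2 ^ k * \<delta>)) \<xi> * h \<xi>)) + 32 * \<delta> / R\<^sup>2 * h \<xi>"
        using AE_mT_circle
      proof eventually_elim
        case (elim \<xi>)
        have "poisson \<rho> z \<xi> \<le> 32 * (\<Sum>k\<le>K. indicator (ball z (2 ^ k * \<delta>)) \<xi> / (4 ^ k * \<delta>)) + 32 * \<delta> / R\<^sup>2"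
          using poisson_dyadic_bound[of \<rho> z \<xi> R K] \<rho> \<delta> z elim R K by (simp add: \<delta>_def)
        from mult_right_mono[OF this h(2)[of \<xi>]]
        have "poisson \<rho> z \<xi> * h \<xi> \<le>
          (32 * (\<Sum>k\<le>K. indicator (ball z (2 ^ k * \<delta>)) \<xi> / (4 ^ k * \<delta>)) + 32 * \<delta> / R\<^sup>2) * h \<xi>" .
        also have "\<dots> = (\<Sum>k\<le>K. 32 / (4 ^ k * \<delta>) *
        (indicator (ball z (2 ^ k * \<delta>)) \<xi> * h \<xi>)) + 32 * \<delta> / R\<^sup>2 * h \<xi>"
          by (simp add: distrib_right sum_distrib_left sum_distrib_right mult.assoc)
        finally show ?case .
      qed
    qed
    also have "\<dots> = (\<Sum>k\<le>K. 32 / (4 ^ k * \<delta>) * ?A (2 ^ k * \<delta>)) + 32 * \<delta> / R\<^sup>2 * ?H"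
      using h int by (subst Bochner_Integration.integral_add) auto
    also have "\<dots> \<le> (\<Sum>k\<le>K. e / 4 * (1/2) ^ k) + 32 * \<delta> / R\<^sup>2 * ?H"
    proof (intro add_right_mono sum_mono)
      fix k assume "k \<in> {..K}"
      then have "(2::real) ^ k * \<delta> \<le> 2 ^ K * \<delta>"
        using \<delta> by (intro mult_right_mono power_increasing) auto
      then have "2 ^ k * \<delta> < b" using K R by linarith
      then have "\<bar>?A (2 ^ k * \<delta>) / (2 ^ k * \<delta>)\<bar> < e / 128"
        using \<delta> by (intro b(2)) auto
      then have "?A (2 ^ k * \<delta>) / (2 ^ k * \<delta>) \<le> e / 128"
        by linarith
      then have "32 * (1/2) ^ k * (?A (2 ^ k * \<delta>) / (2 ^ k * \<delta>)) \<le> 32 * (1/2) ^ k * (e / 128)"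
        by (intro mult_left_mono) auto
      moreover have "32 * (1/2) ^ k * (?A (2 ^ k * \<delta>) / (2 ^ k * \<delta>)) = 32 / (4 ^ k * \<delta>) * ?A (2 ^ k * \<delta>)"
        using \<delta> by (simp add: power_divide power_mult_distrib[symmetric] field_simps)
      ultimately show "32 / (4 ^ k * \<delta>) * ?A (2 ^ k * \<delta>) \<le> e / 4 * (1/2) ^ k"
        by simp
    qed
    also have "\<dots> < e / 2 + e / 2"
    proof (rule add_le_less_mono)
      have "(\<Sum>k\<le>K. e / 4 * (1/2) ^ k) = e / 4 * (\<Sum>k\<le>K. (1/2) ^ k)"
        by (simp only: sum_distrib_left)
      also have "(\<Sum>k\<le>K. (1/2::real) ^ k) \<le> 2"
        by (induction K) (simp_all add: sum_gp_basic[symmetric] sum_gp0)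
      finally show "(\<Sum>k\<le>K. e / 4 * (1/2) ^ k) \<le> e / 2"
        using \<open>e > 0\<close> by simp
      have "32 * \<delta> / R\<^sup>2 * ?H \<le> 32 * \<delta> / R\<^sup>2 * (?H + 1)"
        using \<delta> by (intro mult_left_mono) auto
      also have "\<dots> < e / 2"
        using \<delta>(3) H R(1) by (simp add: field_simps)
      finally show "32 * \<delta> / R\<^sup>2 * ?H < e / 2" .
    qed
    finally have "(\<integral>\<xi>. poisson \<rho> z \<xi> * h \<xi> \<partial>mT) < e" by simp
    moreover have "0 \<le> (\<integral>\<xi>. poisson \<rho> z \<xi> * h \<xi> \<partial>mT)"
      using h \<rho> \<delta> by (intro Bochner_Integration.integral_nonneg mult_nonneg_nonneg poisson_nonneg) auto
    ultimately show ?thesis by simp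
  qed
  show "\<forall>\<^sub>F \<rho> in at_left 1. dist (\<integral>\<xi>. poisson \<rho> z \<xi> * h \<xi> \<partial>mT) 0 < e"
    unfolding eventually_at_left_field using main \<open>0 < d\<close> by (intro exI[of _ "1 - d"]) auto
qed

text \<open>For rational \<open>q\<close> the measure with density \<open>max (g - q) 0\<close> does not charge the set where \<open>g \<le> q\<close>, so
  that it has vanishing Poisson integrals almost everywhere there.\<close>

lemma AE_poisson_limsup:
  fixes g :: "complex \<Rightarrow> real"
  assumes g: "integrable mT g"
  shows "AE z in mT. \<forall>e>0. \<forall>\<^sub>F \<rho> in at_left 1. (\<integral>\<xi>. poisson \<rho> z \<xi> * g \<xi> \<partial>mT) < g z + e"
proof -
  define h where "h q z = max (g z - q) 0" for q z
  have h: "integrable mT (h q)" "\<And>z. 0 \<le> h q z" for q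
    using g unfolding h_def by (auto intro!: Bochner_Integration.integrable_max)
  have "AE z in mT. \<forall>q\<in>\<rat>. h q z = 0 \<longrightarrow>
    ((\<lambda>\<rho>. \<integral>\<xi>. poisson \<rho> z \<xi> * h q \<xi> \<partial>mT) \<longlongrightarrow> 0) (at_left 1)"
  proof (subst AE_ball_countable[OF countable_rat], intro ballI)
    fix q
    show "AE z in mT. h q z = 0 \<longrightarrow>
        ((\<lambda>\<rho>. \<integral>\<xi>. poisson \<rho> z \<xi> * h q \<xi> \<partial>mT) \<longlongrightarrow> 0) (at_left 1)"
      using AE_mT_density_zero[OF h, of q] AE_mT_circle
      by eventually_elim (use h poisson_tendsto_zero in blast)
  qed
  with AE_mT_circle show ?thesis
  proof eventually_elim
    case (elim z)
    show ?case
    proof (intro allI impI)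
      fix e :: real assume "e > 0"
      then obtain q where q: "q \<in> \<rat>" "g z < q" "q < g z + e / 2"
        using Rats_dense_in_real[of "g z" "g z + e / 2"] by auto
      then have "h q z = 0" by (simp add: h_def)
      with elim q have "((\<lambda>\<rho>. \<integral>\<xi>. poisson \<rho> z \<xi> * h q \<xi> \<partial>mT) \<longlongrightarrow> 0) (at_left 1)"
        by blast
      then have "\<forall>\<^sub>F \<rho> in at_left 1. (\<integral>\<xi>. poisson \<rho> z \<xi> * h q \<xi> \<partial>mT) < e / 2"
        using \<open>e > 0\<close> by (intro order_tendstoD) auto
      moreover have "\<forall>\<^sub>F \<rho> in at_left 1. 0 < \<rho> \<and> \<rho> < (1::real)"
        by (rule eventually_at_left_1)
      ultimately show "\<forall>\<^sub>F \<rho> in at_left 1. (\<integral>\<xi>. poisson \<rho> z \<xi> * g \<xi> \<partial>mT) < g z + e"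
      proof eventually_elim
        case (elim \<rho>)
        have one: "integrable mT (\<lambda>\<xi>. poisson \<rho> z \<xi>)"
          using integrable_poisson_mult[of \<rho> z "\<lambda>_. 1"] elim \<open>cmod z = 1\<close> by simp
        \<comment> \<open>Pointwise g is at most \<open>h q + q\<close>, and the Poisson integral of
          the constant q is q.\<close>
        have "(\<integral>\<xi>. poisson \<rho> z \<xi> * g \<xi> \<partial>mT) \<le> (\<integral>\<xi>. poisson \<rho> z \<xi> * h q \<xi> + poisson \<rho> z \<xi> * q \<partial>mT)"
        proof (rule integral_mono)
          fix \<xi>
          show "poisson \<rho> z \<xi> * g \<xi> \<le> poisson \<rho> z \<xi> * h q \<xi> + poisson \<rho> z \<xi> * q"
            unfolding distrib_left[symmetric] using elim
            by (intro mult_left_mono poisson_nonneg) (auto simp: h_def)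
        qed (use elim \<open>cmod z = 1\<close> g h one in \<open>auto intro!: integrable_poisson_mult integrable_mult_left\<close>)
        also have "\<dots> = (\<integral>\<xi>. poisson \<rho> z \<xi> * h q \<xi> \<partial>mT) + q"
          using integral_poisson[of \<rho> z] integrable_poisson_mult[of \<rho> z "h q"] elim \<open>cmod z = 1\<close> h one
          by (subst Bochner_Integration.integral_add) auto
        finally show ?case using elim q by linarith
      qed
    qed
  qed
qed

text \<open>The upper estimate applied to g and to -g encloses the Poisson integrals.\<close>

lemma AE_poisson_tendsto_real:
  fixes g :: "complex \<Rightarrow> real"
  assumes g: "integrable mT g"
  shows "AE z in mT. ((\<lambda>\<rho>. \<integral>\<xi>. poisson \<rho> z \<xi> * g \<xi> \<partial>mT) \<longlongrightarrow> g z) (at_left 1)"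
proof -
  have "integrable mT (\<lambda>z. - g z)" using g by simp
  from AE_poisson_limsup[OF g] AE_poisson_limsup[OF this] show ?thesis
  proof eventually_elim
    case (elim z)
    show ?case
    proof (rule order_tendstoI)
      fix a assume "a > g z"
      with elim(1)[rule_format, of "a - g z"]
      show "\<forall>\<^sub>F \<rho> in at_left 1. (\<integral>\<xi>. poisson \<rho> z \<xi> * g \<xi> \<partial>mT) < a" by simp
    next
      fix a assume "a < g z"
      with elim(2)[rule_format, of "g z - a"]
      show "\<forall>\<^sub>F \<rho> in at_left 1. a < (\<integral>\<xi>. poisson \<rho> z \<xi> * g \<xi> \<partial>mT)" by simp
    qed
  qed
qed

theorem AE_poisson_tendsto:
  fixes g :: "complex \<Rightarrow> complex"
  assumes g: "integrable mT g"
  shows "AE z in mT. ((\<lambda>\<rho>. \<integral>\<xi>. of_real (poisson \<rho> z \<xi>) * g \<xi> \<partial>mT) \<longlongrightarrow> g z) (at_left 1)"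
proof -
  have "integrable mT (\<lambda>z. Re (g z))" "integrable mT (\<lambda>z. Im (g z))" using g by auto
  from AE_poisson_tendsto_real[OF this(1)] AE_poisson_tendsto_real[OF this(2)] AE_mT_circle show ?thesis
  proof eventually_elim
    case (elim z)
    have *: "((\<lambda>\<rho>. Complex (\<integral>\<xi>. poisson \<rho> z \<xi> * Re (g \<xi>) \<partial>mT) (\<integral>\<xi>. poisson \<rho> z \<xi> * Im (g \<xi>) \<partial>mT))
      \<longlongrightarrow> Complex (Re (g z)) (Im (g z))) (at_left 1)"
      using elim by (intro tendsto_Complex)
    have "\<forall>\<^sub>F \<rho> in at_left 1. 0 < \<rho> \<and> \<rho> < (1::real)"
      by (rule eventually_at_left_1)
    then have "\<forall>\<^sub>F \<rho> in at_left 1. Complex (\<integral>\<xi>. poisson \<rho> z \<xi> * Re (g \<xi>) \<partial>mT) (\<integral>\<xi>. poisson \<rho> z \<xi> * Im (g \<xi>) \<partial>mT)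
      = (\<integral>\<xi>. of_real (poisson \<rho> z \<xi>) * g \<xi> \<partial>mT)"
    proof eventually_elim
      case (elim \<rho>)
      have int: "integrable mT (\<lambda>\<xi>. of_real (poisson \<rho> z \<xi>) * g \<xi>)"
        using elim \<open>cmod z = 1\<close> g by (intro integrable_of_real_poisson_mult) simp_all
      show ?case
        using integral_Re[OF int] integral_Im[OF int] by (simp add: complex_eq_iff)
    qed
    from Lim_transform_eventually[OF * this] show ?case by simp
  qed
qed

text \<open>Reflect r z to z / r. With x = \<open>cnj \<xi> * z / r\<close> the Poisson kernel there
  is the Cauchy kernel 1 / (1 - x) plus its conjugate minus 1, and the conjugate minus 1 is exactly
  the exterior kernel. The Cauchy kernel integrates to 0 against g by \<open>orth\<close>, so the
  exterior integral is a Poisson integral of g.\<close>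

lemma AE_exterior_cauchy_tendsto:
  assumes g: "integrable mT g" and orth: "\<And>n. (\<integral>\<xi>. g \<xi> * cnj \<xi> ^ n \<partial>mT) = 0"
  shows "AE z in mT. ((\<lambda>r. \<integral>\<xi>. g \<xi> * (\<xi> / (of_real r * z - \<xi>)) \<partial>mT) \<longlongrightarrow> g z) (at_right 1)"
  using AE_poisson_tendsto[OF g] AE_mT_circle
proof eventually_elim
  case (elim z)
  have [measurable]: "g \<in> borel_measurable borel" using borel_measurable_integrable[OF g] by simp
  have "filterlim (\<lambda>r::real. 1 / r) (at_left 1) (at_right 1)"
    by real_asymp
  from filterlim_compose[OF elim(1) this]
  have *: "((\<lambda>r. \<integral>\<xi>. of_real (poisson (1 / r) z \<xi>) * g \<xi> \<partial>mT) \<longlongrightarrow> g z) (at_right 1)" .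
  have "\<forall>\<^sub>F r in at_right 1. (1::real) < r"
    by (rule eventually_at_right_less)
  then have "\<forall>\<^sub>F r in at_right 1. (\<integral>\<xi>. of_real (poisson (1 / r) z \<xi>) * g \<xi> \<partial>mT) =
      (\<integral>\<xi>. g \<xi> * (\<xi> / (of_real r * z - \<xi>)) \<partial>mT)"
  proof eventually_elim
    case (elim r)
    let ?w = "of_real (1 / r) * z"
    have w: "cmod ?w < 1" using elim \<open>cmod z = 1\<close> by (simp add: norm_divide)
    have zero: "(\<integral>\<xi>. g \<xi> / (1 - cnj \<xi> * ?w) \<partial>mT) = 0"
      using cauchy_integral_sums[OF g AE_mT_circle sets_mT w] by (simp add: orth sums_iff)
    have int1: "integrable mT (\<lambda>\<xi>. g \<xi> / (1 - cnj \<xi> * ?w))"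
      by (rule integrable_cauchy_kernel_mult[OF g w])
    have int2: "integrable mT (\<lambda>\<xi>. of_real (poisson (1 / r) z \<xi>) * g \<xi>)"
      using elim \<open>cmod z = 1\<close> g by (intro integrable_of_real_poisson_mult) simp_all
    have "(\<integral>\<xi>. g \<xi> * (\<xi> / (of_real r * z - \<xi>)) \<partial>mT) =
      (\<integral>\<xi>. of_real (poisson (1 / r) z \<xi>) * g \<xi> - g \<xi> / (1 - cnj \<xi> * ?w) \<partial>mT)"
    proof (rule integral_cong_AE)
      show "AE \<xi> in mT. g \<xi> * (\<xi> / (of_real r * z - \<xi>)) =
          of_real (poisson (1 / r) z \<xi>) * g \<xi> - g \<xi> / (1 - cnj \<xi> * ?w)"
        using AE_mT_circle
      proof eventually_elim
        case (elim \<xi>)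
        define x where "x = cnj \<xi> * ?w"
        have "poisson (1 / r) z \<xi> = 2 * Re (1 / (1 - x)) - 1"
          using poisson_eq[of "1 / r" z \<xi>] elim \<open>1 < r\<close> \<open>cmod z = 1\<close> by (simp add: x_def)
        then have "complex_of_real (poisson (1 / r) z \<xi>) = 1 / (1 - x) + cnj (1 / (1 - x)) - 1"
          by (simp only: complex_add_cnj) simp
        moreover have "cnj (1 / (1 - x)) - 1 = \<xi> / (of_real r * z - \<xi>)"
        proof -
          have "cmod x = cmod ?w" unfolding x_def norm_mult[of "cnj \<xi>"] using elim by simp
          with w have "cmod x < 1" by simp
          then have ne: "1 - cnj x \<noteq> 0" by (metis complex_mod_cnj eq_iff_diff_eq_0 less_irrefl norm_one)
          have zz: "z * cnj z = 1" using \<open>cmod z = 1\<close> complex_norm_square[of z] by simp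
          have cx: "of_real r * z * cnj x = \<xi>"
            using \<open>1 < r\<close> zz by (simp add: x_def field_simps)
          have "cnj (1 / (1 - x)) - 1 = cnj x / (1 - cnj x)" using ne by (simp add: field_simps)
          also have "\<dots> = (of_real r * z * cnj x) / (of_real r * z * (1 - cnj x))"
            using \<open>1 < r\<close> \<open>cmod z = 1\<close> by (intro mult_divide_mult_cancel_left[symmetric]) auto
          also have "of_real r * z * (1 - cnj x) = of_real r * z - \<xi>"
            unfolding right_diff_distrib cx by simp
          finally show ?thesis by (simp add: cx)
        qed
        ultimately have "complex_of_real (poisson (1 / r) z \<xi>) = 1 / (1 - x) + \<xi> / (of_real r * z - \<xi>)"
          by (simp add: algebra_simps)
        then have "g \<xi> * (\<xi> / (of_real r * z - \<xi>)) = of_real (poisson (1 / r) z \<xi>) * g \<xi> - g \<xi> / (1 - x)"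
          by (simp add: algebra_simps)
        then show ?case unfolding x_def .
      qed
    qed measurable
    also have "\<dots> = (\<integral>\<xi>. of_real (poisson (1 / r) z \<xi>) * g \<xi> \<partial>mT)"
      using zero int1 int2 by simp
    finally show ?case ..
  qed
  from Lim_transform_eventually[OF * this] show ?case .
qed

subsection \<open>Uniqueness theorem for bounded holomorphic functions\<close>

text \<open>Integrate the Taylor series termwise; only the constant term survives, since positive
  powers have mean zero.\<close>

lemma integral_mT_holomorphic:
  assumes F: "F holomorphic_on ball 0 1" and [measurable]: "F \<in> borel_measurable borel"
    and \<rho>: "0 \<le> \<rho>" "\<rho> < 1"
  shows "(\<integral>z. F (of_real \<rho> * z) \<partial>mT) = F 0"
proof -
  define c where "c n = (deriv ^^ n) F 0 / fact n" for n
  have F: "(\<lambda>n. c n * w ^ n) sums F w" if "cmod w < 1" for w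
    using holomorphic_power_series[OF F, of w] that by (simp add: c_def)
  let ?g = "\<lambda>n z. c n * (of_real \<rho> * z) ^ n"
  have norm_g: "norm (?g n z) = norm (c n * of_real \<rho> ^ n)" if "cmod z = 1" for n z
    using that by (simp add: norm_mult norm_power)
  have summable: "summable (\<lambda>n. norm (c n * of_real \<rho> ^ n))"
  proof (rule powser_insidea)
    \<comment> \<open>Convergence at a radius strictly between \<rho> and 1 yields absolute
      convergence at \<rho>.\<close>
    show "summable (\<lambda>n. c n * of_real ((\<rho> + 1) / 2) ^ n)"
      using F[of "of_real ((\<rho> + 1) / 2)"] \<rho> unfolding norm_of_real by (auto simp: sums_iff)
    show "norm (complex_of_real \<rho>) < norm (complex_of_real ((\<rho> + 1) / 2))"
      using \<rho> unfolding norm_of_real by simp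
  qed
  have AE_g: "AE z in mT. norm (?g n z) = norm (c n * of_real \<rho> ^ n)" for n
    using AE_mT_circle by eventually_elim (rule norm_g)
  have "(\<lambda>n. integral\<^sup>L mT (?g n)) sums (\<integral>z. (\<Sum>n. ?g n z) \<partial>mT)"
  proof (rule sums_integral)
    show "integrable mT (?g n)" for n
      using AE_g[of n] by (intro mT.integrable_const_bound[of _ "norm (c n * of_real \<rho> ^ n)"]) auto
    show "AE z in mT. summable (\<lambda>n. norm (?g n z))"
      using AE_mT_circle
    proof eventually_elim
      case (elim z)
      show ?case using summable by (simp only: norm_g[OF elim])
    qed
    have "(\<integral>z. norm (?g n z) \<partial>mT) = norm (c n * of_real \<rho> ^ n)" for n
    proof -
      have "(\<integral>z. norm (?g n z) \<partial>mT) = (\<integral>z. norm (c n * of_real \<rho> ^ n) \<partial>mT)"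
        using AE_g[of n] by (intro integral_cong_AE) measurable
      then show ?thesis using mT.prob_space by simp
    qed
    then show "summable (\<lambda>n. \<integral>z. norm (?g n z) \<partial>mT)" using summable by simp
  qed
  moreover have "integral\<^sup>L mT (?g n) = (if n = 0 then F 0 else 0)" for n
  proof (cases "n = 0")
    case True
    then show ?thesis using mT.prob_space by (simp add: c_def)
  next
    case False
    have "integral\<^sup>L mT (?g n) = (c n * of_real \<rho> ^ n) * (\<integral>z. z ^ n \<partial>mT)"
      unfolding integral_mult_right_zero[symmetric] by (simp add: power_mult_distrib mult.assoc)
    then show ?thesis using integral_mT_power[of n] False by simp
  qed
  moreover have "(\<integral>z. (\<Sum>n. ?g n z) \<partial>mT) = (\<integral>z. F (of_real \<rho> * z) \<partial>mT)"
  proof (rule integral_cong_AE)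
    show "AE z in mT. (\<Sum>n. ?g n z) = F (of_real \<rho> * z)"
      using AE_mT_circle
    proof eventually_elim
      case (elim z)
      then show ?case using F[of "of_real \<rho> * z"] \<rho> by (simp add: norm_mult sums_iff)
    qed
  qed measurable
  ultimately have "(\<lambda>n. if n = 0 then F 0 else 0) sums (\<integral>z. F (of_real \<rho> * z) \<partial>mT)"
    by simp
  then show ?thesis
    using sums_unique2[OF _ sums_single[of 0 "\<lambda>_. F 0"]] by simp
qed

text \<open>The mean value at the origin carries information only once a zero there has been divided
  out. Defining g as an explicit quotient makes its Borel measurability on the whole plane
  evident.\<close>

lemma holomorphic_factor_zero_at_0:
  assumes h: "h holomorphic_on ball 0 1" and ne: "w0 \<in> ball 0 1" "h w0 \<noteq> 0"
    and [measurable]: "h \<in> borel_measurable borel"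
  obtains g k where "g holomorphic_on ball 0 1" "g \<in> borel_measurable borel" "g 0 \<noteq> 0"
    "\<And>w. w \<in> ball 0 1 \<Longrightarrow> h w = w ^ k * g w"
proof -
  define c where "c n = (deriv ^^ n) h 0 / fact n" for n
  have h: "(\<lambda>n. c n * w ^ n) sums h w" if "w \<in> ball 0 1" for w
    using holomorphic_power_series[OF h that] by (simp add: c_def)
  have "\<exists>n. c n \<noteq> 0"
  proof (rule ccontr)
    assume "\<not> (\<exists>n. c n \<noteq> 0)"
    then show False using h[OF ne(1)] ne(2) by (simp add: sums_iff)
  qed
  define k where "k = (LEAST n. c n \<noteq> 0)"
  have k: "c k \<noteq> 0" "\<And>n. n < k \<Longrightarrow> c n = 0"
    using LeastI_ex[OF \<open>\<exists>n. c n \<noteq> 0\<close>] unfolding k_def by (auto dest: not_less_Least)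
  define g where "g w = (if w = 0 then c k else h w / w ^ k)" for w
  have hg: "h w = w ^ k * g w" if w: "w \<in> ball 0 1" for w
  proof (cases "w = 0")
    case True
    have "h 0 = c 0" using h[of 0] powser_sums_zero_iff[of c "h 0"] by simp
    then show ?thesis using True k by (cases "k = 0") (auto simp: g_def)
  qed (simp add: g_def)
  have "(\<lambda>n. c (n + k) * (w - 0) ^ n) sums g w" if w: "w \<in> ball 0 1" for w
  proof (cases "w = 0")
    case True
    then show ?thesis using powser_sums_zero_iff[of "\<lambda>n. c (n + k)" "c k"] by (simp add: g_def)
  next
    case False
    have "(\<lambda>n. c (n + k) * w ^ (n + k)) sums h w"
      using h[OF w] sums_zero_iff_shift[of k "\<lambda>n. c n * w ^ n" "h w"] k by simp
    from sums_divide[OF this, of "w ^ k"] show ?thesis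
      using False by (simp add: g_def power_add)
  qed
  then have "g holomorphic_on ball 0 1" by (rule power_series_holomorphic)
  moreover have "g \<in> borel_measurable borel" unfolding g_def[abs_def] by measurable
  moreover have "g 0 \<noteq> 0" using k by (simp add: g_def)
  ultimately show ?thesis using hg that by blast
qed

text \<open>If \<open>h\<close> had vanishing radial limits on a set \<open>E\<close> of positive measure, then multiplying it with
  \<open>exp (A S)\<close>, where \<open>Re S\<close> is the Poisson integral of the indicator function of \<open>E\<close>, would blow up
  the value at the origin as \<open>A\<close> grows, but keep the boundary values bounded.\<close>

theorem AE_radial_limit_nonzero:
  assumes h: "h holomorphic_on ball 0 1" and hm[measurable]: "h \<in> borel_measurable borel"
    and bound: "\<And>w. w \<in> ball 0 1 \<Longrightarrow> cmod (h w) \<le> B"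
    and ne: "w0 \<in> ball 0 1" "h w0 \<noteq> 0"
  shows "AE z in mT. \<not> ((\<lambda>\<rho>. h (of_real \<rho> * z)) \<longlongrightarrow> 0) (at_left 1)"
proof -
  obtain g k where g: "g holomorphic_on ball 0 1"
      and [measurable]: "g \<in> borel_measurable borel" and g0: "g 0 \<noteq> 0"
      and hg: "\<And>w. w \<in> ball 0 1 \<Longrightarrow> h w = w ^ k * g w"
    using holomorphic_factor_zero_at_0[OF h ne hm] by metis
  \<comment> \<open>The radii start at 1/2, so that dividing by \<open>w ^ k\<close> costs at most
    the factor \<open>2 ^ k\<close>.\<close>
  define \<rho> where "\<rho> n = 1 - inverse (real n + 2)" for n
  have \<rho>: "1 / 2 \<le> \<rho> n" "\<rho> n < 1" for n
    by (auto simp: \<rho>_def field_simps)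
  have "\<rho> \<longlonglongrightarrow> 1"
    unfolding \<rho>_def by real_asymp
  then have lim_\<rho>: "filterlim \<rho> (at_left 1) sequentially"
    using \<rho> by (intro filterlim_at_withinI) (auto simp: less_imp_neq)
  \<comment> \<open>Along a sequence of radii, convergence to 0 is a condition with countable
    quantifiers, so E is Borel; a vanishing radial limit forces membership in E.\<close>
  define E where "E = {z. \<forall>j::nat. \<exists>N::nat. \<forall>n\<in>{N..}. cmod (h (of_real (\<rho> n) * z)) < inverse (real (Suc j))}"
  have [measurable]: "E \<in> sets borel" unfolding E_def by measurable
  have E_lim: "(\<lambda>n. h (of_real (\<rho> n) * z)) \<longlonglongrightarrow> 0 \<longleftrightarrow> z \<in> E" for z
  proof
    assume lim: "(\<lambda>n. h (of_real (\<rho> n) * z)) \<longlonglongrightarrow> 0"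
    have "\<exists>N. \<forall>n\<in>{N..}. cmod (h (of_real (\<rho> n) * z)) < inverse (real (Suc j))" for j
      using LIMSEQ_D[OF lim, of "inverse (real (Suc j))"] by (simp add: Ball_def)
    then show "z \<in> E" unfolding E_def by blast
  next
    assume "z \<in> E"
    show "(\<lambda>n. h (of_real (\<rho> n) * z)) \<longlonglongrightarrow> 0"
      unfolding LIMSEQ_iff
    proof (intro allI impI)
      fix e :: real assume "e > 0"
      then obtain j where j: "inverse (real (Suc j)) < e" using reals_Archimedean by blast
      obtain N where "\<And>n. n \<ge> N \<Longrightarrow> cmod (h (of_real (\<rho> n) * z)) < inverse (real (Suc j))"
        using \<open>z \<in> E\<close> unfolding E_def by blast
      with j show "\<exists>N. \<forall>n\<ge>N. norm (h (of_real (\<rho> n) * z) - 0) < e" by (intro exI[of _ N]) force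
    qed
  qed
  let ?m = "measure mT E"
  have B: "0 \<le> B" using bound[of 0] norm_ge_zero[of "h 0"] by (simp add: order_trans del: norm_ge_zero)
  have ind: "integrable mT (\<lambda>\<xi>. indicator E \<xi> :: real)"
    by (rule mT.integrable_const_bound[of _ 1]) (auto split: split_indicator)
  have "?m = 0"
  proof (rule ccontr)
    assume "?m \<noteq> 0"
    then have m: "?m > 0" by (simp add: less_le)
    \<comment> \<open>The Herglotz transform of the indicator of E: its value at 0 is the measure of
      E, so \<open>exp (A * S)\<close> is large there.\<close>
    define S where "S w = 2 * (\<integral>\<xi>. of_real (indicator E \<xi>) / (1 - cnj \<xi> * w) \<partial>mT) - of_real ?m" for w
    have int_E: "integrable mT (\<lambda>\<xi>. complex_of_real (indicator E \<xi>))"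
      using ind by simp
    have E_sums: "(\<lambda>n. (\<integral>\<xi>. of_real (indicator E \<xi>) * cnj \<xi> ^ n \<partial>mT) * w ^ n) sums
        (\<integral>\<xi>. of_real (indicator E \<xi>) / (1 - cnj \<xi> * w) \<partial>mT)" if "cmod w < 1" for w
      using that by (intro cauchy_integral_sums int_E AE_mT_circle) simp_all
    have S_hol: "S holomorphic_on ball 0 1"
      unfolding S_def
      by (intro holomorphic_intros power_series_holomorphic[where a = "\<lambda>n. \<integral>\<xi>. of_real (indicator E \<xi>) * cnj \<xi> ^ n \<partial>mT"])
        (use E_sums in auto)
    have [measurable]: "S \<in> borel_measurable borel"
      unfolding S_def[abs_def] by measurable
    have S_0: "S 0 = of_real ?m"
      by (simp add: S_def)
    have Re_S: "Re (S (of_real r * z)) = (\<integral>\<xi>. poisson r z \<xi> * indicator E \<xi> \<partial>mT)"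
      if "0 \<le> r" "r < 1" "cmod z = 1" for r z
    proof -
      let ?w = "of_real r * z"
      have int: "integrable mT (\<lambda>\<xi>. of_real (indicator E \<xi>) / (1 - cnj \<xi> * ?w))"
        using that by (intro integrable_cauchy_kernel_mult int_E) (simp add: norm_mult)
      have "(\<integral>\<xi>. poisson r z \<xi> * indicator E \<xi> \<partial>mT) =
        (\<integral>\<xi>. 2 * Re (of_real (indicator E \<xi>) / (1 - cnj \<xi> * ?w)) - indicator E \<xi> \<partial>mT)"
      proof (rule integral_cong_AE)
        show "AE \<xi> in mT. poisson r z \<xi> * indicator E \<xi> =
          2 * Re (of_real (indicator E \<xi>) / (1 - cnj \<xi> * ?w)) - indicator E \<xi>"
          using AE_mT_circle
          by eventually_elim (use that poisson_eq in \<open>auto split: split_indicator\<close>)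
      qed measurable
      also have "\<dots> = 2 * (\<integral>\<xi>. Re (of_real (indicator E \<xi>) / (1 - cnj \<xi> * ?w)) \<partial>mT) - ?m"
        using integrable_Re[OF int] ind by (subst Bochner_Integration.integral_diff) auto
      finally show ?thesis
        unfolding integral_Re[OF int] by (simp add: S_def)
    qed
    have P_le: "(\<integral>\<xi>. poisson r z \<xi> * indicator E \<xi> \<partial>mT) \<le> 1" if "0 \<le> r" "r < 1" "cmod z = 1" for r z
    proof -
      have "(\<integral>\<xi>. poisson r z \<xi> * indicator E \<xi> \<partial>mT) \<le> (\<integral>\<xi>. poisson r z \<xi> * 1 \<partial>mT)"
        by (intro integral_mono integrable_poisson_mult that mT.integrable_const_bound[of _ 1] mult_left_mono poisson_nonneg)
          (auto split: split_indicator)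
      then show ?thesis using integral_poisson[OF that] by simp
    qed
    have main: "cmod (g 0) * exp (A * ?m) \<le> B * 2 ^ k" if "A > 0" for A
    proof -
      define u where "u n z = Re (S (of_real (\<rho> n) * z))" for n z
      have [measurable]: "u n \<in> borel_measurable borel" for n unfolding u_def[abs_def] by measurable
      \<comment> \<open>On E the factor \<open>|h|\<close> tends to 0. Off E it is replaced by B,
        and there the exponent \<open>A * u n z\<close> tends to 0. Hence the limit of the integrals
        is bounded independently of A.\<close>
      define \<psi> where "\<psi> n z = (if z \<in> E then cmod (h (of_real (\<rho> n) * z)) else B) * 2 ^ k * exp (A * u n z)" for n z
      have [measurable]: "\<psi> n \<in> borel_measurable borel" for n unfolding \<psi>_def[abs_def] by measurable
      have u_le: "u n z \<le> 1" if "cmod z = 1" for n z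
        using P_le[of "\<rho> n" z] Re_S[of "\<rho> n" z] that \<rho>[of n] by (simp add: u_def)
      have in_ball: "of_real (\<rho> n) * z \<in> ball 0 1" if "cmod z = 1" for n z
        using that \<rho>[of n] by (simp add: norm_mult)
      have \<psi>_bound: "norm (\<psi> n z) \<le> B * 2 ^ k * exp A" if "cmod z = 1" for n z
        unfolding \<psi>_def using u_le[OF that] bound[OF in_ball[OF that]] B \<open>A > 0\<close>
        by (auto simp: abs_mult intro!: mult_mono)
      have int_\<psi>: "integrable mT (\<psi> n)" for n
      proof (rule mT.integrable_const_bound)
        show "AE z in mT. norm (\<psi> n z) \<le> B * 2 ^ k * exp A"
          using AE_mT_circle by eventually_elim (rule \<psi>_bound)
      qed measurable
      have le: "cmod (g 0) * exp (A * ?m) \<le> (\<integral>z. \<psi> n z \<partial>mT)" for n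
      proof -
        let ?F = "\<lambda>w. g w * exp (of_real A * S w)"
        have "(\<integral>z. ?F (of_real (\<rho> n) * z) \<partial>mT) = ?F 0"
          using \<rho>[of n] g S_hol by (intro integral_mT_holomorphic holomorphic_intros) auto
        then have "cmod (g 0) * exp (A * ?m) = cmod (\<integral>z. ?F (of_real (\<rho> n) * z) \<partial>mT)"
          by (simp add: S_0 norm_mult flip: of_real_mult)
        also have "\<dots> \<le> (\<integral>z. cmod (?F (of_real (\<rho> n) * z)) \<partial>mT)"
          by (rule integral_norm_bound)
        also have "\<dots> \<le> (\<integral>z. \<psi> n z \<partial>mT)"
        proof (rule integral_mono_AE')
          show "AE z in mT. cmod (?F (of_real (\<rho> n) * z)) \<le> \<psi> n z"
            using AE_mT_circle
          proof eventually_elim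
            case (elim z)
            let ?w = "of_real (\<rho> n) * z"
            have "cmod (h ?w) = \<rho> n ^ k * cmod (g ?w)"
              using hg[OF in_ball[OF elim]] elim \<rho>(1)[of n] by (simp add: norm_mult norm_power)
            moreover have "(1 / 2) ^ k \<le> \<rho> n ^ k" using \<rho>(1)[of n] by (intro power_mono) auto
            ultimately have "(1 / 2) ^ k * cmod (g ?w) \<le> cmod (h ?w)"
              by (simp add: mult_right_mono)
            then have g_le: "cmod (g ?w) \<le> cmod (h ?w) * 2 ^ k"
              by (simp add: power_divide field_simps)
            also have "\<dots> \<le> (if z \<in> E then cmod (h ?w) else B) * 2 ^ k"
              using bound[OF in_ball[OF elim]] by auto
            finally show ?case
              by (simp add: norm_mult \<psi>_def u_def mult_right_mono)
          qed
          show "AE z in mT. 0 \<le> \<psi> n z" using B by (simp add: \<psi>_def)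
        qed (rule int_\<psi>)
        finally show ?thesis .
      qed
      have lim: "(\<lambda>n. \<integral>z. \<psi> n z \<partial>mT) \<longlonglongrightarrow> (\<integral>z. (if z \<in> E then 0 else B * 2 ^ k) \<partial>mT)"
      proof (rule integral_dominated_convergence[where w = "\<lambda>_. B * 2 ^ k * exp A"])
        show "AE z in mT. (\<lambda>n. \<psi> n z) \<longlonglongrightarrow> (if z \<in> E then 0 else B * 2 ^ k)"
          using AE_poisson_tendsto_real[OF ind] AE_mT_circle
        proof eventually_elim
          case (elim z)
          have "(\<lambda>n. \<integral>\<xi>. poisson (\<rho> n) z \<xi> * indicator E \<xi> \<partial>mT) \<longlonglongrightarrow> indicator E z"
            using filterlim_compose[OF elim(1) lim_\<rho>] .
          moreover have "(\<integral>\<xi>. poisson (\<rho> n) z \<xi> * indicator E \<xi> \<partial>mT) = u n z" for n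
            using Re_S[of "\<rho> n" z] \<rho>[of n] elim(2) by (simp add: u_def)
          ultimately have u: "(\<lambda>n. u n z) \<longlonglongrightarrow> indicator E z" by simp
          show ?case
          proof (cases "z \<in> E")
            case True
            then have "(\<lambda>n. h (of_real (\<rho> n) * z)) \<longlonglongrightarrow> 0" using E_lim by simp
            then have "(\<lambda>n. cmod (h (of_real (\<rho> n) * z)) * 2 ^ k * exp (A * u n z)) \<longlonglongrightarrow>
                0 * 2 ^ k * exp (A * indicator E z)"
              using u by (intro tendsto_intros tendsto_norm_zero)
            with True show ?thesis by (simp add: \<psi>_def)
          next
            case False
            have "(\<lambda>n. B * 2 ^ k * exp (A * u n z)) \<longlonglongrightarrow> B * 2 ^ k * exp (A * indicator E z)"
              using u by (intro tendsto_intros)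
            with False show ?thesis by (simp add: \<psi>_def)
          qed
        qed
        show "AE z in mT. norm (\<psi> n z) \<le> B * 2 ^ k * exp A" for n
          using AE_mT_circle by eventually_elim (rule \<psi>_bound)
      qed simp_all
      have "cmod (g 0) * exp (A * ?m) \<le> (\<integral>z. (if z \<in> E then 0 else B * 2 ^ k) \<partial>mT)"
        using lim le by (intro LIMSEQ_le_const) auto
      also have "\<dots> \<le> (\<integral>z. B * 2 ^ k \<partial>mT)"
        using B by (intro integral_mono mT.integrable_const_bound[of _ "B * 2 ^ k"]) auto
      finally show ?thesis using mT.prob_space by simp
    qed
    \<comment> \<open>Chosen so that already the linear bound \<open>1 + x \<le> exp x\<close>
      pushes the left side of \<open>main\<close> above \<open>B * 2 ^ k\<close>.\<close>
    define A where "A = (B * 2 ^ k / cmod (g 0) + 1) / ?m"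
    have "A > 0" using B m g0 by (auto simp: A_def intro!: divide_pos_pos add_nonneg_pos)
    have "B * 2 ^ k < cmod (g 0) * (1 + A * ?m)"
      using m g0 by (simp add: A_def field_simps)
    also have "\<dots> \<le> cmod (g 0) * exp (A * ?m)"
      by (intro mult_left_mono exp_ge_add_one_self) auto
    finally show False using main[OF \<open>A > 0\<close>] by simp
  qed
  then have "E \<in> null_sets mT"
    by (simp add: null_sets_def mT.emeasure_eq_measure)
  from AE_not_in[OF this] show ?thesis
  proof eventually_elim
    case (elim z)
    then show ?case using E_lim[of z] filterlim_compose[OF _ lim_\<rho>, of "\<lambda>\<rho>. h (of_real \<rho> * z)" "nhds 0"] by blast
  qed
qed

subsection \<open>A measure on the circle is determined by its moments\<close>

text \<open>On the circle \<open>cnj z * z = 1\<close> cancels all but the difference of the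
  exponents; a surplus power of z is the conjugate of a given moment.\<close>

lemma integral_laurent_monomial:
  fixes N :: "complex measure"
  assumes N: "prob_space N" "sets N = sets borel" and circle: "AE \<xi> in N. cmod \<xi> = 1"
    and moments: "\<And>n. n \<ge> 1 \<Longrightarrow> (\<integral>\<xi>. cnj \<xi> ^ n \<partial>N) = 0"
  shows "(\<integral>z. cnj z ^ k * z ^ i \<partial>N) = (if i = k then 1 else 0)"
proof -
  interpret prob_space N by fact
  note [measurable_cong] = N(2)
  have cnj_mult: "cnj z * z = 1" if "cmod z = 1" for z
    using that complex_norm_square[of z] by (simp add: mult.commute)
  show ?thesis
  proof (cases "i \<le> k")
    case True
    have "(\<integral>z. cnj z ^ k * z ^ i \<partial>N) = (\<integral>z. cnj z ^ (k - i) \<partial>N)"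
    proof (rule integral_cong_AE)
      show "AE z in N. cnj z ^ k * z ^ i = cnj z ^ (k - i)"
        using circle
      proof eventually_elim
        case (elim z)
        have "cnj z ^ k = cnj z ^ (k - i) * cnj z ^ i" using True by (simp flip: power_add)
        then show ?case using cnj_mult[OF elim] by (simp add: mult.assoc flip: power_mult_distrib)
      qed
    qed measurable
    then show ?thesis using moments[of "k - i"] True prob_space by auto
  next
    case False
    have "(\<integral>z. cnj z ^ k * z ^ i \<partial>N) = (\<integral>z. cnj (cnj z ^ (i - k)) \<partial>N)"
    proof (rule integral_cong_AE)
      show "AE z in N. cnj z ^ k * z ^ i = cnj (cnj z ^ (i - k))"
        using circle
      proof eventually_elim
        case (elim z)
        have "z ^ i = z ^ k * z ^ (i - k)" using False by (simp flip: power_add)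
        then show ?case using cnj_mult[OF elim] by (simp add: mult.assoc[symmetric] flip: power_mult_distrib)
      qed
    qed measurable
    also have "\<dots> = cnj (\<integral>z. cnj z ^ (i - k) \<partial>N)"
      by (rule Bochner_Integration.integral_cnj)
    also have "(\<integral>z. cnj z ^ (i - k) \<partial>N) = 0"
      using False by (intro moments) simp
    finally show ?thesis using False by simp
  qed
qed

lemma integral_laurent_polynomial:
  fixes N :: "complex measure"
  assumes N: "prob_space N" "sets N = sets borel" and circle: "AE \<xi> in N. cmod \<xi> = 1"
    and moments: "\<And>n. n \<ge> 1 \<Longrightarrow> (\<integral>\<xi>. cnj \<xi> ^ n \<partial>N) = 0"
  shows "(\<integral>z. cnj z ^ k * poly p z \<partial>N) = coeff p k"
proof -
  interpret prob_space N by fact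
  note [measurable_cong] = N(2)
  have int: "integrable N (\<lambda>z. cnj z ^ k * z ^ i)" for i
  proof (rule integrable_const_bound[of _ 1])
    show "AE z in N. norm (cnj z ^ k * z ^ i) \<le> 1"
      using circle by eventually_elim (simp add: norm_mult norm_power)
  qed measurable
  have "(\<integral>z. cnj z ^ k * poly p z \<partial>N) = (\<integral>z. (\<Sum>i\<le>degree p. coeff p i * (cnj z ^ k * z ^ i)) \<partial>N)"
    by (simp add: poly_altdef sum_distrib_left mult.left_commute)
  also have "\<dots> = (\<Sum>i\<le>degree p. coeff p i * (if i = k then 1 else 0))"
    using int integral_laurent_monomial[OF N circle moments]
    by (subst Bochner_Integration.integral_sum) auto
  also have "\<dots> = coeff p k"
    by (simp add: if_distrib[of "(*) _"] coeff_eq_0 cong: if_cong)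
  finally show ?thesis .
qed

text \<open>On the circle \<open>cnj z\<close> is the inverse of z, so real polynomials in the
  coordinates become Laurent polynomials. The form \<open>cnj z ^ k * poly p z\<close> expresses
  them through ordinary polynomials.\<close>

lemma real_polynomial_function_laurent:
  assumes "real_polynomial_function f"
  shows "\<exists>k p. \<forall>z. cmod z = 1 \<longrightarrow> complex_of_real (f z) = cnj z ^ k * poly p z"
  using assms
proof induction
  case (linear f)
  have f: "f z = Re z * f 1 + Im z * f \<i>" for z
  proof -
    interpret bounded_linear f by fact
    have "f z = f (Re z *\<^sub>R 1 + Im z *\<^sub>R \<i>)" by (rule arg_cong) (simp add: complex_eq_iff)
    also have "\<dots> = Re z * f 1 + Im z * f \<i>" unfolding add scaleR by simp
    finally show ?thesis .
  qed
  \<comment> \<open>From Re z = (z + cnj z) / 2 and Im z = (z - cnj z) / (2 i), after taking out the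
    factor \<open>cnj z\<close>.\<close>
  let ?p = "[:(of_real (f 1) - of_real (f \<i>) / \<i>) / 2, 0, (of_real (f 1) + of_real (f \<i>) / \<i>) / 2:]"
  have "complex_of_real (f z) = cnj z ^ 1 * poly ?p z" if "cmod z = 1" for z
  proof -
    have zz: "cnj z * (z * w) = w" for w
    proof -
      have "z * cnj z = 1" using that complex_norm_square[of z] by simp
      then show ?thesis by (metis mult.assoc mult.commute mult_1)
    qed
    have re: "complex_of_real (Re z) = (z + cnj z) / 2" by (simp add: complex_add_cnj)
    have im: "complex_of_real (Im z) = (cnj z - z) * \<i> / 2" by (simp add: complex_eq_iff)
    have "cnj z * poly ?p z = cnj z * ((of_real (f 1) - of_real (f \<i>) / \<i>) / 2) +
       cnj z * (z * (z * ((of_real (f 1) + of_real (f \<i>) / \<i>) / 2)))"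
      by (simp add: algebra_simps)
    also have "\<dots> = of_real (f 1) * ((z + cnj z) / 2) + of_real (f \<i>) * ((cnj z - z) * \<i> / 2)"
      unfolding zz by (simp add: field_simps)
    also have "\<dots> = complex_of_real (f z)"
      unfolding f[of z] by (simp add: re im mult.commute)
    finally show ?thesis by simp
  qed
  then show ?case by blast
next
  case (const c)
  show ?case by (rule exI[of _ 0], rule exI[of _ "[:complex_of_real c:]"]) simp
next
  case (add f g)
  from add.IH obtain k p l q where
    f: "\<forall>z. cmod z = 1 \<longrightarrow> complex_of_real (f z) = cnj z ^ k * poly p z" and
    g: "\<forall>z. cmod z = 1 \<longrightarrow> complex_of_real (g z) = cnj z ^ l * poly q z" by auto
  \<comment> \<open>The extra monomials bring both summands to the common factor
    \<open>cnj z ^ (k + l)\<close>.\<close>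
  have "complex_of_real (f z + g z) = cnj z ^ (k + l) * poly (p * monom 1 l + q * monom 1 k) z"
    if "cmod z = 1" for z
  proof -
    have zz: "cnj z ^ n * z ^ n = 1" for n
      using that complex_norm_square[of z] by (simp add: mult.commute flip: power_mult_distrib)
    have "cnj z ^ (k + l) * poly (p * monom 1 l + q * monom 1 k) z =
      cnj z ^ k * poly p z * (cnj z ^ l * z ^ l) + cnj z ^ l * poly q z * (cnj z ^ k * z ^ k)"
      by (simp add: poly_monom power_add algebra_simps)
    then show ?thesis by (simp add: zz f[rule_format, OF that] g[rule_format, OF that])
  qed
  then show ?case by blast
next
  case (mult f g)
  from mult.IH obtain k p l q where
    f: "\<forall>z. cmod z = 1 \<longrightarrow> complex_of_real (f z) = cnj z ^ k * poly p z" and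
    g: "\<forall>z. cmod z = 1 \<longrightarrow> complex_of_real (g z) = cnj z ^ l * poly q z" by auto
  have "complex_of_real (f z * g z) = cnj z ^ (k + l) * poly (p * q) z"
    if "cmod z = 1" for z
    using f[rule_format, OF that] g[rule_format, OF that] by (simp add: power_add algebra_simps)
  then show ?case by blast
qed

text \<open>Closed sets form an intersection-stable generator, and the indicator of a closed set is
  a pointwise limit of continuous cutoffs of the distance.\<close>

lemma measure_eqI_integral_continuous:
  fixes N N' :: "'a::euclidean_space measure"
  assumes N: "finite_measure N" "sets N = sets borel" and N': "finite_measure N'" "sets N' = sets borel"
    and eq: "\<And>f. continuous_on UNIV f \<Longrightarrow> (\<And>x. 0 \<le> f x) \<Longrightarrow> (\<And>x. f x \<le> 1) \<Longrightarrow> (\<integral>x. f x \<partial>N) = (\<integral>x. f x \<partial>N' :: real)"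
  shows "N = N'"
proof (rule measure_eqI_generator_eq[where E = "Collect closed" and \<Omega> = UNIV and A = "\<lambda>_. UNIV"])
  interpret N: finite_measure N by fact
  interpret N': finite_measure N' by fact
  fix X :: "'a set" assume "X \<in> Collect closed"
  then have X: "closed X" by simp
  show "emeasure N X = emeasure N' X"
  proof (cases "X = {}")
    \<comment> \<open>The empty set is separate because \<open>infdist\<close> to it is 0 by
      convention, which would make the cutoffs constantly 1.\<close>
    case False
    define f where "f n x = max 0 (1 - real n * infdist x X)" for n x
    have cont: "continuous_on UNIV (f n)" for n
      unfolding f_def by (intro continuous_intros continuous_on_infdist)
    have f01: "0 \<le> f n x" "f n x \<le> 1" for n x
      by (auto simp: f_def infdist_nonneg)
    have lim: "(\<lambda>n. f n x) \<longlonglongrightarrow> indicator X x" for x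
    proof (cases "x \<in> X")
      case True
      then show ?thesis by (simp add: f_def)
    next
      case False
      then have pos: "infdist x X > 0"
        using in_closed_iff_infdist_zero[OF X \<open>X \<noteq> {}\<close>, of x] infdist_nonneg[of x X] by simp
      obtain n0 where n0: "1 < real n0 * infdist x X" using reals_Archimedean3[OF pos] by blast
      have "f n x = 0" if "n \<ge> n0" for n
      proof -
        have "real n0 * infdist x X \<le> real n * infdist x X" using that pos by (intro mult_right_mono) auto
        then show ?thesis using n0 by (simp add: f_def)
      qed
      then have "eventually (\<lambda>n. f n x = 0) sequentially" by (auto simp: eventually_sequentially)
      then show ?thesis using False by (simp add: tendsto_eventually)
    qed
    have conv: "(\<lambda>n. \<integral>x. f n x \<partial>L) \<longlonglongrightarrow> measure L X" if "finite_measure L" "sets L = sets borel" for L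
    proof -
      interpret L: finite_measure L by fact
      note [measurable_cong] = that(2)
      have [measurable]: "f n \<in> borel_measurable borel" for n
        using cont by (rule borel_measurable_continuous_onI)
      have [measurable]: "X \<in> sets borel" using X by simp
      have "(\<lambda>n. \<integral>x. f n x \<partial>L) \<longlonglongrightarrow> (\<integral>x. indicator X x \<partial>L)"
      proof (rule integral_dominated_convergence[where w = "\<lambda>_. 1"])
        show "AE x in L. norm (f n x) \<le> 1" for n using f01 by auto
      qed (use lim in auto)
      then show ?thesis using that(2) by (simp add: sets_eq_imp_space_eq[OF that(2)])
    qed
    have "measure N X = measure N' X"
      using LIMSEQ_unique[OF conv[OF N]] conv[OF N'] eq[OF cont f01] by simp
    then show ?thesis by (simp add: N.emeasure_eq_measure N'.emeasure_eq_measure)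
  qed simp
next
  show "emeasure N UNIV \<noteq> \<infinity>" using N(1) by (simp add: finite_measure.emeasure_finite)
  show "Int_stable (Collect closed :: 'a set set)" by (auto simp: Int_stable_def)
  have "sets (borel :: 'a measure) = sigma_sets UNIV (Collect closed)"
    unfolding borel_eq_closed by simp
  then show "sets N = sigma_sets UNIV (Collect closed)" "sets N' = sigma_sets UNIV (Collect closed)"
    using N(2) N'(2) by simp_all
qed simp_all

text \<open>By Stone-Weierstrass, continuous functions are uniformly close on the circle to Laurent
  polynomials. The integral of such a polynomial is one of its coefficients, the same for both
  measures.\<close>

lemma prob_space_eq_mT:
  fixes N :: "complex measure"
  assumes N: "prob_space N" "sets N = sets borel" and circle: "AE \<xi> in N. cmod \<xi> = 1"
    and moments: "\<And>n. n \<ge> 1 \<Longrightarrow> (\<integral>\<xi>. cnj \<xi> ^ n \<partial>N) = 0"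
  shows "N = mT"
proof (rule measure_eqI_integral_continuous)
  interpret prob_space N by fact
  note [measurable_cong] = N(2)
  show "finite_measure N" "finite_measure mT" by unfold_locales
  show "sets N = sets borel" "sets mT = sets borel" using N by simp_all
  fix f :: "complex \<Rightarrow> real"
  assume f: "continuous_on UNIV f" "\<And>x. 0 \<le> f x" "\<And>x. f x \<le> 1"
  have [measurable]: "f \<in> borel_measurable borel" using f(1) by (rule borel_measurable_continuous_onI)
  have bound: "\<bar>(\<integral>x. f x \<partial>L) - (\<integral>x. g x \<partial>L)\<bar> \<le> e"
    if L: "prob_space L" "sets L = sets borel" "AE \<xi> in L. cmod \<xi> = 1"
      and [measurable]: "g \<in> borel_measurable borel"
      and g: "\<And>x. cmod x = 1 \<Longrightarrow> \<bar>f x - g x\<bar> < e" and "e > 0" for L :: "complex measure" and g e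
  proof -
    interpret L: prob_space L by fact
    note [measurable_cong] = L(2)
    have intf: "integrable L f"
      using f(2,3) by (intro L.integrable_const_bound[of _ 1] AE_I2) simp_all
    have fg: "AE x in L. norm (f x - g x) \<le> e"
      using L(3) by eventually_elim (simp add: g less_imp_le)
    then have intfg: "integrable L (\<lambda>x. f x - g x)"
      by (intro L.integrable_const_bound[of _ e]) auto
    have intg: "integrable L g"
      using Bochner_Integration.integrable_diff[OF intf intfg] by simp
    have "\<bar>(\<integral>x. f x \<partial>L) - (\<integral>x. g x \<partial>L)\<bar> = \<bar>\<integral>x. f x - g x \<partial>L\<bar>"
      using intf intg by simp
    also have "\<dots> \<le> (\<integral>x. \<bar>f x - g x\<bar> \<partial>L)" by (rule integral_abs_bound)
    also have "\<dots> \<le> (\<integral>x. e \<partial>L)"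
      using fg intfg by (intro integral_mono_AE) auto
    also have "\<dots> = e" using L.prob_space by simp
    finally show ?thesis .
  qed
  have "\<bar>(\<integral>x. f x \<partial>N) - (\<integral>x. f x \<partial>mT)\<bar> \<le> e" if e: "e > 0" for e
  proof -
    have "compact (sphere (0::complex) 1)" "continuous_on (sphere 0 1) f"
      using continuous_on_subset[OF f(1)] by simp_all
    then obtain g where g: "real_polynomial_function g"
        "\<And>x. x \<in> sphere (0::complex) 1 \<Longrightarrow> \<bar>f x - g x\<bar> < e / 2"
      using e by (elim Stone_Weierstrass_real_polynomial_function[of "sphere 0 1" f "e / 2"]) simp_all
    have [measurable]: "g \<in> borel_measurable borel"
      using g(1)
      by (intro borel_measurable_continuous_onI continuous_on_polymonial_function)
        (simp add: real_polynomial_function_eq)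
    obtain k p where kp: "\<forall>z. cmod z = 1 \<longrightarrow> complex_of_real (g z) = cnj z ^ k * poly p z"
      using real_polynomial_function_laurent[OF g(1)] by auto
    have g_int: "complex_of_real (\<integral>x. g x \<partial>L) = coeff p k"
      if L: "prob_space L" "sets L = sets borel" "AE \<xi> in L. cmod \<xi> = 1" 
        "\<And>n. n \<ge> 1 \<Longrightarrow> (\<integral>\<xi>. cnj \<xi> ^ n \<partial>L) = 0" for L :: "complex measure"
    proof -
      note [measurable_cong] = L(2)
      have [measurable]: "poly p \<in> borel_measurable borel"
        by (rule borel_measurable_continuous_onI) (rule continuous_on_poly[OF continuous_on_id])
      have "complex_of_real (\<integral>x. g x \<partial>L) = (\<integral>x. complex_of_real (g x) \<partial>L)" by simp
      also have "\<dots> = (\<integral>x. cnj x ^ k * poly p x \<partial>L)"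
      proof (rule integral_cong_AE)
        show "AE x in L. complex_of_real (g x) = cnj x ^ k * poly p x"
          using L(3) by eventually_elim (use kp in simp)
      qed measurable
      finally show ?thesis using integral_laurent_polynomial[OF L] by simp
    qed
    have "complex_of_real (\<integral>x. g x \<partial>N) = complex_of_real (\<integral>x. g x \<partial>mT)"
      using g_int[OF N circle moments] g_int[OF prob_space_mT sets_mT AE_mT_circle] integral_mT_cnj_power by simp
    then have "(\<integral>x. g x \<partial>N) = (\<integral>x. g x \<partial>mT)" by (simp only: of_real_eq_iff)
    moreover have "\<bar>(\<integral>x. f x \<partial>N) - (\<integral>x. g x \<partial>N)\<bar> \<le> e / 2"
      using g(2) e by (intro bound[OF N circle]) simp_all
    moreover have "\<bar>(\<integral>x. f x \<partial>mT) - (\<integral>x. g x \<partial>mT)\<bar> \<le> e / 2"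
      using g(2) e by (intro bound[OF prob_space_mT sets_mT AE_mT_circle]) simp_all
    ultimately show ?thesis by linarith
  qed
  then have "\<bar>(\<integral>x. f x \<partial>N) - (\<integral>x. f x \<partial>mT)\<bar> \<le> 0"
    by (rule field_le_epsilon) simp
  then show "(\<integral>x. f x \<partial>N) = (\<integral>x. f x \<partial>mT)"
    by simp
qed

subsection \<open>The Herglotz transform and the characteristic function\<close>

text \<open>The difference of the squares is \<open>(1 - |\<gamma>|^2) * (|b|^2 - |a|^2)\<close>.
  With a = R2 - 1 and b = R2 + 1 the two sides are the numerator and the denominator of
  \<open>theta\<close>.\<close>

lemma mobius_norm_less:
  fixes a b \<gamma> :: complex
  assumes "cmod a < cmod b" "cmod \<gamma> < 1"
  shows "cmod (a - \<gamma> * b) < cmod (b - cnj \<gamma> * a)"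
proof -
  have "(cmod a)\<^sup>2 < (cmod b)\<^sup>2" "(cmod \<gamma>)\<^sup>2 < 1\<^sup>2"
    using assms by (intro power_strict_mono; simp)+
  then have "0 < (1 - (cmod \<gamma>)\<^sup>2) * ((cmod b)\<^sup>2 - (cmod a)\<^sup>2)"
    by (intro mult_pos_pos) simp_all
  also have "\<dots> = (cmod (b - cnj \<gamma> * a))\<^sup>2 - (cmod (a - \<gamma> * b))\<^sup>2"
  proof -
    have "complex_of_real ((1 - (cmod \<gamma>)\<^sup>2) * ((cmod b)\<^sup>2 - (cmod a)\<^sup>2)) =
      complex_of_real ((cmod (b - cnj \<gamma> * a))\<^sup>2 - (cmod (a - \<gamma> * b))\<^sup>2)"
      unfolding of_real_mult of_real_diff complex_norm_square
      by (simp add: algebra_simps)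
    then show ?thesis by (simp only: of_real_eq_iff)
  qed
  finally have "(cmod (a - \<gamma> * b))\<^sup>2 < (cmod (b - cnj \<gamma> * a))\<^sup>2" by simp
  then show ?thesis by (rule power_less_imp_less_base) simp
qed

locale circle_measure = prob_space M for M :: "complex measure" +
  assumes sets_M [measurable_cong]: "sets M = sets borel"
    and circle: "AE \<xi> in M. cmod \<xi> = 1"
begin

lemma space_M [simp]: "space M = UNIV"
  using sets_eq_imp_space_eq[OF sets_M] by simp

lemma kernel_lower_bound: "cmod \<xi> = 1 \<Longrightarrow> \<bar>1 - cmod w\<bar> \<le> cmod (1 - cnj \<xi> * w)"
  using norm_triangle_ineq3[of 1 "cnj \<xi> * w"] by (simp add: norm_mult)

lemma kernel_bound:
  assumes "cmod w \<noteq> 1"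
  shows "AE \<xi> in M. cmod (1 / (1 - cnj \<xi> * w)) \<le> 1 / \<bar>1 - cmod w\<bar>"
  using circle
proof eventually_elim
  case (elim \<xi>)
  show ?case
    unfolding norm_divide norm_one
    using kernel_lower_bound[OF elim, of w] assms by (intro divide_left_mono mult_pos_pos) auto
qed

lemma integrable_kernel: "cmod w \<noteq> 1 \<Longrightarrow> integrable M (\<lambda>\<xi>. 1 / (1 - cnj \<xi> * w))"
  by (rule integrable_const_bound[OF kernel_bound]) measurable

lemma R2_eq:
  assumes "cmod w \<noteq> 1"
  shows "R2 M w = 2 * (\<integral>\<xi>. 1 / (1 - cnj \<xi> * w) \<partial>M) - 1"
proof -
  have "R2 M w = (\<integral>\<xi>. 2 * (1 / (1 - cnj \<xi> * w)) - 1 \<partial>M)"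
    unfolding R2_def
  proof (rule integral_cong_AE)
    show "AE \<xi> in M. (1 + cnj \<xi> * w) / (1 - cnj \<xi> * w) = 2 * (1 / (1 - cnj \<xi> * w)) - 1"
      using circle
    proof eventually_elim
      case (elim \<xi>)
      have "1 - cnj \<xi> * w \<noteq> 0" using kernel_lower_bound[OF elim, of w] assms by auto
      then show ?case by (simp add: field_simps)
    qed
  qed measurable
  also have "\<dots> = 2 * (\<integral>\<xi>. 1 / (1 - cnj \<xi> * w) \<partial>M) - 1"
    using integrable_kernel[OF assms] prob_space
    by (subst Bochner_Integration.integral_diff) (simp_all only: integral_mult_right_zero integrable_const
      integrable_mult_right lebesgue_integral_const, simp)
  finally show ?thesis .
qed

text \<open>On the circle the kernel is \<open>\<xi> / (\<xi> - w)\<close>, which is 1 minus the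
  conjugate of the kernel at the reflected point. This reduces values of the transforms outside the
  disc to values inside.\<close>

lemma cauchy_integral_exterior:
  assumes "cmod w > 1"
  shows "(\<integral>\<xi>. 1 / (1 - cnj \<xi> * w) \<partial>M) = 1 - cnj (\<integral>\<xi>. 1 / (1 - cnj \<xi> * (1 / cnj w)) \<partial>M)"
proof -
  let ?v = "1 / cnj w"
  have v: "cmod ?v \<noteq> 1" using assms by (simp add: norm_divide)
  have w: "w \<noteq> 0" using assms by auto
  have "(\<integral>\<xi>. 1 / (1 - cnj \<xi> * w) \<partial>M) = (\<integral>\<xi>. 1 - cnj (1 / (1 - cnj \<xi> * ?v)) \<partial>M)"
  proof (rule integral_cong_AE)
    show "AE \<xi> in M. 1 / (1 - cnj \<xi> * w) = 1 - cnj (1 / (1 - cnj \<xi> * ?v))"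
      using circle
    proof eventually_elim
      case (elim \<xi>)
      have 1: "1 - cnj \<xi> * w \<noteq> 0" using kernel_lower_bound[OF elim, of w] assms by auto
      have "\<xi> * cnj \<xi> = 1" using elim complex_norm_square[of \<xi>] by simp
      then have eq: "\<xi> * (1 - cnj \<xi> * w) = \<xi> - w" by (simp add: algebra_simps)
      then have 2: "\<xi> - w \<noteq> 0" using 1 elim by (metis mult_eq_0_iff norm_zero zero_neq_one)
      have "cnj (1 / (1 - cnj \<xi> * ?v)) = w / (w - \<xi>)"
        using w 2 by (simp add: field_simps)
      then have "1 - cnj (1 / (1 - cnj \<xi> * ?v)) = \<xi> / (\<xi> - w)"
        using 2 by (simp add: field_simps)
      also have "\<dots> = \<xi> * 1 / (\<xi> * (1 - cnj \<xi> * w))" unfolding eq by simp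
      also have "\<dots> = 1 / (1 - cnj \<xi> * w)"
        using elim by (intro mult_divide_mult_cancel_left) auto
      finally show ?case ..
    qed
  qed measurable
  also have "\<dots> = (\<integral>\<xi>. 1 \<partial>M) - (\<integral>\<xi>. cnj (1 / (1 - cnj \<xi> * ?v)) \<partial>M)"
    by (rule Bochner_Integration.integral_diff) (simp, rule integrable_cnj, rule integrable_kernel[OF v])
  also have "(\<integral>\<xi>. cnj (1 / (1 - cnj \<xi> * ?v)) \<partial>M) = cnj (\<integral>\<xi>. 1 / (1 - cnj \<xi> * ?v) \<partial>M)"
    by (rule Bochner_Integration.integral_cnj)
  finally show ?thesis using prob_space by simp
qed

lemma R2_reflect: "cmod w > 1 \<Longrightarrow> R2 M w = - cnj (R2 M (1 / cnj w))"
  using cauchy_integral_exterior[of w] R2_eq[of w] R2_eq[of "1 / cnj w"] by (simp add: norm_divide)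

lemma cauchy_integral_power_series:
  assumes "cmod w < 1"
  shows "(\<lambda>n. (\<integral>\<xi>. cnj \<xi> ^ n \<partial>M) * w ^ n) sums (\<integral>\<xi>. 1 / (1 - cnj \<xi> * w) \<partial>M)"
  using cauchy_integral_sums[OF integrable_const circle sets_M assms, of 1] by simp

lemma R2_holomorphic: "R2 M holomorphic_on ball 0 1"
proof -
  have "(\<lambda>w. 2 * (\<integral>\<xi>. 1 / (1 - cnj \<xi> * w) \<partial>M) - 1) holomorphic_on ball 0 1"
    using cauchy_integral_power_series
    by (intro holomorphic_intros power_series_holomorphic[where a = "\<lambda>n. \<integral>\<xi>. cnj \<xi> ^ n \<partial>M"]) simp
  then show ?thesis
    by (rule holomorphic_transform) (simp add: R2_eq)
qed

lemma R2_measurable [measurable]: "R2 M \<in> borel_measurable borel"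
  unfolding R2_def[abs_def] by measurable

lemma R2_0: "R2 M 0 = 1"
  using prob_space by (simp add: R2_def)

lemma Re_R2_pos:
  assumes "cmod w < 1"
  shows "Re (R2 M w) > 0"
proof -
  \<comment> \<open>A lower bound independent of \<xi> for the real part of the integrand,
    \<open>(1 - |w|^2) / |1 - x|^2\<close> with \<open>|1 - x| \<le> 2\<close>; it keeps the
    inequality strict after integration.\<close>
  let ?c = "(1 - (cmod w)\<^sup>2) / 4"
  have "(cmod w)\<^sup>2 < 1" using assms by (simp add: power_less_one_iff)
  then have c: "?c > 0" by simp
  have int: "integrable M (\<lambda>\<xi>. (1 + cnj \<xi> * w) / (1 - cnj \<xi> * w))"
  proof (rule integrable_const_bound)
    show "AE \<xi> in M. norm ((1 + cnj \<xi> * w) / (1 - cnj \<xi> * w)) \<le> 2 / (1 - cmod w)"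
      using circle
    proof eventually_elim
      case (elim \<xi>)
      show ?case unfolding norm_divide
        using kernel_lower_bound[OF elim, of w] norm_triangle_ineq[of 1 "cnj \<xi> * w"] elim assms
        by (intro frac_le) (auto simp: norm_mult)
    qed
  qed measurable
  have "?c = (\<integral>\<xi>. ?c \<partial>M)" using prob_space by simp
  also have "\<dots> \<le> (\<integral>\<xi>. Re ((1 + cnj \<xi> * w) / (1 - cnj \<xi> * w)) \<partial>M)"
  proof (rule integral_mono_AE)
    show "integrable M (\<lambda>\<xi>. Re ((1 + cnj \<xi> * w) / (1 - cnj \<xi> * w)))"
      using int by (rule integrable_Re)
    show "AE \<xi> in M. ?c \<le> Re ((1 + cnj \<xi> * w) / (1 - cnj \<xi> * w))"
      using circle
    proof eventually_elim
      case (elim \<xi>)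
      define x where "x = cnj \<xi> * w"
      have x: "cmod x = cmod w" using elim by (simp add: x_def norm_mult)
      have "cmod (1 - x) \<le> 2" using norm_triangle_ineq4[of 1 x] x assms by simp
      then have le: "(cmod (1 - x))\<^sup>2 \<le> 4" using power_mono[of "cmod (1 - x)" 2 2] by simp
      have "x \<noteq> 1" using x assms by auto
      then have pos: "(cmod (1 - x))\<^sup>2 > 0" by simp
      have "Re ((1 + x) / (1 - x)) = (1 - (cmod x)\<^sup>2) / (cmod (1 - x))\<^sup>2"
        by (simp add: Re_divide cmod_power2) (simp add: power2_eq_square algebra_simps)
      moreover have "?c \<le> (1 - (cmod x)\<^sup>2) / (cmod (1 - x))\<^sup>2"
        unfolding x using le pos c by (intro divide_left_mono) simp_all
      ultimately show ?case by (simp add: x_def)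
    qed
  qed simp
  also have "\<dots> = Re (R2 M w)" unfolding R2_def by (rule integral_Re[OF int])
  finally show ?thesis using c by linarith
qed

text \<open>Apart from the constant term, the Taylor coefficients of \<open>R2\<close> are twice the
  moments of M, so a constant \<open>R2\<close> annihilates all moments of positive order.\<close>

lemma R2_eq_1_imp_mT:
  assumes "\<And>w. cmod w < 1 \<Longrightarrow> R2 M w = 1"
  shows "M = mT"
proof (rule prob_space_eq_mT[OF prob_space_axioms sets_M circle])
  fix n :: nat assume "n \<ge> 1"
  \<comment> \<open>The entry at 0 is 0 because the constant 1 of the Cauchy integral is
    subtracted.\<close>
  define a where "a n = (if n = 0 then 0 else (\<integral>\<xi>. cnj \<xi> ^ n \<partial>M))" for n
  have a: "(\<lambda>n. a n * (w - 0) ^ n) sums 0" if "cmod (w - 0) < 1" for w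
  proof -
    have "(\<lambda>n. (\<integral>\<xi>. cnj \<xi> ^ n \<partial>M) * w ^ n) sums 1"
      using cauchy_integral_power_series[of w] R2_eq[of w] assms[of w] that by simp
    from sums_diff[OF this sums_single[of 0 "\<lambda>_. 1"]]
    have "(\<lambda>n. (\<integral>\<xi>. cnj \<xi> ^ n \<partial>M) * w ^ n - (if n = 0 then 1 else 0)) sums 0" by simp
    moreover have "(\<integral>\<xi>. cnj \<xi> ^ n \<partial>M) * w ^ n - (if n = 0 then 1 else 0) = a n * (w - 0) ^ n" for n
      using prob_space by (simp add: a_def)
    ultimately show ?thesis by simp
  qed
  have "a n = 0"
  proof (rule ccontr)
    assume "a n \<noteq> 0"
    \<comment> \<open>A nonzero coefficient would make the zero function nonvanishing on a punctured
      disc.\<close>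
    show False
    proof (rule powser_0_nonzero[of 1 0 a "\<lambda>_. 0::complex" n])
      fix s :: real assume s: "0 < s" "\<And>z::complex. z \<in> cball 0 s - {0} \<Longrightarrow> (0::complex) \<noteq> 0"
      show False using s(2)[of "of_real s"] s(1) by simp
    qed (use a \<open>a n \<noteq> 0\<close> \<open>n \<ge> 1\<close> in simp_all)
  qed
  then show "(\<integral>\<xi>. cnj \<xi> ^ n \<partial>M) = 0" using \<open>n \<ge> 1\<close> by (simp add: a_def)
qed

lemma theta_denominator_bound:
  assumes "cmod w < 1" "cmod \<gamma> < 1"
  shows "cmod ((1 - \<gamma>) * R2 M w - (1 + \<gamma>)) < cmod ((1 - cnj \<gamma>) * R2 M w + (1 + cnj \<gamma>))"
proof -
  have "(cmod (R2 M w - 1))\<^sup>2 < (cmod (R2 M w + 1))\<^sup>2"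
    using Re_R2_pos[OF assms(1)] unfolding cmod_power2 by (simp add: power2_eq_square algebra_simps)
  then have "cmod (R2 M w - 1) < cmod (R2 M w + 1)"
    by (rule power_less_imp_less_base) simp
  from mobius_norm_less[OF this assms(2)] show ?thesis
    by (simp add: algebra_simps)
qed

lemma theta_denominator_nonzero:
  "cmod w < 1 \<Longrightarrow> cmod \<gamma> < 1 \<Longrightarrow> (1 - cnj \<gamma>) * R2 M w + (1 + cnj \<gamma>) \<noteq> 0"
  using theta_denominator_bound[of w \<gamma>] by auto

lemma norm_theta_less_1: "cmod w < 1 \<Longrightarrow> cmod \<gamma> < 1 \<Longrightarrow> cmod (theta M \<gamma> w) < 1"
  using theta_denominator_bound[of w \<gamma>] theta_denominator_nonzero[of w \<gamma>]
  by (simp add: theta_def norm_divide)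

lemma theta_at_0: "theta M \<gamma> 0 = - \<gamma>"
  by (simp add: theta_def R2_0)

lemma theta_holomorphic: "cmod \<gamma> < 1 \<Longrightarrow> theta M \<gamma> holomorphic_on ball 0 1"
  unfolding theta_def[abs_def]
  by (intro holomorphic_intros R2_holomorphic) (simp add: theta_denominator_nonzero)

lemma theta_measurable [measurable]: "theta M \<gamma> \<in> borel_measurable borel"
  unfolding theta_def[abs_def] by measurable

text \<open>A zero of \<open>theta + \<gamma>\<close> is a point where \<open>R2\<close> is 1, so
  this function vanishes identically only for \<open>mT\<close>. Dividing by the companion identity
  for \<open>1 + cnj \<gamma> * theta\<close> leaves (R2 - 1) / (R2 + 1), that is
  \<open>theta M 0\<close>.\<close>

lemma theta_add_gamma:
  assumes "cmod w < 1" "cmod \<gamma> < 1"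
  shows "theta M \<gamma> w + \<gamma> = (1 - \<gamma> * cnj \<gamma>) * (R2 M w - 1) / ((1 - cnj \<gamma>) * R2 M w + (1 + cnj \<gamma>))"
  using theta_denominator_nonzero[OF assms] by (simp add: theta_def field_simps)

lemma one_plus_gamma_theta:
  assumes "cmod w < 1" "cmod \<gamma> < 1"
  shows "1 + cnj \<gamma> * theta M \<gamma> w = (1 - \<gamma> * cnj \<gamma>) * (R2 M w + 1) / ((1 - cnj \<gamma>) * R2 M w + (1 + cnj \<gamma>))"
  using theta_denominator_nonzero[OF assms] by (simp add: theta_def field_simps)

lemma theta_0_eq:
  assumes "cmod w < 1" "cmod \<gamma> < 1"
  shows "theta M 0 w = (theta M \<gamma> w + \<gamma>) / (1 + cnj \<gamma> * theta M \<gamma> w)"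
proof -
  have "(cmod \<gamma>)\<^sup>2 < 1" using assms by (simp add: power_less_one_iff)
  then have "complex_of_real ((cmod \<gamma>)\<^sup>2) \<noteq> of_real 1"
    unfolding of_real_eq_iff by simp
  then have "1 - \<gamma> * cnj \<gamma> \<noteq> 0"
    unfolding complex_norm_square by simp
  then show ?thesis
    unfolding theta_add_gamma[OF assms] one_plus_gamma_theta[OF assms]
    using theta_denominator_nonzero[OF assms] by (simp add: theta_def)
qed

lemma R2_not_constant:
  assumes "M \<noteq> mT"
  obtains w where "cmod w < 1" "R2 M w \<noteq> 1"
  using R2_eq_1_imp_mT assms by blast

end

subsection \<open>Measurability of boundary values\<close>

text \<open>Where the radial limit does not exist, \<^term>\<open>bval\<close> takes a fixed value, which does not depend on
  the point.\<close>

lemma bval_measurable: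
  fixes F :: "complex \<Rightarrow> complex"
  assumes [measurable]: "F \<in> borel_measurable borel" and Z: "countable Z"
    and cont: "\<And>\<xi>. \<xi> \<notin> Z \<Longrightarrow> \<exists>a<1. continuous_on {a<..<1} (\<lambda>r. F (of_real r * \<xi>))"
  shows "bval F \<in> borel_measurable borel"
proof -
  define \<epsilon> where "\<epsilon> n = inverse (real (Suc n))" for n
  have \<epsilon>: "\<epsilon> n > 0" for n by (simp add: \<epsilon>_def)
  have \<epsilon>_0: "\<epsilon> \<longlonglongrightarrow> 0" unfolding \<epsilon>_def by (rule LIMSEQ_inverse_real_of_nat)
  \<comment> \<open>A Cauchy condition over rational radii only, hence countably many conditions and
    a Borel set. Continuity along the ray extends it to all radii near 1.\<close>
  define C where "C = {\<xi>. \<forall>n. \<exists>m. \<forall>p q::rat. real_of_rat p \<in> {1 - \<epsilon> m<..<1} \<longrightarrow> real_of_rat q \<in> {1 - \<epsilon> m<..<1} \<longrightarrow>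
      dist (F (of_real (of_rat p) * \<xi>)) (F (of_real (of_rat q) * \<xi>)) \<le> \<epsilon> n}"
  have [measurable]: "C \<in> sets borel" unfolding C_def by measurable
  define L where "L \<xi> = lim (\<lambda>n. F (of_real (1 - \<epsilon> (Suc n)) * \<xi>))" for \<xi>
  have [measurable]: "L \<in> borel_measurable borel" unfolding L_def by measurable
  have \<epsilon>_tendsto: "filterlim (\<lambda>n. 1 - \<epsilon> (Suc n)) (at_left 1) sequentially"
  proof (intro filterlim_at_withinI)
    from tendsto_diff[OF tendsto_const LIMSEQ_Suc[OF \<epsilon>_0], of 1] show "(\<lambda>n. 1 - \<epsilon> (Suc n)) \<longlonglongrightarrow> 1" by simp
  qed (use \<epsilon> in \<open>auto simp: less_imp_neq\<close>)
  have conv_iff: "(\<exists>l. ((\<lambda>r. F (of_real r * \<xi>)) \<longlongrightarrow> l) (at_left 1)) \<longleftrightarrow> \<xi> \<in> C" if "\<xi> \<notin> Z" for \<xi>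
  proof
    assume "\<exists>l. ((\<lambda>r. F (of_real r * \<xi>)) \<longlongrightarrow> l) (at_left 1)"
    then obtain l where l: "((\<lambda>r. F (of_real r * \<xi>)) \<longlongrightarrow> l) (at_left 1)" ..
    show "\<xi> \<in> C"
      unfolding C_def
    proof (intro CollectI allI)
      fix n
      have "\<forall>\<^sub>F r in at_left 1. dist (F (of_real r * \<xi>)) l < \<epsilon> n / 2"
        using l \<epsilon>[of n] by (intro tendstoD) auto
      then obtain b where b: "b < 1" "\<And>r. b < r \<Longrightarrow> r < 1 \<Longrightarrow> dist (F (of_real r * \<xi>)) l < \<epsilon> n / 2"
        by (auto simp: eventually_at_left_field)
      obtain m where m: "\<epsilon> m < 1 - b" using reals_Archimedean[of "1 - b"] b(1) by (auto simp: \<epsilon>_def)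
      have "dist (F (of_real p * \<xi>)) (F (of_real q * \<xi>)) \<le> \<epsilon> n"
        if "p \<in> {1 - \<epsilon> m<..<1}" "q \<in> {1 - \<epsilon> m<..<1}" for p q
      proof -
        have "dist (F (of_real p * \<xi>)) (F (of_real q * \<xi>)) \<le> dist (F (of_real p * \<xi>)) l + dist (F (of_real q * \<xi>)) l"
          by (rule dist_triangle2)
        also have "\<dots> \<le> \<epsilon> n / 2 + \<epsilon> n / 2"
          using that m by (intro add_mono less_imp_le[OF b(2)]) auto
        finally show ?thesis by simp
      qed
      then show "\<exists>m. \<forall>p q::rat. real_of_rat p \<in> {1 - \<epsilon> m<..<1} \<longrightarrow> real_of_rat q \<in> {1 - \<epsilon> m<..<1} \<longrightarrow>
          dist (F (of_real (of_rat p) * \<xi>)) (F (of_real (of_rat q) * \<xi>)) \<le> \<epsilon> n"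
        by blast
    qed
  next
    assume "\<xi> \<in> C"
    obtain a where a: "a < 1" "continuous_on {a<..<1} (\<lambda>r. F (of_real r * \<xi>))"
      using cont[OF \<open>\<xi> \<notin> Z\<close>] by blast
    let ?f = "\<lambda>r. F (of_real r * \<xi>)"
    have isCont: "isCont ?f r" if "a < r" "r < 1" for r
      using a(2) that by (simp add: continuous_on_eq_continuous_at)
    have close: "\<exists>b<1. \<forall>p q. p \<in> {b<..<1} \<longrightarrow> q \<in> {b<..<1} \<longrightarrow> dist (?f p) (?f q) \<le> \<epsilon> n" for n
    proof -
      obtain m where m: "\<And>p q::rat. real_of_rat p \<in> {1 - \<epsilon> m<..<1} \<Longrightarrow> real_of_rat q \<in> {1 - \<epsilon> m<..<1} \<Longrightarrow>
          dist (?f (of_rat p)) (?f (of_rat q)) \<le> \<epsilon> n"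
        using \<open>\<xi> \<in> C\<close> unfolding C_def by blast
      define b where "b = max a (1 - \<epsilon> m)"
      have approx: "\<exists>X::nat \<Rightarrow> rat. (\<forall>k. real_of_rat (X k) \<in> {b<..<1}) \<and> (\<lambda>k. ?f (of_rat (X k))) \<longlonglongrightarrow> ?f p"
        if p: "p \<in> {b<..<1}" for p
      proof -
        have "\<exists>x::rat. real_of_rat x \<in> {b<..<p} \<and> p - \<epsilon> k < real_of_rat x" for k
          using of_rat_dense[of "max b (p - \<epsilon> k)" p] p \<epsilon>[of k] by auto
        then obtain X :: "nat \<Rightarrow> rat" where X: "\<And>k. real_of_rat (X k) \<in> {b<..<p}" "\<And>k. p - \<epsilon> k < real_of_rat (X k)"
          by metis
        have "(\<lambda>k. real_of_rat (X k)) \<longlonglongrightarrow> p"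
        proof (rule tendsto_sandwich[of "\<lambda>k. p - \<epsilon> k" _ _ "\<lambda>_. p"])
          from tendsto_diff[OF tendsto_const \<epsilon>_0, of p] show "(\<lambda>k. p - \<epsilon> k) \<longlonglongrightarrow> p" by simp
        qed (use X in \<open>auto intro!: always_eventually less_imp_le\<close>)
        moreover have "isCont ?f p" using p by (intro isCont) (auto simp: b_def)
        ultimately have "(\<lambda>k. ?f (of_rat (X k))) \<longlonglongrightarrow> ?f p"
          by (intro isCont_tendsto_compose[of p ?f])
        moreover have "real_of_rat (X k) \<in> {b<..<1}" for k
          using X(1)[of k] p unfolding greaterThanLessThan_iff by (blast intro: less_trans)
        ultimately show ?thesis by blast
      qed
      have "dist (?f p) (?f q) \<le> \<epsilon> n" if pq: "p \<in> {b<..<1}" "q \<in> {b<..<1}" for p q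
      proof -
        obtain X where X: "\<And>k. real_of_rat (X k) \<in> {b<..<1}" "(\<lambda>k. ?f (of_rat (X k))) \<longlonglongrightarrow> ?f p"
          using approx[OF pq(1)] by blast
        obtain Y where Y: "\<And>k. real_of_rat (Y k) \<in> {b<..<1}" "(\<lambda>k. ?f (of_rat (Y k))) \<longlonglongrightarrow> ?f q"
          using approx[OF pq(2)] by blast
        have "dist (?f (of_rat (X k))) (?f (of_rat (Y k))) \<le> \<epsilon> n" for k
          using X(1)[of k] Y(1)[of k] by (intro m) (auto simp: b_def)
        then show ?thesis
          using tendsto_dist[OF X(2) Y(2)] by (intro LIMSEQ_le_const2) auto
      qed
      moreover have "b < 1" using a \<epsilon>[of m] by (simp add: b_def)
      ultimately show ?thesis by blast
    qed
    have ev: "\<forall>\<^sub>F r in at_left 1. r \<in> {b<..<1}" if "b < 1" for b :: real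
      unfolding eventually_at_left_field using that by auto
    have ev': "\<forall>\<^sub>F k in sequentially. 1 - \<epsilon> (Suc k) \<in> {b<..<1}" if "b < 1" for b
      using ev[OF that] \<epsilon>_tendsto by (rule eventually_compose_filterlim)
    have "Cauchy (\<lambda>k. ?f (1 - \<epsilon> (Suc k)))"
    proof (rule metric_CauchyI)
      fix e :: real assume "e > 0"
      then obtain n where n: "\<epsilon> n < e" using reals_Archimedean[of e] by (auto simp: \<epsilon>_def)
      obtain b where b: "b < 1" "\<And>p q. p \<in> {b<..<1} \<Longrightarrow> q \<in> {b<..<1} \<Longrightarrow> dist (?f p) (?f q) \<le> \<epsilon> n"
        using close[of n] by blast
      obtain K where "\<And>k. k \<ge> K \<Longrightarrow> 1 - \<epsilon> (Suc k) \<in> {b<..<1}"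
        using ev'[OF b(1)] by (auto simp: eventually_sequentially)
      then have "dist (?f (1 - \<epsilon> (Suc k))) (?f (1 - \<epsilon> (Suc k'))) < e" if "k \<ge> K" "k' \<ge> K" for k k'
        using that n by (intro le_less_trans[OF b(2)]) auto
      then show "\<exists>K. \<forall>k\<ge>K. \<forall>k'\<ge>K. dist (?f (1 - \<epsilon> (Suc k))) (?f (1 - \<epsilon> (Suc k'))) < e" by blast
    qed
    then obtain l where l: "(\<lambda>k. ?f (1 - \<epsilon> (Suc k))) \<longlonglongrightarrow> l"
      using Cauchy_convergent convergentD by blast
    have "(?f \<longlongrightarrow> l) (at_left 1)"
    proof (rule tendstoI)
      fix e :: real assume "e > 0"
      then obtain n where n: "\<epsilon> n < e" using reals_Archimedean[of e] by (auto simp: \<epsilon>_def)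
      obtain b where b: "b < 1" "\<And>p q. p \<in> {b<..<1} \<Longrightarrow> q \<in> {b<..<1} \<Longrightarrow> dist (?f p) (?f q) \<le> \<epsilon> n"
        using close[of n] by blast
      show "\<forall>\<^sub>F r in at_left 1. dist (?f r) l < e"
        using ev[OF b(1)]
      proof eventually_elim
        case (elim r)
        have "\<forall>\<^sub>F k in sequentially. dist (?f r) (?f (1 - \<epsilon> (Suc k))) \<le> \<epsilon> n"
          using ev'[OF b(1)] by eventually_elim (rule b(2)[OF elim])
        then have "dist (?f r) l \<le> \<epsilon> n"
          using tendsto_dist[OF tendsto_const l, of "?f r"] by (intro tendsto_upperbound) auto
        with n show ?case by simp
      qed
    qed
    then show "\<exists>l. (?f \<longlongrightarrow> l) (at_left 1)" by blast
  qed
  \<comment> \<open>\<open>THE l. False\<close> is what \<open>Lim\<close> returns in the absence of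
    a limit, because its defining predicate is then constantly False.\<close>
  define G where "G \<xi> = (if \<xi> \<in> C then L \<xi> else (THE l. False))" for \<xi>
  have "G \<in> borel_measurable borel" unfolding G_def by measurable
  moreover have "G \<xi> = bval F \<xi>" if nZ: "\<xi> \<notin> Z" for \<xi>
  proof (cases "\<xi> \<in> C")
    case True
    then obtain l where l: "((\<lambda>r. F (of_real r * \<xi>)) \<longlongrightarrow> l) (at_left 1)"
      using conv_iff[OF nZ] by blast
    have "bval F \<xi> = l" unfolding bval_def using l by (intro tendsto_Lim) auto
    moreover have "L \<xi> = l" unfolding L_def by (rule limI[OF filterlim_compose[OF l \<epsilon>_tendsto]])
    ultimately show ?thesis using True by (simp add: G_def)
  next
    case False
    then have "(\<lambda>l. ((\<lambda>r. F (of_real r * \<xi>)) \<longlongrightarrow> l) (at_left 1)) = (\<lambda>l. False)"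
      using conv_iff[OF nZ] by blast
    from arg_cong[OF this, of The] show ?thesis
      using False unfolding G_def bval_def t2_space_class.Lim_def by simp
  qed
  ultimately show ?thesis
    using Z by (intro measurable_discrete_difference[of G borel borel Z "bval F"]) auto
qed

context circle_measure
begin

text \<open>The only possible discontinuities of \<^term>\<open>theta M \<gamma>\<close> off the circle are its poles outside the closed
  disc. By reflection these correspond to zeros inside the disc, hence they are countably many.\<close>

lemma bval_theta_measurable:
  assumes ne: "M \<noteq> mT" and \<gamma>: "cmod \<gamma> < 1"
  shows "bval (theta M \<gamma>) \<in> borel_measurable borel"
proof (rule bval_measurable)
  let ?N = "\<lambda>w. (1 - \<gamma>) * R2 M w - (1 + \<gamma>)"
  let ?D = "\<lambda>w. (1 - cnj \<gamma>) * R2 M w + (1 + cnj \<gamma>)"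
  define Z where "Z = {z. cmod z > 1 \<and> ?D z = 0}"
  have \<gamma>1: "\<gamma> \<noteq> 1" using \<gamma> by auto
  \<comment> \<open>\<open>R2\<close> is recovered from \<open>?N\<close> because
    \<open>1 - \<gamma>\<close> is nonzero, and \<open>R2\<close> is constant only for
    \<open>mT\<close>.\<close>
  have "\<not> ?N constant_on ball 0 1"
  proof
    assume "?N constant_on ball 0 1"
    then obtain c where c: "\<And>w. w \<in> ball 0 1 \<Longrightarrow> ?N w = c" unfolding constant_on_def by blast
    have "R2 M w = 1" if "cmod w < 1" for w
    proof -
      have cancel: "a = b" if "g * a - d = c" "g * b - d = c" "g \<noteq> 0" for a b c d g :: complex
        using that by auto
      have "?N w = c" "?N 0 = c" using that by (intro c; simp)+
      then have "R2 M w = R2 M 0" by (rule cancel) (use \<gamma>1 in simp)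
      then show ?thesis by (simp add: R2_0)
    qed
    then show False using R2_eq_1_imp_mT ne by blast
  qed
  then have "countable {w \<in> ball 0 1. ?N w = 0}"
  proof (intro holomorphic_countable_zeros holomorphic_intros R2_holomorphic open_ball connected_ball)
    have "ball (0::complex) 1 = (\<Union>n::nat. cball 0 (1 - inverse (real (Suc n))))"
    proof (intro equalityI subsetI)
      fix w :: complex assume "w \<in> ball 0 1"
      then obtain n where "inverse (real (Suc n)) < 1 - cmod w" using reals_Archimedean[of "1 - cmod w"] by auto
      then show "w \<in> (\<Union>n::nat. cball 0 (1 - inverse (real (Suc n))))" by (intro UN_I[of n]) auto
    next
      fix w :: complex assume "w \<in> (\<Union>n::nat. cball 0 (1 - inverse (real (Suc n))))"
      then obtain n where "cmod w \<le> 1 - inverse (real (Suc n))" by auto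
      moreover have "0 < inverse (real (Suc n))" by simp
      ultimately have "cmod w < 1" by linarith
      then show "w \<in> ball 0 1" by simp
    qed
    also have "fsigma \<dots>" by (rule fsigma.intros) simp
    finally show "fsigma (ball (0::complex) 1)" .
  qed
  moreover have "Z \<subseteq> (\<lambda>w. 1 / cnj w) ` {w \<in> ball 0 1. ?N w = 0}"
  proof
    fix z assume "z \<in> Z"
    then have z: "cmod z > 1" "?D z = 0" by (auto simp: Z_def)
    have "?N (1 / cnj z) = - cnj (?D z)" unfolding R2_reflect[OF z(1)] by (simp add: algebra_simps)
    then have "?N (1 / cnj z) = 0" unfolding z(2) by simp
    moreover have "1 / cnj z \<in> ball 0 1" using z(1) by (simp add: norm_divide divide_less_eq)
    moreover have "z = 1 / cnj (1 / cnj z)" by simp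
    ultimately show "z \<in> (\<lambda>w. 1 / cnj w) ` {w \<in> ball 0 1. ?N w = 0}"
      by (intro image_eqI[of _ _ "1 / cnj z"] CollectI conjI)
  qed
  ultimately show "countable Z" by (rule countable_subset[OF _ countable_image, rotated])
  fix z assume z: "z \<notin> Z"
  show "\<exists>a<1. continuous_on {a<..<1} (\<lambda>r. theta M \<gamma> (of_real r * z))"
  proof (cases "cmod z \<le> 1")
    case True
    have "continuous_on {0<..<1} (\<lambda>r. theta M \<gamma> (of_real r * z))"
    proof (rule continuous_on_compose2[OF holomorphic_on_imp_continuous_on[OF theta_holomorphic[OF \<gamma>]]])
      show "(\<lambda>r. complex_of_real r * z) ` {0<..<1} \<subseteq> ball 0 1"
      proof safe
        fix r :: real assume "r \<in> {0<..<1}"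
        then have "r * cmod z \<le> r * 1" using True by (intro mult_left_mono) simp_all
        also have "r * 1 < 1" using \<open>r \<in> {0<..<1}\<close> by simp
        finally have "r * cmod z < 1" .
        then show "complex_of_real r * z \<in> ball 0 1" using \<open>r \<in> {0<..<1}\<close> by (simp add: norm_mult)
      qed
    qed (intro continuous_intros)
    then show ?thesis by (intro exI[of _ 0]) simp
  next
    case False
    \<comment> \<open>Outside the disc the continuity of \<open>R2\<close> comes by reflection from
      holomorphy inside; for radii near 1 the ray avoids the poles because z itself is not
      one.\<close>
    let ?X = "{w. cmod w > 1}"
    have open_X: "open ?X" by (intro open_Collect_less continuous_intros)
    have "continuous_on ?X (\<lambda>w. - cnj (R2 M (1 / cnj w)))"
      by (intro continuous_intros continuous_on_compose2[OF holomorphic_on_imp_continuous_on[OF R2_holomorphic]])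
        (auto simp: norm_divide divide_less_eq)
    then have R2_cont: "continuous_on ?X (R2 M)"
      by (rule continuous_on_eq) (simp add: R2_reflect)
    have "open (?X \<inter> ?D -` (- {0}))"
      by (intro continuous_open_preimage open_X continuous_intros R2_cont)
    moreover have "z \<in> (?X \<inter> ?D -` (- {0}))" using z False by (auto simp: Z_def)
    moreover have "((\<lambda>r. complex_of_real r * z) \<longlongrightarrow> of_real 1 * z) (at_left 1)"
      by (intro tendsto_intros)
    ultimately have "\<forall>\<^sub>F r in at_left 1. complex_of_real r * z \<in> (?X \<inter> ?D -` (- {0}))"
      by (intro topological_tendstoD) simp_all
    then obtain a where a: "a < 1" "\<And>r. a < r \<Longrightarrow> r < 1 \<Longrightarrow> complex_of_real r * z \<in> (?X \<inter> ?D -` (- {0}))"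
      unfolding eventually_at_left_field by blast
    have "continuous_on (?X \<inter> ?D -` (- {0})) (theta M \<gamma>)"
      unfolding theta_def[abs_def]
      by (intro continuous_intros continuous_on_subset[OF R2_cont]) auto
    then have "continuous_on {a<..<1} (\<lambda>r. theta M \<gamma> (of_real r * z))"
    proof (rule continuous_on_compose2)
      show "(\<lambda>r. complex_of_real r * z) ` {a<..<1} \<subseteq> (?X \<inter> ?D -` (- {0}))"
        using a(2) by auto
    qed (intro continuous_intros)
    with a(1) show ?thesis by blast
  qed
qed measurable

end

subsection \<open>The Hardy space and the model space\<close>

lemma circle_inverse: "cmod z = 1 \<Longrightarrow> inverse z = cnj z"
  using complex_norm_square[of z] by (intro inverse_unique) simp

lemma circle_cnj_mult: "cmod z = 1 \<Longrightarrow> z * (cnj z * w) = w" "cmod z = 1 \<Longrightarrow> cnj z * (z * w) = w"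
  using complex_norm_square[of z] by (simp_all add: mult.assoc[symmetric] mult.commute[of "cnj z" z])

lemma sq_int_mT_measurable: "sq_int mT f \<Longrightarrow> f \<in> borel_measurable borel"
  using measurable_cong_sets[OF sets_mT refl, of borel] by (auto simp: sq_int_def)

lemma sq_int_mult_id:
  assumes "sq_int mT f"
  shows "sq_int mT (\<lambda>z. z * f z)"
proof (rule sq_int_mult_bounded[OF assms])
  show "AE z in mT. cmod z \<le> 1" using AE_mT_circle by eventually_elim simp
qed measurable

lemma sq_int_mult_inverse:
  assumes "sq_int mT f"
  shows "sq_int mT (\<lambda>z. inverse z * f z)"
proof (rule sq_int_mult_bounded[OF assms])
  show "AE z in mT. cmod (inverse z) \<le> 1" using AE_mT_circle by eventually_elim (simp add: norm_inverse)
qed measurable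

lemma integrable_sq_int_mT: "sq_int mT f \<Longrightarrow> integrable mT f"
  by (rule integrable_sq_int[OF mT.finite_measure_axioms])

lemma sq_int_const_mT: "sq_int mT (\<lambda>z. c)"
  by (rule sq_int_const[OF mT.finite_measure_axioms])

lemma H2D: "h \<in> H2 \<Longrightarrow> sq_int mT h" "h \<in> H2 \<Longrightarrow> k \<ge> 1 \<Longrightarrow> (\<integral>z. h z * z ^ k \<partial>mT) = 0"
  by (auto simp: H2_def)

lemma sq_int_power_mT: "sq_int mT (\<lambda>z. z ^ k)"
proof (rule sq_int_bounded[OF mT.finite_measure_axioms])
  show "AE z in mT. cmod (z ^ k) \<le> 1" using AE_mT_circle by eventually_elim (simp add: norm_power)
qed measurable

lemma H2_const: "(\<lambda>z. c) \<in> H2"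
  using integral_mT_power by (auto simp: H2_def sq_int_const_mT)

lemma H2_power: "(\<lambda>z. z ^ n) \<in> H2"
  using integral_mT_power by (auto simp: H2_def sq_int_power_mT simp flip: power_add)

lemma H2_lincomb:
  assumes "h \<in> H2" "h' \<in> H2"
  shows "(\<lambda>z. a * h z + b * h' z) \<in> H2"
proof -
  have "(\<integral>z. (a * h z + b * h' z) * z ^ k \<partial>mT) = 0" if "k \<ge> 1" for k
  proof -
    have int: "integrable mT (\<lambda>z. h z * z ^ k)" "integrable mT (\<lambda>z. h' z * z ^ k)"
      using assms by (auto intro!: integrable_mult_sq_int sq_int_power_mT H2D)
    have "(\<integral>z. (a * h z + b * h' z) * z ^ k \<partial>mT) = (\<integral>z. a * (h z * z ^ k) + b * (h' z * z ^ k) \<partial>mT)"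
      by (simp add: algebra_simps)
    also have "\<dots> = a * (\<integral>z. h z * z ^ k \<partial>mT) + b * (\<integral>z. h' z * z ^ k \<partial>mT)"
      using int by simp
    finally show ?thesis using assms that by (simp add: H2D)
  qed
  then show ?thesis
    using assms by (auto simp: H2_def intro!: sq_int_add sq_int_cmult)
qed

lemma H2_mult_id:
  assumes "h \<in> H2"
  shows "(\<lambda>z. z * h z) \<in> H2"
proof -
  have "(\<integral>z. z * h z * z ^ k \<partial>mT) = 0" for k
    using H2D(2)[OF assms, of "Suc k"] by (simp add: mult_ac)
  then show ?thesis using sq_int_mult_id[OF H2D(1)[OF assms]] by (simp add: H2_def)
qed

lemma H2_cong_AE:
  assumes "h \<in> H2" "h' \<in> borel_measurable borel" "AE z in mT. h z = h' z"
  shows "h' \<in> H2"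
proof -
  note [measurable] = assms(2)
  have [measurable]: "h \<in> borel_measurable borel" by (rule sq_int_mT_measurable[OF H2D(1)[OF assms(1)]])
  have "(\<integral>z. h' z * z ^ k \<partial>mT) = (\<integral>z. h z * z ^ k \<partial>mT)" for k
    using assms(3) by (intro integral_cong_AE) auto
  moreover have "sq_int mT h'"
    using H2D(1)[OF assms(1)] _ assms(3) by (rule sq_int_cong_AE) measurable
  ultimately show ?thesis using H2D(2)[OF assms(1)] by (simp add: H2_def)
qed

text \<open>Multiplication by the inverse of z turns the condition for k into the one for k - 1, and
  for k = 1 the subtracted mean makes it hold. The lemma serves to split h into its mean and z times
  an element of \<open>H2\<close>.\<close>

lemma H2_backward_shift:
  assumes h: "h \<in> H2"
  shows "(\<lambda>z. inverse z * (h z - (\<integral>z. h z \<partial>mT))) \<in> H2"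
proof -
  let ?c = "\<integral>z. h z \<partial>mT"
  have sq: "sq_int mT (\<lambda>z. h z - ?c)"
    by (intro sq_int_diff H2D(1) h sq_int_const_mT)
  have [measurable]: "h \<in> borel_measurable borel" by (rule sq_int_mT_measurable[OF H2D(1)[OF h]])
  have "(\<integral>z. inverse z * (h z - ?c) * z ^ k \<partial>mT) = 0" if "k \<ge> 1" for k
  proof -
    obtain j where k: "k = Suc j" using \<open>k \<ge> 1\<close> by (cases k) auto
    have "(\<integral>z. inverse z * (h z - ?c) * z ^ k \<partial>mT) = (\<integral>z. h z * z ^ j - ?c * z ^ j \<partial>mT)"
    proof (rule integral_cong_AE)
      show "AE z in mT. inverse z * (h z - ?c) * z ^ k = h z * z ^ j - ?c * z ^ j"
        using AE_mT_circle
      proof eventually_elim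
        case (elim z)
        then have "z \<noteq> 0" by auto
        then show ?case by (simp add: k field_simps)
      qed
    qed measurable
    also have "\<dots> = (\<integral>z. h z * z ^ j \<partial>mT) - ?c * (\<integral>z. z ^ j \<partial>mT)"
      using integrable_mult_sq_int[OF H2D(1)[OF h] sq_int_power_mT, of j]
        integrable_sq_int_mT[OF sq_int_power_mT, of j]
      by simp
    also have "\<dots> = 0"
      using H2D(2)[OF h, of j] integral_mT_power[of j] mT.prob_space by (cases "j = 0") auto
    finally show ?thesis .
  qed
  then show ?thesis using sq_int_mult_inverse[OF sq] by (simp add: H2_def)
qed

section \<open>Inner products of functions and of pairs\<close>

lemma L2inner_cong_AE:
  assumes "f \<in> borel_measurable N" "f' \<in> borel_measurable N" "g \<in> borel_measurable N" "g' \<in> borel_measurable N"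
    and "AE x in N. f x = f' x" "AE x in N. g x = g' x"
  shows "L2inner N f g = L2inner N f' g'"
  unfolding L2inner_def
proof (rule integral_cong_AE)
  note [measurable] = assms(1-4)
  show "(\<lambda>x. f x * cnj (g x)) \<in> borel_measurable N" "(\<lambda>x. f' x * cnj (g' x)) \<in> borel_measurable N"
    by measurable
  show "AE x in N. f x * cnj (g x) = f' x * cnj (g' x)"
    using assms(5,6) by eventually_elim simp
qed

lemma L2inner_lincomb_left:
  assumes "sq_int N f" "sq_int N g" "sq_int N h"
  shows "L2inner N (\<lambda>x. a * f x + b * g x) h = a * L2inner N f h + b * L2inner N g h"
proof -
  have int: "integrable N (\<lambda>x. f x * cnj (h x))" "integrable N (\<lambda>x. g x * cnj (h x))"
    using assms by (auto intro: integrable_mult_cnj_sq_int)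
  have "L2inner N (\<lambda>x. a * f x + b * g x) h = (\<integral>x. a * (f x * cnj (h x)) + b * (g x * cnj (h x)) \<partial>N)"
    by (simp add: L2inner_def algebra_simps)
  also have "\<dots> = a * L2inner N f h + b * L2inner N g h"
    using int by (simp add: L2inner_def)
  finally show ?thesis .
qed

lemma L2inner_commute: "L2inner N f g = cnj (L2inner N g f)"
  unfolding L2inner_def Bochner_Integration.integral_cnj[symmetric] by (simp add: mult.commute)

definition sq_int_pair :: "pairfun \<Rightarrow> bool" where
  "sq_int_pair x \<longleftrightarrow> sq_int mT (fst x) \<and> sq_int mT (snd x)"

lemma Kinner_cong_AE:
  assumes "sq_int_pair x" "sq_int_pair x'" "sq_int_pair y" "sq_int_pair y'" "ae_eq_pair x x'" "ae_eq_pair y y'"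
  shows "Kinner x y = Kinner x' y'"
  using assms unfolding Kinner_def sq_int_pair_def ae_eq_pair_def
  by (intro arg_cong2[of _ _ _ _ "(+)"] L2inner_cong_AE) (auto simp: sq_int_def)

lemma Kinner_lincomb_left:
  assumes "sq_int_pair x" "sq_int_pair y" "sq_int_pair k"
  shows "Kinner (\<lambda>z. a * fst x z + b * fst y z, \<lambda>z. a * snd x z + b * snd y z) k = a * Kinner x k + b * Kinner y k"
  using assms unfolding Kinner_def sq_int_pair_def by (simp add: L2inner_lincomb_left algebra_simps)

lemma Kinner_commute: "Kinner x y = cnj (Kinner y x)"
  unfolding Kinner_def using L2inner_commute[of mT "fst x" "fst y"] L2inner_commute[of mT "snd x" "snd y"] by simp

lemma Kinner_self_eq_0D:
  assumes "sq_int_pair x" "Kinner x x = 0"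
  shows "AE z in mT. fst x z = 0" "AE z in mT. snd x z = 0"
proof -
  have "complex_of_real ((\<integral>z. (cmod (fst x z))\<^sup>2 \<partial>mT) + (\<integral>z. (cmod (snd x z))\<^sup>2 \<partial>mT)) = of_real 0"
    using assms(2) by (simp add: Kinner_def L2inner_self)
  then have "(\<integral>z. (cmod (fst x z))\<^sup>2 \<partial>mT) + (\<integral>z. (cmod (snd x z))\<^sup>2 \<partial>mT) = 0"
    unfolding of_real_eq_iff .
  moreover have "0 \<le> (\<integral>z. (cmod (fst x z))\<^sup>2 \<partial>mT)" "0 \<le> (\<integral>z. (cmod (snd x z))\<^sup>2 \<partial>mT)"
    by (auto intro!: Bochner_Integration.integral_nonneg)
  ultimately have "(\<integral>z. (cmod (fst x z))\<^sup>2 \<partial>mT) = 0" "(\<integral>z. (cmod (snd x z))\<^sup>2 \<partial>mT) = 0"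
    by linarith+
  then show "AE z in mT. fst x z = 0" "AE z in mT. snd x z = 0"
    using assms(1) by (auto simp: sq_int_pair_def intro: L2inner_self_eq_0D)
qed

lemma Kspace_sq_int_pair: "k \<in> Kspace \<phi> \<Longrightarrow> sq_int_pair k"
  by (auto simp: Kspace_def sq_int_pair_def closDeltaL2_def H2D)

text \<open>If \<open>D * h\<close> approximates g, then \<open>D * (z * h - a)\<close> approximates
  the shifted function with the same error, since |z| = 1.\<close>

lemma closDeltaL2_shift:
  assumes g: "g \<in> closDeltaL2 D" and D: "sq_int mT D"
  shows "(\<lambda>z. z * g z - a * D z) \<in> closDeltaL2 D"
proof -
  have sq: "sq_int mT g" using g by (simp add: closDeltaL2_def)
  have "\<exists>h. sq_int mT h \<and> L2norm mT (\<lambda>z. (z * g z - a * D z) - D z * h z) < e" if "e > 0" for e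
  proof -
    obtain h where h: "sq_int mT h" "L2norm mT (\<lambda>z. g z - D z * h z) < e"
      using g \<open>e > 0\<close> by (auto simp: closDeltaL2_def)
    note [measurable] = sq_int_mT_measurable[OF sq] sq_int_mT_measurable[OF D] sq_int_mT_measurable[OF h(1)]
    have "(\<integral>z. (cmod ((z * g z - a * D z) - D z * (z * h z - a)))\<^sup>2 \<partial>mT) = (\<integral>z. (cmod (g z - D z * h z))\<^sup>2 \<partial>mT)"
    proof (rule integral_cong_AE)
      show "AE z in mT. (cmod ((z * g z - a * D z) - D z * (z * h z - a)))\<^sup>2 = (cmod (g z - D z * h z))\<^sup>2"
        using AE_mT_circle
      proof eventually_elim
        case (elim z)
        have "(z * g z - a * D z) - D z * (z * h z - a) = z * (g z - D z * h z)" by (simp add: algebra_simps)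
        then show ?case using elim by (simp only: norm_mult) simp
      qed
    qed measurable
    then have "L2norm mT (\<lambda>z. (z * g z - a * D z) - D z * (z * h z - a)) < e"
      using h(2) by (simp add: L2norm_def)
    then show ?thesis
      using h(1) by (intro exI[of _ "\<lambda>z. z * h z - a"] conjI sq_int_diff sq_int_mult_id sq_int_const_mT)
  qed
  then show ?thesis
    unfolding closDeltaL2_def by (auto intro!: sq_int_diff sq_int_mult_id sq sq_int_cmult D)
qed

subsection \<open>The Clark operator\<close>

locale clark_operator = circle_measure +
  fixes \<gamma> :: complex and \<Phi> :: "(complex \<Rightarrow> complex) \<Rightarrow> pairfun"
  assumes not_mT: "M \<noteq> mT" and gamma: "cmod \<gamma> < 1" and clark: "clark_Phi M \<gamma> \<Phi>"
begin

definition \<phi> where "\<phi> = bval (theta M \<gamma>)"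
definition \<Delta> where "\<Delta> = Delta \<phi>"
text \<open>The normalization of both defect vectors, because \<open>theta\<close> takes the value
  \<open>- \<gamma>\<close> at 0.\<close>

definition s where "s = complex_of_real (1 / sqrt (1 - (cmod \<gamma>)\<^sup>2))"

definition G where "G f = (\<lambda>z. cnj (\<phi> z) * fst (\<Phi> f) z + \<Delta> z * snd (\<Phi> f) z)"

lemma one_minus_gamma_pos: "1 - (cmod \<gamma>)\<^sup>2 > 0"
  using gamma by (simp add: power_less_one_iff)

lemma s_nonzero: "s \<noteq> 0" and cnj_s: "cnj s = s"
  using one_minus_gamma_pos by (auto simp: s_def)

lemma s_square: "s * s * (1 - \<gamma> * cnj \<gamma>) = 1"
proof -
  have "1 / sqrt (1 - (cmod \<gamma>)\<^sup>2) * (1 / sqrt (1 - (cmod \<gamma>)\<^sup>2)) * (1 - (cmod \<gamma>)\<^sup>2) = 1"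
    using one_minus_gamma_pos by simp
  then have "complex_of_real (1 / sqrt (1 - (cmod \<gamma>)\<^sup>2) * (1 / sqrt (1 - (cmod \<gamma>)\<^sup>2)) * (1 - (cmod \<gamma>)\<^sup>2)) = 1"
    by (simp only: of_real_1)
  then show ?thesis
    unfolding of_real_mult of_real_diff complex_norm_square s_def by simp
qed

lemma sqrt_eq: "complex_of_real (sqrt (1 - (cmod \<gamma>)\<^sup>2)) = 1 / s"
  by (simp add: s_def)

lemma phi_measurable [measurable]: "\<phi> \<in> borel_measurable borel"
  unfolding \<phi>_def by (rule bval_theta_measurable[OF not_mT gamma])

lemma Delta_measurable [measurable]: "\<Delta> \<in> borel_measurable borel"
  unfolding \<Delta>_def Delta_def[abs_def] by measurable

lemma cnj_Delta: "cnj (\<Delta> z) = \<Delta> z"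
  by (simp add: \<Delta>_def Delta_def)

lemma
  shows Phi_Kspace: "sq_int M f \<Longrightarrow> \<Phi> f \<in> Kspace \<phi>"
    and Phi_lincomb: "sq_int M f \<Longrightarrow> sq_int M g \<Longrightarrow> ae_eq_pair (\<Phi> (\<lambda>x. a * f x + g x))
          (\<lambda>z. a * fst (\<Phi> f) z + fst (\<Phi> g) z, \<lambda>z. a * snd (\<Phi> f) z + snd (\<Phi> g) z)"
    and Phi_isometry: "sq_int M f \<Longrightarrow> sq_int M g \<Longrightarrow> Kinner (\<Phi> f) (\<Phi> g) = L2inner M f g"
    and Phi_intertwines: "sq_int M f \<Longrightarrow> k \<in> Kspace \<phi> \<Longrightarrow>
        Kinner (\<lambda>z. z * fst (\<Phi> f) z - fst (\<Phi> (Ugamma M \<gamma> f)) z,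
                \<lambda>z. z * snd (\<Phi> f) z - snd (\<Phi> (Ugamma M \<gamma> f)) z) k = 0"
    and Phi_one: "ae_eq_pair (\<Phi> (\<lambda>_. 1)) (cvec M \<gamma>)"
    and Phi_cnj: "ae_eq_pair (\<Phi> (\<lambda>\<xi>. cnj \<xi>)) (c1vec M \<gamma>)"
  using clark unfolding clark_Phi_def Let_def \<phi>_def by blast+

lemma cvec_eq: "cvec M \<gamma> = (\<lambda>z. s * (1 + cnj \<gamma> * \<phi> z), \<lambda>z. s * (cnj \<gamma> * \<Delta> z))"
  by (simp add: cvec_def Let_def theta_at_0 s_def \<phi>_def \<Delta>_def)

lemma c1vec_eq: "c1vec M \<gamma> = (\<lambda>z. s * (inverse z * (\<phi> z + \<gamma>)), \<lambda>z. s * (inverse z * \<Delta> z))"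
  by (simp add: c1vec_def Let_def theta_at_0 s_def \<phi>_def \<Delta>_def)

lemma AE_Phi_one:
  "AE z in mT. fst (\<Phi> (\<lambda>_. 1)) z = s * (1 + cnj \<gamma> * \<phi> z)"
  "AE z in mT. snd (\<Phi> (\<lambda>_. 1)) z = s * (cnj \<gamma> * \<Delta> z)"
  using Phi_one by (simp_all add: ae_eq_pair_def cvec_eq)

lemma AE_Phi_cnj:
  "AE z in mT. fst (\<Phi> (\<lambda>\<xi>. cnj \<xi>)) z = s * (inverse z * (\<phi> z + \<gamma>))"
  "AE z in mT. snd (\<Phi> (\<lambda>\<xi>. cnj \<xi>)) z = s * (inverse z * \<Delta> z)"
  using Phi_cnj by (simp_all add: ae_eq_pair_def c1vec_eq)

lemma sq_int_M_const: "sq_int M (\<lambda>_. c)"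
  by (rule sq_int_const[OF finite_measure_axioms])

lemma sq_int_M_cnj: "sq_int M (\<lambda>\<xi>. cnj \<xi>)"
proof (rule sq_int_bounded[OF finite_measure_axioms])
  show "AE x in M. cmod (cnj x) \<le> 1" using circle by eventually_elim simp
qed measurable

lemma sq_int_M_mult_id:
  assumes "sq_int M f"
  shows "sq_int M (\<lambda>\<xi>. \<xi> * f \<xi>)"
proof (rule sq_int_mult_bounded[OF assms])
  show "AE \<xi> in M. cmod \<xi> \<le> 1" using circle by eventually_elim simp
qed measurable

lemma fst_Phi_H2: "sq_int M f \<Longrightarrow> fst (\<Phi> f) \<in> H2"
  and snd_Phi_clos: "sq_int M f \<Longrightarrow> snd (\<Phi> f) \<in> closDeltaL2 \<Delta>"
  using Phi_Kspace by (auto simp: Kspace_def \<Delta>_def)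

lemma Phi_sq_int_pair: "sq_int M f \<Longrightarrow> sq_int_pair (\<Phi> f)"
  using Phi_Kspace Kspace_sq_int_pair by blast

lemma sq_int_fst_Phi: "sq_int M f \<Longrightarrow> sq_int mT (fst (\<Phi> f))"
  and sq_int_snd_Phi: "sq_int M f \<Longrightarrow> sq_int mT (snd (\<Phi> f))"
  using Phi_sq_int_pair by (auto simp: sq_int_pair_def)

text \<open>Solve the first component of the image of \<open>b_1\<close> for \<open>\<phi>\<close>:
  up to scaling and an additive constant it is z times an element of \<open>H2\<close>. No radial
  limit is involved at this point.\<close>

lemma phi_H2: "\<phi> \<in> H2"
proof (rule H2_cong_AE)
  show "(\<lambda>z. (1 / s) * (z * fst (\<Phi> (\<lambda>\<xi>. cnj \<xi>)) z) + (- \<gamma>) * 1) \<in> H2"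
    by (intro H2_lincomb H2_mult_id fst_Phi_H2 sq_int_M_cnj H2_const)
  show "AE z in mT. (1 / s) * (z * fst (\<Phi> (\<lambda>\<xi>. cnj \<xi>)) z) + (- \<gamma>) * 1 = \<phi> z"
    using AE_Phi_cnj(1) AE_mT_circle
  proof eventually_elim
    case (elim z)
    then have "z \<noteq> 0" by auto
    then show ?case using s_nonzero elim by (simp add: field_simps)
  qed
qed measurable

lemma sq_int_phi: "sq_int mT \<phi>"
  by (rule H2D(1)[OF phi_H2])

lemma sq_int_Delta: "sq_int mT \<Delta>"
proof (rule sq_int_cong_AE)
  show "sq_int mT (\<lambda>z. (1 / s) * (z * snd (\<Phi> (\<lambda>\<xi>. cnj \<xi>)) z))"
    by (intro sq_int_cmult sq_int_mult_id sq_int_snd_Phi sq_int_M_cnj)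
  show "AE z in mT. (1 / s) * (z * snd (\<Phi> (\<lambda>\<xi>. cnj \<xi>)) z) = \<Delta> z"
    using AE_Phi_cnj(2) AE_mT_circle
  proof eventually_elim
    case (elim z)
    then have "z \<noteq> 0" by auto
    then show ?case using s_nonzero elim by (simp add: field_simps)
  qed
qed measurable

text \<open>Where the radial limit of \<^term>\<open>theta M \<gamma>\<close> does not exist, nothing is known about \<^term>\<open>\<phi>\<close>. As the
  real square root is odd, \<open>|\<phi>|\<^sup>2 + |\<Delta>|\<^sup>2 > 1\<close> wherever \<open>|\<phi>| > 1\<close>. Comparing the norms of
  the two defect vectors shows that this sum has mean 1, hence that \<open>|\<phi>| \<le> 1\<close> almost everywhere.\<close>

lemma phi_Delta_ge_1: "(cmod (\<phi> z))\<^sup>2 + (cmod (\<Delta> z))\<^sup>2 \<ge> 1"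
  and phi_Delta_eq_1D: "(cmod (\<phi> z))\<^sup>2 + (cmod (\<Delta> z))\<^sup>2 = 1 \<Longrightarrow> cmod (\<phi> z) \<le> 1"
proof -
  have D: "(cmod (\<Delta> z))\<^sup>2 = \<bar>1 - (cmod (\<phi> z))\<^sup>2\<bar>"
  proof -
    have "(cmod (complex_of_real (sqrt x)))\<^sup>2 = \<bar>x\<bar>" for x
      by (simp add: power2_eq_square)
    then show ?thesis unfolding \<Delta>_def Delta_def .
  qed
  then show "(cmod (\<phi> z))\<^sup>2 + (cmod (\<Delta> z))\<^sup>2 \<ge> 1" by simp
  assume "(cmod (\<phi> z))\<^sup>2 + (cmod (\<Delta> z))\<^sup>2 = 1"
  with D have "(cmod (\<phi> z))\<^sup>2 \<le> 1\<^sup>2" by (simp add: abs_if split: if_splits)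
  then show "cmod (\<phi> z) \<le> 1" by (rule power2_le_imp_le) simp
qed

lemma AE_phi_Delta: "AE z in mT. (cmod (\<phi> z))\<^sup>2 + (cmod (\<Delta> z))\<^sup>2 = 1"
proof -
  let ?n = "\<lambda>x z. (cmod (fst x z))\<^sup>2 + (cmod (snd x z))\<^sup>2"
  let ?I = "\<lambda>z. (cmod (\<phi> z))\<^sup>2 + (cmod (\<Delta> z))\<^sup>2 - 1"
  have int: "integrable mT (\<lambda>z. (cmod (\<phi> z))\<^sup>2)" "integrable mT (\<lambda>z. (cmod (\<Delta> z))\<^sup>2)"
    by (rule sq_intD(2)[OF sq_int_phi], rule sq_intD(2)[OF sq_int_Delta])
  have sq_c: "sq_int_pair (cvec M \<gamma>)" "sq_int_pair (c1vec M \<gamma>)"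
    unfolding cvec_eq c1vec_eq sq_int_pair_def
    by (auto intro!: sq_int_cmult sq_int_add sq_int_mult_inverse sq_int_const_mT sq_int_phi sq_int_Delta)
  have "Kinner (cvec M \<gamma>) (cvec M \<gamma>) = L2inner M (\<lambda>_. 1) (\<lambda>_. 1)"
    using Phi_isometry[OF sq_int_M_const sq_int_M_const]
      Kinner_cong_AE[OF Phi_sq_int_pair[OF sq_int_M_const] sq_c(1) Phi_sq_int_pair[OF sq_int_M_const] sq_c(1) Phi_one Phi_one]
    by simp
  also have "\<dots> = 1" using prob_space by (simp add: L2inner_def)
  finally have 1: "Kinner (cvec M \<gamma>) (cvec M \<gamma>) = 1" .
  have "Kinner (c1vec M \<gamma>) (c1vec M \<gamma>) = L2inner M (\<lambda>\<xi>. cnj \<xi>) (\<lambda>\<xi>. cnj \<xi>)"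
    using Phi_isometry[OF sq_int_M_cnj sq_int_M_cnj]
      Kinner_cong_AE[OF Phi_sq_int_pair[OF sq_int_M_cnj] sq_c(2) Phi_sq_int_pair[OF sq_int_M_cnj] sq_c(2) Phi_cnj Phi_cnj]
    by simp
  also have "\<dots> = (\<integral>\<xi>. 1 \<partial>M)"
    unfolding L2inner_def
  proof (rule integral_cong_AE)
    show "AE \<xi> in M. cnj \<xi> * cnj (cnj \<xi>) = 1"
      using circle by eventually_elim (use circle_cnj_mult(2)[where w = 1] in simp)
  qed measurable
  also have "\<dots> = 1" using prob_space by simp
  finally have 2: "Kinner (c1vec M \<gamma>) (c1vec M \<gamma>) = 1" .
  have pair: "Kinner x x = of_real (\<integral>z. (cmod (fst x z))\<^sup>2 + (cmod (snd x z))\<^sup>2 \<partial>mT)" if "sq_int_pair x" for x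
    using that by (simp add: Kinner_def L2inner_self sq_int_pair_def sq_int_def)
  \<comment> \<open>Both defect vectors are images of unit vectors, so their squared norms agree.
    The pointwise difference of the squares is \<open>?I\<close>, thanks to the normalization of
    s.\<close>
  have "(\<integral>z. ?n (c1vec M \<gamma>) z \<partial>mT) -
        (\<integral>z. ?n (cvec M \<gamma>) z \<partial>mT) = 0"
    using 1 2 unfolding pair[OF sq_c(1)] pair[OF sq_c(2)] by simp
  also have "(\<integral>z. ?n (c1vec M \<gamma>) z \<partial>mT) -
        (\<integral>z. ?n (cvec M \<gamma>) z \<partial>mT) =
      (\<integral>z. (?n (c1vec M \<gamma>) z) -
           (?n (cvec M \<gamma>) z) \<partial>mT)"
    using sq_c by (intro Bochner_Integration.integral_diff[symmetric]) (auto simp: sq_int_pair_def sq_int_def)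
  also have "\<dots> = (\<integral>z. ?I z \<partial>mT)"
  proof (rule integral_cong_AE)
    show "AE z in mT. (?n (c1vec M \<gamma>) z) -
           (?n (cvec M \<gamma>) z) = ?I z"
      using AE_mT_circle
    proof eventually_elim
      case (elim z)
      let ?q = "(cmod s)\<^sup>2"
      have q: "?q * (1 - (cmod \<gamma>)\<^sup>2) = 1"
        using one_minus_gamma_pos by (simp add: s_def norm_divide power_divide)
      have X1: "?n (c1vec M \<gamma>) z =
          ?q * ((cmod (\<phi> z + \<gamma>))\<^sup>2 + (cmod (\<Delta> z))\<^sup>2)"
        unfolding c1vec_eq fst_conv snd_conv norm_mult norm_inverse power_mult_distrib elim
        by (simp add: distrib_left[of "(cmod s)\<^sup>2"])
      have X2: "?n (cvec M \<gamma>) z =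
          ?q * ((cmod (1 + cnj \<gamma> * \<phi> z))\<^sup>2 + (cmod \<gamma>)\<^sup>2 * (cmod (\<Delta> z))\<^sup>2)"
        unfolding cvec_eq fst_conv snd_conv norm_mult power_mult_distrib
        by (simp add: distrib_left[of "(cmod s)\<^sup>2"])
      have X3: "(cmod (\<phi> z + \<gamma>))\<^sup>2 - (cmod (1 + cnj \<gamma> * \<phi> z))\<^sup>2 = (1 - (cmod \<gamma>)\<^sup>2) * ((cmod (\<phi> z))\<^sup>2 - 1)"
      proof -
        have "complex_of_real ((cmod (\<phi> z + \<gamma>))\<^sup>2 - (cmod (1 + cnj \<gamma> * \<phi> z))\<^sup>2) =
          complex_of_real ((1 - (cmod \<gamma>)\<^sup>2) * ((cmod (\<phi> z))\<^sup>2 - 1))"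
          unfolding of_real_mult of_real_diff complex_norm_square by (simp add: algebra_simps)
        then show ?thesis by (simp only: of_real_eq_iff)
      qed
      have "(?n (c1vec M \<gamma>) z) -
           (?n (cvec M \<gamma>) z) = (?q * (1 - (cmod \<gamma>)\<^sup>2)) * ?I z"
      proof -
        have "x - y = (q * (1 - g)) * (p + d - 1)"
          if "x = q * (a + d)" "y = q * (b + g * d)" "a - b = (1 - g) * (p - 1)" for x y q g p d a b :: real
          using that by algebra
        from this[OF X1 X2 X3] show ?thesis .
      qed
      then show ?case unfolding q by simp
    qed
  next
    show "(\<lambda>z. (?n (c1vec M \<gamma>) z) -
           (?n (cvec M \<gamma>) z)) \<in> borel_measurable mT"
      unfolding cvec_eq c1vec_eq fst_conv snd_conv by measurable
  qed measurable
  finally have "(\<integral>z. ?I z \<partial>mT) = 0" by simp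
  moreover have "integrable mT ?I" using int by simp
  ultimately have "AE z in mT. ?I z = 0"
    using integral_nonneg_eq_0_iff_AE[of mT ?I] phi_Delta_ge_1 by simp
  then show ?thesis by eventually_elim simp
qed

lemma AE_phi_le_1: "AE z in mT. cmod (\<phi> z) \<le> 1"
  using AE_phi_Delta by eventually_elim (rule phi_Delta_eq_1D)

lemma AE_Delta_le_1: "AE z in mT. cmod (\<Delta> z) \<le> 1"
  using AE_phi_Delta
proof eventually_elim
  case (elim z)
  then have "(cmod (\<Delta> z))\<^sup>2 \<le> 1\<^sup>2"
    using zero_le_power2[of "cmod (\<phi> z)"] unfolding one_power2 by linarith
  then show ?case by (rule power2_le_imp_le) simp
qed

lemma AE_Delta_square: "AE z in mT. \<Delta> z * \<Delta> z = 1 - \<phi> z * cnj (\<phi> z)"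
  using AE_phi_Delta
proof eventually_elim
  case (elim z)
  then have "complex_of_real ((cmod (\<phi> z))\<^sup>2 + (cmod (\<Delta> z))\<^sup>2) = of_real 1" by simp
  then have "\<phi> z * cnj (\<phi> z) + \<Delta> z * cnj (\<Delta> z) = 1"
    unfolding of_real_add complex_norm_square by simp
  then show ?case unfolding cnj_Delta by (simp add: algebra_simps)
qed

end

section \<open>The function \<open>G\<close> and the intertwining relation\<close>

context clark_operator
begin

lemma sq_int_mult_phi: "sq_int mT h \<Longrightarrow> sq_int mT (\<lambda>z. \<phi> z * h z)"
  and sq_int_mult_cnj_phi: "sq_int mT h \<Longrightarrow> sq_int mT (\<lambda>z. cnj (\<phi> z) * h z)"
  and sq_int_mult_Delta: "sq_int mT h \<Longrightarrow> sq_int mT (\<lambda>z. \<Delta> z * h z)"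
  using AE_phi_le_1 AE_Delta_le_1 by (auto intro!: sq_int_mult_bounded[where B = 1])

lemma sq_int_G: "sq_int M f \<Longrightarrow> sq_int mT (G f)"
  unfolding G_def by (intro sq_int_add sq_int_mult_cnj_phi sq_int_mult_Delta sq_int_fst_Phi sq_int_snd_Phi)

lemma G_measurable: "sq_int M f \<Longrightarrow> G f \<in> borel_measurable borel"
  by (rule sq_int_mT_measurable[OF sq_int_G])

lemma Kinner_phi_Delta:
  assumes x: "sq_int_pair x" and h: "sq_int mT h"
  shows "Kinner x (\<lambda>z. \<phi> z * h z, \<lambda>z. \<Delta> z * h z) =
    (\<integral>z. (cnj (\<phi> z) * fst x z + \<Delta> z * snd x z) * cnj (h z) \<partial>mT)"
proof -
  have x': "sq_int mT (fst x)" "sq_int mT (snd x)" using x by (auto simp: sq_int_pair_def)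
  have int: "integrable mT (\<lambda>z. fst x z * cnj (\<phi> z * h z))" "integrable mT (\<lambda>z. snd x z * cnj (\<Delta> z * h z))"
    by (intro integrable_mult_cnj_sq_int sq_int_mult_phi sq_int_mult_Delta x' h)+
  have "Kinner x (\<lambda>z. \<phi> z * h z, \<lambda>z. \<Delta> z * h z) =
    (\<integral>z. fst x z * cnj (\<phi> z * h z) + snd x z * cnj (\<Delta> z * h z) \<partial>mT)"
    unfolding Kinner_def L2inner_def fst_conv snd_conv using int by (rule Bochner_Integration.integral_add[symmetric])
  also have "\<dots> = (\<integral>z. (cnj (\<phi> z) * fst x z + \<Delta> z * snd x z) * cnj (h z) \<partial>mT)"
    by (rule Bochner_Integration.integral_cong) (simp_all add: cnj_Delta algebra_simps)
  finally show ?thesis .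
qed

lemma Kspace_iff:
  "x \<in> Kspace \<phi> \<longleftrightarrow> fst x \<in> H2 \<and> snd x \<in> closDeltaL2 \<Delta> \<and>
    (\<forall>h\<in>H2. Kinner x (\<lambda>z. \<phi> z * h z, \<lambda>z. \<Delta> z * h z) = 0)"
  by (simp add: Kspace_def \<Delta>_def)

lemma Kspace_orth:
  "x \<in> Kspace \<phi> \<Longrightarrow> h \<in> H2 \<Longrightarrow> Kinner x (\<lambda>z. \<phi> z * h z, \<lambda>z. \<Delta> z * h z) = 0"
  by (simp add: Kspace_iff)

lemma G_orth_H2:
  assumes f: "sq_int M f" and h: "h \<in> H2"
  shows "(\<integral>z. G f z * cnj (h z) \<partial>mT) = 0"
  using Phi_Kspace[OF f] h Kinner_phi_Delta[OF Phi_sq_int_pair[OF f] H2D(1)[OF h]]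
  unfolding Kspace_iff G_def by simp

lemma G_H2minus: "sq_int M f \<Longrightarrow> G f \<in> H2minus"
  using sq_int_G G_orth_H2 by (simp add: H2minus_def L2inner_def)

lemma integral_G_cnj_power: "sq_int M f \<Longrightarrow> (\<integral>z. G f z * cnj z ^ n \<partial>mT) = 0"
  using G_orth_H2[OF _ H2_power[of n]] by simp

definition b1 where "b1 f = L2inner M f (\<lambda>\<xi>. cnj \<xi>)"

text \<open>Pair the image of f with the second defect vector. As \<open>cnj (inverse z) = z\<close>
  on the circle, the pairing is s times the integral of \<open>z * G f z\<close> plus a multiple of
  the integral of \<open>z * fst (\<Phi> f) z\<close>, which is zero because the first component
  lies in \<open>H2\<close>.\<close>

lemma integral_z_G:
  assumes f: "sq_int M f"
  shows "(\<integral>z. z * G f z \<partial>mT) = b1 f / s"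
proof -
  have sq_c1: "sq_int_pair (c1vec M \<gamma>)"
    unfolding c1vec_eq sq_int_pair_def
    by (auto intro!: sq_int_cmult sq_int_add sq_int_mult_inverse sq_int_const_mT sq_int_phi sq_int_Delta)
  have refl: "ae_eq_pair (\<Phi> f) (\<Phi> f)" by (simp add: ae_eq_pair_def)
  note sq = sq_int_fst_Phi[OF f] sq_int_snd_Phi[OF f]
  note [measurable] = sq_int_mT_measurable[OF sq(1)] sq_int_mT_measurable[OF sq(2)] G_measurable[OF f]
  have "b1 f = Kinner (\<Phi> f) (\<Phi> (\<lambda>\<xi>. cnj \<xi>))"
    unfolding b1_def by (rule Phi_isometry[OF f sq_int_M_cnj, symmetric])
  also have "\<dots> = Kinner (\<Phi> f) (c1vec M \<gamma>)"
    by (rule Kinner_cong_AE[OF Phi_sq_int_pair[OF f] Phi_sq_int_pair[OF f] Phi_sq_int_pair[OF sq_int_M_cnj] sq_c1 refl Phi_cnj])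
  also have "\<dots> = (\<integral>z. fst (\<Phi> f) z * cnj (fst (c1vec M \<gamma>) z) + snd (\<Phi> f) z * cnj (snd (c1vec M \<gamma>) z) \<partial>mT)"
    unfolding Kinner_def L2inner_def
    using sq sq_c1 by (intro Bochner_Integration.integral_add[symmetric] integrable_mult_cnj_sq_int) (auto simp: sq_int_pair_def)
  also have "\<dots> = (\<integral>z. s * (z * G f z) + s * cnj \<gamma> * (fst (\<Phi> f) z * z ^ 1) \<partial>mT)"
  proof (rule integral_cong_AE)
    show "AE z in mT. fst (\<Phi> f) z * cnj (fst (c1vec M \<gamma>) z) + snd (\<Phi> f) z * cnj (snd (c1vec M \<gamma>) z) =
      s * (z * G f z) + s * cnj \<gamma> * (fst (\<Phi> f) z * z ^ 1)"
      using AE_mT_circle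
    proof eventually_elim
      case (elim z)
      have "cnj (inverse z) = z" using circle_inverse[OF elim] by simp
      then show ?case
        by (simp add: c1vec_eq cnj_s cnj_Delta G_def algebra_simps del: complex_cnj_inverse)
    qed
  next
    show "(\<lambda>z. fst (\<Phi> f) z * cnj (fst (c1vec M \<gamma>) z) + snd (\<Phi> f) z * cnj (snd (c1vec M \<gamma>) z)) \<in> borel_measurable mT"
      unfolding c1vec_eq fst_conv snd_conv by measurable
  qed measurable
  also have "\<dots> = s * (\<integral>z. z * G f z \<partial>mT) + s * cnj \<gamma> * (\<integral>z. fst (\<Phi> f) z * z ^ 1 \<partial>mT)"
    using integrable_sq_int_mT[OF sq_int_mult_id[OF sq_int_G[OF f]]]
      integrable_mult_sq_int[OF sq(1) sq_int_power_mT[of 1]]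
    by (subst Bochner_Integration.integral_add) simp_all
  also have "(\<integral>z. fst (\<Phi> f) z * z ^ 1 \<partial>mT) = 0"
    by (rule H2D(2)[OF fst_Phi_H2[OF f]]) simp
  finally show ?thesis using s_nonzero by (simp add: field_simps)
qed

lemma sq_int_Ugamma: "sq_int M f \<Longrightarrow> sq_int M (Ugamma M \<gamma> f)"
  unfolding Ugamma_def by (intro sq_int_add sq_int_M_mult_id sq_int_M_const) simp_all

text \<open>Since \<open>G f\<close> has only negative frequencies, \<open>z * G f z\<close> leaves
  \<open>H2minus\<close> by a constant a only. Subtracting a times
  \<open>(\<phi>, \<Delta>)\<close>, which is orthogonal to the model space, puts z times the image
  of f back into that space, so this is the projection that the intertwining relation asks
  for.\<close>

lemma AE_Phi_Ugamma:
  assumes f: "sq_int M f"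
  defines "a \<equiv> (\<integral>z. z * G f z \<partial>mT)"
  shows "AE z in mT. fst (\<Phi> (Ugamma M \<gamma> f)) z = z * fst (\<Phi> f) z - a * \<phi> z"
    and "AE z in mT. snd (\<Phi> (Ugamma M \<gamma> f)) z = z * snd (\<Phi> f) z - a * \<Delta> z"
proof -
  define d where "d = (\<lambda>z. z * fst (\<Phi> f) z - a * \<phi> z, \<lambda>z. z * snd (\<Phi> f) z - a * \<Delta> z)"
  let ?u = "\<Phi> (Ugamma M \<gamma> f)"
  let ?p = "(\<lambda>z. \<phi> z * 1, \<lambda>z. \<Delta> z * 1)"
  have Uf: "sq_int M (Ugamma M \<gamma> f)" by (rule sq_int_Ugamma[OF f])
  note sq = sq_int_fst_Phi[OF f] sq_int_snd_Phi[OF f]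
  have sq_d: "sq_int_pair d"
    unfolding d_def sq_int_pair_def fst_conv snd_conv
    by (intro conjI sq_int_diff sq_int_mult_id sq sq_int_cmult sq_int_phi sq_int_Delta)
  note [measurable] = G_measurable[OF f]
  have d_K: "d \<in> Kspace \<phi>"
    unfolding Kspace_iff
  proof (intro conjI ballI)
    show "fst d \<in> H2"
      using H2_lincomb[OF H2_mult_id[OF fst_Phi_H2[OF f]] phi_H2, of 1 "- a"] by (simp add: d_def)
    show "snd d \<in> closDeltaL2 \<Delta>"
      using closDeltaL2_shift[OF snd_Phi_clos[OF f] sq_int_Delta] by (simp add: d_def)
    fix h assume h: "h \<in> H2"
    note [measurable] = sq_int_mT_measurable[OF H2D(1)[OF h]]
    \<comment> \<open>Split h as \<open>h0 + z * h'\<close>. Against the second part,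
      \<open>z * G f z\<close> becomes \<open>G f\<close> against h', which gives 0. The mean
      contributes \<open>a * cnj h0\<close>, which cancels the term coming from the subtracted
      pair.\<close>
    define h0 where "h0 = (\<integral>z. h z \<partial>mT)"
    define h' where "h' z = inverse z * (h z - h0)" for z
    have h': "h' \<in> H2" using H2_backward_shift[OF h] unfolding h'_def h0_def .
    note [measurable] = sq_int_mT_measurable[OF H2D(1)[OF h']]
    note [measurable] = sq_int_mT_measurable[OF sq(1)] sq_int_mT_measurable[OF sq(2)]
    have "Kinner d (\<lambda>z. \<phi> z * h z, \<lambda>z. \<Delta> z * h z) =
        (\<integral>z. (cnj (\<phi> z) * fst d z + \<Delta> z * snd d z) * cnj (h z) \<partial>mT)"
      by (rule Kinner_phi_Delta[OF sq_d H2D(1)[OF h]])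
    also have "\<dots> = (\<integral>z. (cnj h0 * (z * G f z) + G f z * cnj (h' z)) + (- a) * cnj (h z) \<partial>mT)"
    proof (rule integral_cong_AE)
      show "AE z in mT. (cnj (\<phi> z) * fst d z + \<Delta> z * snd d z) * cnj (h z) =
          (cnj h0 * (z * G f z) + G f z * cnj (h' z)) + (- a) * cnj (h z)"
        using AE_mT_circle AE_Delta_square
      proof eventually_elim
        case (elim z)
        have "cnj (\<phi> z) * fst d z + \<Delta> z * snd d z = z * G f z - a * (\<phi> z * cnj (\<phi> z) + \<Delta> z * \<Delta> z)"
          by (simp add: d_def G_def algebra_simps)
        also have "\<dots> = z * G f z - a" using elim(2) by simp
        finally have 1: "cnj (\<phi> z) * fst d z + \<Delta> z * snd d z = z * G f z - a" .
        have "z \<noteq> 0" using elim(1) by auto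
        then have "h z = h0 + z * h' z" by (simp add: h'_def field_simps)
        then have "z * cnj (h z) = cnj h0 * z + z * (cnj z * cnj (h' z))"
          by (simp add: algebra_simps)
        then have 2: "z * cnj (h z) = cnj h0 * z + cnj (h' z)"
          unfolding circle_cnj_mult(1)[OF elim(1)] .
        have "(z * G f z - a) * cnj (h z) = G f z * (z * cnj (h z)) - a * cnj (h z)"
          by (simp add: algebra_simps)
        also have "\<dots> = G f z * (cnj h0 * z + cnj (h' z)) - a * cnj (h z)" unfolding 2 ..
        finally show ?case unfolding 1 by (simp add: algebra_simps)
      qed
    next
      show "(\<lambda>z. (cnj (\<phi> z) * fst d z + \<Delta> z * snd d z) * cnj (h z)) \<in> borel_measurable mT"
        unfolding d_def fst_conv snd_conv by measurable
    qed measurable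
    also have "\<dots> = (cnj h0 * (\<integral>z. z * G f z \<partial>mT) + (\<integral>z. G f z * cnj (h' z) \<partial>mT)) + (- a) * (\<integral>z. cnj (h z) \<partial>mT)"
    proof -
      have "integrable mT (\<lambda>z. z * G f z)" "integrable mT (\<lambda>z. G f z * cnj (h' z))" "integrable mT (\<lambda>z. cnj (h z))"
        by (intro integrable_sq_int_mT sq_int_mult_id sq_int_G f integrable_mult_cnj_sq_int sq_int_cnj H2D h h')+
      then show ?thesis by simp
    qed
    also have "(\<integral>z. cnj (h z) \<partial>mT) = cnj h0"
      unfolding h0_def by (rule Bochner_Integration.integral_cnj)
    also have "(\<integral>z. G f z * cnj (h' z) \<partial>mT) = 0"
      by (rule G_orth_H2[OF f h'])
    finally show "Kinner d (\<lambda>z. \<phi> z * h z, \<lambda>z. \<Delta> z * h z) = 0"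
      by (simp add: a_def)
  qed
  have sq_p: "sq_int_pair ?p"
    using sq_int_phi sq_int_Delta by (simp add: sq_int_pair_def)
  have sq_u: "sq_int_pair ?u" by (rule Phi_sq_int_pair[OF Uf])
  define v where "v = (\<lambda>z. z * fst (\<Phi> f) z - fst ?u z, \<lambda>z. z * snd (\<Phi> f) z - snd ?u z)"
  have sq_v: "sq_int_pair v"
    using sq_u sq unfolding v_def sq_int_pair_def fst_conv snd_conv by (intro conjI sq_int_diff sq_int_mult_id) auto
  \<comment> \<open>The difference of the candidate and the actual image, both in the model space.
    Rewritten through v and \<open>?p\<close> it is also orthogonal to that space, hence to
    itself.\<close>
  define e where "e = (\<lambda>z. 1 * fst d z + (-1) * fst ?u z, \<lambda>z. 1 * snd d z + (-1) * snd ?u z)"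
  have e_eq: "e = (\<lambda>z. 1 * fst v z + (- a) * fst ?p z, \<lambda>z. 1 * snd v z + (- a) * snd ?p z)"
    by (auto simp: e_def d_def v_def fun_eq_iff)
  have sq_e: "sq_int_pair e"
    using sq_d sq_u unfolding e_def sq_int_pair_def fst_conv snd_conv by (intro conjI sq_int_add sq_int_cmult) auto
  have orth: "Kinner e k = 0" if k: "k \<in> Kspace \<phi>" for k
  proof -
    have "Kinner e k = 1 * Kinner v k + (- a) * Kinner ?p k"
      unfolding e_eq by (rule Kinner_lincomb_left[OF sq_v sq_p Kspace_sq_int_pair[OF k]])
    moreover have "Kinner v k = 0" unfolding v_def by (rule Phi_intertwines[OF f k])
    moreover have "Kinner k ?p = 0"
      by (rule Kspace_orth[OF k H2_const])
    then have "Kinner ?p k = 0" by (subst Kinner_commute) simp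
    ultimately show ?thesis by simp
  qed
  have "Kinner d e = 0" by (subst Kinner_commute) (simp only: orth[OF d_K] complex_cnj_zero)
  moreover have "Kinner ?u e = 0"
    by (subst Kinner_commute) (simp only: orth[OF Phi_Kspace[OF Uf]] complex_cnj_zero)
  moreover have "Kinner e e = 1 * Kinner d e + (-1) * Kinner ?u e"
    by (subst (1) e_def) (rule Kinner_lincomb_left[OF sq_d sq_u sq_e])
  ultimately have "Kinner e e = 0" by simp
  from Kinner_self_eq_0D[OF sq_e this]
  have 0: "AE z in mT. fst e z = 0" "AE z in mT. snd e z = 0" .
  show "AE z in mT. fst ?u z = z * fst (\<Phi> f) z - a * \<phi> z"
    using 0(1) by eventually_elim (simp add: e_def d_def)
  show "AE z in mT. snd ?u z = z * snd (\<Phi> f) z - a * \<Delta> z"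
    using 0(2) by eventually_elim (simp add: e_def d_def)
qed

text \<open>The identity \<open>\<phi> * cnj \<phi> + \<Delta> * \<Delta> = 1\<close> turns the
  removed multiple of \<open>(\<phi>, \<Delta>)\<close> into a constant.\<close>

lemma AE_G_Ugamma:
  assumes f: "sq_int M f"
  shows "AE z in mT. G (Ugamma M \<gamma> f) z = z * G f z - b1 f / s"
  using AE_Phi_Ugamma[OF f] AE_Delta_square
proof eventually_elim
  case (elim z)
  let ?a = "b1 f / s"
  have "G (Ugamma M \<gamma> f) z = z * G f z - ?a * (\<phi> z * cnj (\<phi> z) + \<Delta> z * \<Delta> z)"
    unfolding G_def elim(1,2) integral_z_G[OF f, unfolded G_def] by (simp add: algebra_simps)
  then show ?case using elim(3) by simp
qed

lemma AE_G_lincomb: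
  assumes "sq_int M f" "sq_int M g"
  shows "AE z in mT. G (\<lambda>x. a * f x + g x) z = a * G f z + G g z"
  using Phi_lincomb[OF assms, of a, unfolded ae_eq_pair_def fst_conv snd_conv, THEN conjunct1]
    Phi_lincomb[OF assms, of a, unfolded ae_eq_pair_def fst_conv snd_conv, THEN conjunct2]
  by eventually_elim (simp add: G_def algebra_simps)

lemma AE_G_one: "AE z in mT. G (\<lambda>_. 1) z = s * (cnj (\<phi> z) + cnj \<gamma>)"
  using AE_Phi_one AE_Delta_square
proof eventually_elim
  case (elim z)
  have "G (\<lambda>_. 1) z = s * (cnj (\<phi> z) + cnj \<gamma> * (\<phi> z * cnj (\<phi> z) + \<Delta> z * \<Delta> z))"
    unfolding G_def elim(1,2) by (simp add: algebra_simps)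
  then show ?case using elim(3) by simp
qed

text \<open>The two summands of the bracket have different origins: \<open>1 / s\<close> stems from
  the projection onto the model space, the other from the rank one perturbation.\<close>

lemma AE_G_mult_id:
  assumes f: "sq_int M f"
  shows "AE z in mT. G (\<lambda>\<xi>. \<xi> * f \<xi>) z = z * G f z - b1 f * (1 / s + (\<gamma> - 1) * G (\<lambda>_. 1) z)"
proof -
  define h where "h = (\<lambda>\<xi>. ((\<gamma> - 1) * b1 f) * 1 + \<xi> * f \<xi>)"
  have U: "Ugamma M \<gamma> f = h"
    by (simp add: Ugamma_def b1_def h_def add.commute)
  show ?thesis
    using AE_G_Ugamma[OF f, unfolded U]
      AE_G_lincomb[OF sq_int_M_const[of 1] sq_int_M_mult_id[OF f], of "(\<gamma> - 1) * b1 f", folded h_def]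
    by eventually_elim (simp add: algebra_simps)
qed

text \<open>\<open>\<Phi>\<close> acts on functions rather than classes, so insensitivity to M-null
  sets has to come from the isometry. It is used for the resolvent identity, which holds on the
  circle only.\<close>

lemma AE_G_cong:
  assumes f: "sq_int M f" and g: "sq_int M g" and eq: "AE \<xi> in M. f \<xi> = g \<xi>"
  shows "AE z in mT. G f z = G g z"
proof -
  define h where "h = (\<lambda>\<xi>. (-1) * f \<xi> + g \<xi>)"
  have h: "sq_int M h" unfolding h_def by (intro sq_int_add sq_int_cmult f g)
  note [measurable] = sq_intD(1)[OF h]
  have "L2inner M h h = (\<integral>\<xi>. 0 \<partial>M)"
    unfolding L2inner_def
  proof (rule integral_cong_AE)
    show "AE \<xi> in M. h \<xi> * cnj (h \<xi>) = 0" using eq by eventually_elim (simp add: h_def)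
  qed measurable
  then have "Kinner (\<Phi> h) (\<Phi> h) = 0" using Phi_isometry[OF h h] by simp
  from Kinner_self_eq_0D[OF Phi_sq_int_pair[OF h] this] AE_G_lincomb[OF f g, of "-1", folded h_def]
  show ?thesis
  proof eventually_elim
    case (elim z)
    have "G h z = 0" using elim(1,2) by (simp add: G_def)
    then show ?case using elim(3) by simp
  qed
qed

end

section \<open>Cauchy integrals outside the disc\<close>

lemma exterior_bound:
  assumes "cmod w > 1"
  shows "AE z in mT. cmod (1 / (w - z)) \<le> 1 / (cmod w - 1)"
  using AE_mT_circle
proof eventually_elim
  case (elim z)
  have "cmod w - 1 \<le> cmod (w - z)" using norm_triangle_ineq2[of w z] elim by simp
  then show ?case unfolding norm_divide norm_one using assms by (intro divide_left_mono mult_pos_pos) auto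
qed

lemma integrable_exterior:
  assumes "cmod w > 1" "integrable mT g"
  shows "integrable mT (\<lambda>z. 1 / (w - z) * g z)"
  using assms(2) _ exterior_bound[OF assms(1)] by (rule integrable_bounded_mult) measurable

lemma integral_mT_exterior:
  assumes "cmod w > 1"
  shows "(\<integral>z. 1 / (w - z) \<partial>mT) = 1 / w"
proof -
  have w: "w \<noteq> 0" using assms by auto
  have small: "cmod (cnj (1 / w)) < 1" using assms by (simp add: norm_divide divide_less_eq)
  have "(\<integral>z. 1 / (w - z) \<partial>mT) = (\<integral>z. 1 / w * cnj (1 / (1 - cnj z * cnj (1 / w))) \<partial>mT)"
  proof (rule integral_cong_AE)
    show "AE z in mT. 1 / (w - z) = 1 / w * cnj (1 / (1 - cnj z * cnj (1 / w)))"
      using AE_mT_circle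
    proof eventually_elim
      case (elim z)
      have "w - z \<noteq> 0" using elim assms by auto
      then show ?case using w by (simp add: field_simps)
    qed
  qed measurable
  also have "\<dots> = 1 / w * (\<integral>z. cnj (1 / (1 - cnj z * cnj (1 / w))) \<partial>mT)"
    by (rule integral_mult_right_zero)
  also have "(\<integral>z. cnj (1 / (1 - cnj z * cnj (1 / w))) \<partial>mT) = cnj (\<integral>z. 1 / (1 - cnj z * cnj (1 / w)) \<partial>mT)"
    by (rule Bochner_Integration.integral_cnj)
  finally show ?thesis unfolding integral_mT_cauchy_one[OF small] by simp
qed

context clark_operator
begin

text \<open>The extension of \<open>G f\<close> to the exterior: for |\<xi>| = 1 < |w| the kernel is
  the sum of \<open>(\<xi> / w) ^ n\<close> over n \<ge> 1, so L collects the negative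
  frequencies.\<close>

definition L where "L f w = (\<integral>\<xi>. G f \<xi> * (\<xi> / (w - \<xi>)) \<partial>mT)"
definition T where "T f w = (\<integral>\<xi>. f \<xi> / (1 - cnj \<xi> * w) \<partial>M)"
definition \<kappa> where "\<kappa> w = 1 / s + (\<gamma> - 1) * L (\<lambda>_. 1) w"

lemma integral_G: "sq_int M f \<Longrightarrow> (\<integral>z. G f z \<partial>mT) = 0"
  using integral_G_cnj_power[of f 0] by simp

lemma integrable_G: "sq_int M f \<Longrightarrow> integrable mT (G f)"
  by (rule integrable_sq_int_mT[OF sq_int_G])

lemma L_exterior: "cmod w > 1 \<Longrightarrow> L f w = (\<integral>z. 1 / (w - z) * (z * G f z) \<partial>mT)"
  unfolding L_def by (rule Bochner_Integration.integral_cong) auto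

text \<open>w / (w - z) = 1 + z / (w - z), and \<open>G f\<close> has mean zero.\<close>

lemma integral_G_exterior:
  assumes w: "cmod w > 1" and f: "sq_int M f"
  shows "w * (\<integral>z. 1 / (w - z) * G f z \<partial>mT) = L f w"
proof -
  note [measurable] = G_measurable[OF f]
  have "w * (\<integral>z. 1 / (w - z) * G f z \<partial>mT) = (\<integral>z. w * (1 / (w - z) * G f z) \<partial>mT)"
    by (rule integral_mult_right_zero[symmetric])
  also have "\<dots> = (\<integral>z. G f z + 1 / (w - z) * (z * G f z) \<partial>mT)"
  proof (rule integral_cong_AE)
    show "AE z in mT. w * (1 / (w - z) * G f z) = G f z + 1 / (w - z) * (z * G f z)"
      using AE_mT_circle
    proof eventually_elim
      case (elim z)
      have "w - z \<noteq> 0" using elim w by auto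
      then show ?case by (simp add: field_simps)
    qed
  qed measurable
  also have "\<dots> = (\<integral>z. G f z \<partial>mT) + (\<integral>z. 1 / (w - z) * (z * G f z) \<partial>mT)"
    by (intro Bochner_Integration.integral_add integrable_G f integrable_exterior w
      integrable_sq_int_mT sq_int_mult_id sq_int_G)
  finally show ?thesis using integral_G[OF f] L_exterior[OF w] by simp
qed

text \<open>Apply \<^term>\<open>G\<close> to the resolvent identity \<open>\<xi> F - w F = \<xi> f\<close> for \<open>F = f / (1 - cnj \<xi> w)\<close>.\<close>

lemma L_eq_kappa_T:
  assumes w: "cmod w > 1" and f: "sq_int M f"
  shows "L f w = - \<kappa> w * T f w"
proof -
  have [measurable]: "f \<in> borel_measurable borel"
    using sq_intD(1)[OF f] measurable_cong_sets[OF sets_M refl, of borel] by auto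
  define F where "F = (\<lambda>\<xi>. 1 / (1 - cnj \<xi> * w) * f \<xi>)"
  have [measurable]: "F \<in> borel_measurable borel" unfolding F_def by measurable
  have F: "sq_int M F"
    unfolding F_def using f _ kernel_bound[of w] by (rule sq_int_mult_bounded) (use w in \<open>auto\<close>)
  have xF: "sq_int M (\<lambda>\<xi>. \<xi> * F \<xi>)" and xf: "sq_int M (\<lambda>\<xi>. \<xi> * f \<xi>)"
    by (rule sq_int_M_mult_id F f)+
  have res: "AE \<xi> in M. \<xi> * f \<xi> = (- w) * F \<xi> + \<xi> * F \<xi>"
    using circle
  proof eventually_elim
    case (elim \<xi>)
    have "1 - cnj \<xi> * w \<noteq> 0" using kernel_lower_bound[OF elim, of w] w by auto
    then have "f \<xi> = (1 - cnj \<xi> * w) * F \<xi>" by (simp add: F_def)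
    then have "\<xi> * f \<xi> = \<xi> * ((1 - cnj \<xi> * w) * F \<xi>)" by (rule arg_cong)
    also have "\<dots> = \<xi> * F \<xi> - \<xi> * (cnj \<xi> * (w * F \<xi>))" by (simp add: algebra_simps)
    finally show ?case unfolding circle_cnj_mult(1)[OF elim] by simp
  qed
  \<comment> \<open>\<open>b1\<close> integrates against \<xi>, and \<open>res\<close> says that
    \<xi> times f - F is - w F.\<close>
  have b1_diff: "b1 f - b1 F = - w * T f w"
  proof -
    have "b1 f - b1 F = 1 * L2inner M f (\<lambda>\<xi>. cnj \<xi>) + (-1) * L2inner M F (\<lambda>\<xi>. cnj \<xi>)"
      by (simp add: b1_def)
    also have "\<dots> = L2inner M (\<lambda>\<xi>. 1 * f \<xi> + (-1) * F \<xi>) (\<lambda>\<xi>. cnj \<xi>)"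
      by (rule L2inner_lincomb_left[OF f F sq_int_M_cnj, symmetric])
    also have "\<dots> = (\<integral>\<xi>. - w * (f \<xi> / (1 - cnj \<xi> * w)) \<partial>M)"
      unfolding L2inner_def
    proof (rule integral_cong_AE)
      show "AE \<xi> in M. (1 * f \<xi> + - 1 * F \<xi>) * cnj (cnj \<xi>) = - w * (f \<xi> / (1 - cnj \<xi> * w))"
        using res
      proof eventually_elim
        case (elim \<xi>)
        then have "(1 * f \<xi> + - 1 * F \<xi>) * cnj (cnj \<xi>) = - w * F \<xi>" by (simp add: algebra_simps)
        then show ?case by (simp add: F_def)
      qed
    qed measurable
    also have "\<dots> = - w * T f w"
      unfolding T_def by (rule integral_mult_right_zero)
    finally show ?thesis .
  qed
  have AE_eq: "AE z in mT. z * G f z - b1 f * (1 / s + (\<gamma> - 1) * G (\<lambda>_. 1) z) =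
      - w * G F z + (z * G F z - b1 F * (1 / s + (\<gamma> - 1) * G (\<lambda>_. 1) z))"
    using AE_G_cong[OF xf sq_int_add[OF sq_int_cmult[OF F] xF] res] AE_G_mult_id[OF f] AE_G_mult_id[OF F]
      AE_G_lincomb[OF F xF, of "- w"]
    by eventually_elim simp
  note [measurable] = G_measurable[OF f] G_measurable[OF F] G_measurable[OF sq_int_M_const[of 1]]
  note int = integrable_exterior[OF w]
  have "L f w = (\<integral>z. 1 / (w - z) * (z * G f z) \<partial>mT)" by (rule L_exterior[OF w])
  \<comment> \<open>The coefficient \<open>w - z\<close> of \<open>G F z\<close> cancels against the
    kernel; what is left is \<open>G F\<close> itself, whose integral is zero.\<close>
  also have "\<dots> = (\<integral>z. (b1 f - b1 F) * (1 / s * (1 / (w - z) * 1) + (\<gamma> - 1) * (1 / (w - z) * G (\<lambda>_. 1) z)) - G F z \<partial>mT)"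
  proof (rule integral_cong_AE)
    show "AE z in mT. 1 / (w - z) * (z * G f z) =
      (b1 f - b1 F) * (1 / s * (1 / (w - z) * 1) + (\<gamma> - 1) * (1 / (w - z) * G (\<lambda>_. 1) z)) - G F z"
      using AE_eq AE_mT_circle
    proof eventually_elim
      case (elim z)
      have ne: "w - z \<noteq> 0" using elim(2) w by auto
      define k where "k = 1 / s + (\<gamma> - 1) * G (\<lambda>_. 1) z"
      have eq: "z * G f z = (b1 f - b1 F) * k - (w - z) * G F z"
        using elim(1) unfolding k_def[symmetric] by (simp add: algebra_simps)
      have "1 / (w - z) * (z * G f z) = (b1 f - b1 F) * (1 / (w - z) * k) - G F z"
        unfolding eq using ne by (simp add: diff_divide_distrib)
      moreover have "a * (b + c * d) = b * (a * 1) + c * (a * d)" for a b c d :: complex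
        by (simp add: algebra_simps)
      ultimately show ?case unfolding k_def by simp
    qed
  qed measurable
  also have "\<dots> = (b1 f - b1 F) * (1 / s * (\<integral>z. 1 / (w - z) * 1 \<partial>mT) + (\<gamma> - 1) * (\<integral>z. 1 / (w - z) * G (\<lambda>_. 1) z \<partial>mT))
      - (\<integral>z. G F z \<partial>mT)"
  proof -
    have 1: "integrable mT (\<lambda>z. 1 / s * (1 / (w - z) * 1))"
      by (intro integrable_mult_right int) simp
    have 2: "integrable mT (\<lambda>z. (\<gamma> - 1) * (1 / (w - z) * G (\<lambda>_. 1) z))"
      by (intro integrable_mult_right int integrable_G sq_int_M_const)
    show ?thesis
      unfolding Bochner_Integration.integral_diff[OF integrable_mult_right[OF Bochner_Integration.integrable_add[OF 1 2]] integrable_G[OF F]]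
        integral_mult_right_zero Bochner_Integration.integral_add[OF 1 2] ..
  qed
  also have "\<dots> = - w * T f w * (1 / s * (1 / w) + (\<gamma> - 1) * (\<integral>z. 1 / (w - z) * G (\<lambda>_. 1) z \<partial>mT))"
    unfolding b1_diff integral_G[OF F] using integral_mT_exterior[OF w] by simp
  also have "\<dots> = - T f w * (1 / s + (\<gamma> - 1) * (w * (\<integral>z. 1 / (w - z) * G (\<lambda>_. 1) z \<partial>mT)))"
  proof -
    have "w \<noteq> 0" using w by auto
    then show ?thesis by (simp add: field_simps)
  qed
  finally show ?thesis
    unfolding integral_G_exterior[OF w sq_int_M_const] by (simp add: \<kappa>_def algebra_simps)
qed

text \<open>For f = 1 the relation \<open>L_eq_kappa_T\<close> is a linear equation for
  \<open>L 1\<close>: \<open>\<kappa>\<close> is affine in \<open>L 1\<close>, and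
  \<open>T 1\<close> is known from \<open>R2\<close> by reflection. The value of
  \<open>theta\<close> appears as its solution.\<close>

lemma L_one:
  assumes w: "cmod w > 1"
  shows "L (\<lambda>_. 1) w = s * cnj (theta M \<gamma> (1 / cnj w) + \<gamma>)"
proof -
  let ?v = "1 / cnj w"
  have v: "cmod ?v < 1" using w by (simp add: norm_divide divide_less_eq)
  define R where "R = R2 M ?v"
  define D where "D = (1 - cnj \<gamma>) * R + (1 + cnj \<gamma>)"
  define l where "l = L (\<lambda>_. 1) w"
  have "D \<noteq> 0" unfolding D_def R_def by (rule theta_denominator_nonzero[OF v gamma])
  then have D: "cnj D \<noteq> 0" by simp
  have T1: "T (\<lambda>_. 1) w = (1 - cnj R) / 2"
    using cauchy_integral_exterior[OF w] R2_eq[of ?v] v by (simp add: T_def R_def)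
  have "l = - (1 / s + (\<gamma> - 1) * l) * ((1 - cnj R) / 2)"
    using L_eq_kappa_T[OF w sq_int_M_const[of 1]] unfolding T1 \<kappa>_def l_def[symmetric] .
  then have eq: "cnj R - 1 = s * (l * cnj D)"
    using s_nonzero by (simp add: D_def field_simps)
  have "s * ((1 - \<gamma> * cnj \<gamma>) * (cnj R - 1)) = (s * s * (1 - \<gamma> * cnj \<gamma>)) * (l * cnj D)"
    unfolding eq by (simp only: mult_ac)
  then have "l * cnj D = s * ((1 - \<gamma> * cnj \<gamma>) * (cnj R - 1))"
    unfolding s_square by simp
  then have "l = s * ((1 - \<gamma> * cnj \<gamma>) * (cnj R - 1) / cnj D)"
    using D by (simp add: field_simps)
  also have "(1 - \<gamma> * cnj \<gamma>) * (cnj R - 1) / cnj D = cnj (theta M \<gamma> ?v + \<gamma>)"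
    unfolding theta_add_gamma[OF v gamma] D_def R_def by (simp add: mult.commute)
  finally show ?thesis by (simp add: l_def)
qed

end

section \<open>Boundary values and the quotient formula\<close>

lemma filterlim_inverse_at_right_1: "filterlim (\<lambda>\<rho>::real. 1 / \<rho>) (at_right 1) (at_left 1)"
  by real_asymp

context clark_operator
begin

lemma AE_L_tendsto:
  "sq_int M f \<Longrightarrow> AE z in mT. ((\<lambda>r. L f (of_real r * z)) \<longlongrightarrow> G f z) (at_right 1)"
  unfolding L_def by (rule AE_exterior_cauchy_tendsto[OF integrable_G integral_G_cnj_power])

text \<open>\<open>L 1\<close> converges from outside to \<open>G 1\<close>, an affine function of
  \<open>cnj \<phi>\<close>; by \<open>L_one\<close>, at radius 1 / \<rho> it is the same affine
  function of the conjugate of \<open>theta\<close> at radius \<rho>. Hence the value of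
  \<open>bval\<close> is a genuine limit almost everywhere.\<close>

lemma AE_theta_tendsto:
  "AE z in mT. ((\<lambda>\<rho>. theta M \<gamma> (of_real \<rho> * z)) \<longlongrightarrow> \<phi> z) (at_left 1)"
  using AE_L_tendsto[OF sq_int_M_const[of 1]] AE_G_one AE_mT_circle
proof eventually_elim
  case (elim z)
  have "((\<lambda>\<rho>. L (\<lambda>_. 1) (of_real (1 / \<rho>) * z)) \<longlongrightarrow> G (\<lambda>_. 1) z) (at_left 1)"
    by (rule filterlim_compose[OF elim(1) filterlim_inverse_at_right_1])
  then have "((\<lambda>\<rho>. cnj (L (\<lambda>_. 1) (of_real (1 / \<rho>) * z)) / s - \<gamma>) \<longlongrightarrow> cnj (G (\<lambda>_. 1) z) / s - \<gamma>) (at_left 1)"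
    using s_nonzero by (intro tendsto_intros)
  moreover have "cnj (G (\<lambda>_. 1) z) / s - \<gamma> = \<phi> z"
    using s_nonzero unfolding elim(2) by (simp add: cnj_s)
  moreover have "\<forall>\<^sub>F \<rho> in at_left 1. 0 < \<rho> \<and> \<rho> < (1::real)"
    by (rule eventually_at_left_1)
  then have "\<forall>\<^sub>F \<rho> in at_left 1. cnj (L (\<lambda>_. 1) (of_real (1 / \<rho>) * z)) / s - \<gamma> = theta M \<gamma> (of_real \<rho> * z)"
  proof eventually_elim
    case (elim \<rho>)
    have "cmod (of_real (1 / \<rho>) * z) > 1" using elim \<open>cmod z = 1\<close> by (simp add: norm_divide)
    moreover have "1 / cnj (of_real (1 / \<rho>) * z) = of_real \<rho> * z"
      using circle_inverse[of "cnj z"] \<open>cmod z = 1\<close> by (simp add: divide_inverse)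
    ultimately show ?case using s_nonzero L_one[of "of_real (1 / \<rho>) * z"] by (simp add: cnj_s)
  qed
  ultimately show ?case by (simp add: Lim_transform_eventually)
qed

text \<open>As \<open>G 1\<close> is \<open>s * cnj (\<phi> + \<gamma>)\<close>, this amounts to the
  nonvanishing of \<open>Tminus M 1\<close>. The bounded function \<open>theta + \<gamma>\<close> is
  not identically zero because M differs from \<open>mT\<close>.\<close>

lemma AE_phi_add_gamma_nonzero: "AE z in mT. \<phi> z + \<gamma> \<noteq> 0"
proof -
  obtain w where w: "cmod w < 1" "R2 M w \<noteq> 1" using R2_not_constant[OF not_mT] .
  have "1 - \<gamma> * cnj \<gamma> \<noteq> 0" using s_square by auto
  then have "theta M \<gamma> w + \<gamma> \<noteq> 0"
    unfolding theta_add_gamma[OF w(1) gamma] using w theta_denominator_nonzero[OF w(1) gamma] by simp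
  moreover have "cmod (theta M \<gamma> w + \<gamma>) \<le> 2" if "w \<in> ball 0 1" for w
    using norm_triangle_ineq[of "theta M \<gamma> w" \<gamma>] norm_theta_less_1[of w \<gamma>] gamma that by simp
  ultimately have "AE z in mT. \<not> ((\<lambda>\<rho>. theta M \<gamma> (of_real \<rho> * z) + \<gamma>) \<longlongrightarrow> 0) (at_left 1)"
    using w by (intro AE_radial_limit_nonzero[where h = "\<lambda>w. theta M \<gamma> w + \<gamma>" and B = 2 and ?w0.0 = w]
      holomorphic_intros theta_holomorphic gamma) auto
  with AE_theta_tendsto show ?thesis
  proof eventually_elim
    case (elim z)
    have "((\<lambda>\<rho>. theta M \<gamma> (of_real \<rho> * z) + \<gamma>) \<longlongrightarrow> \<phi> z + \<gamma>) (at_left 1)"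
      using elim(1) by (intro tendsto_intros)
    then show ?case using elim(2) by auto
  qed
qed

text \<open>The radial limit of \<open>\<kappa>\<close> from outside.\<close>

definition \<kappa>b where "\<kappa>b z = 1 / s + (\<gamma> - 1) * G (\<lambda>_. 1) z"

text \<open>The function \<open>?h\<close> is \<open>\<kappa>\<close> conjugated and reflected into
  the disc. It is bounded there, and its value at 0 is \<open>1 / s\<close> because
  \<open>theta\<close> is \<open>- \<gamma>\<close> there.\<close>

lemma AE_kappa_nonzero: "AE z in mT. \<kappa>b z \<noteq> 0"
proof -
  let ?h = "\<lambda>w. 1 / s + (cnj \<gamma> - 1) * (s * (theta M \<gamma> w + \<gamma>))"
  have "?h 0 \<noteq> 0" using s_nonzero by (simp add: theta_at_0)
  moreover have "cmod (?h w) \<le> cmod (1 / s) + cmod (cnj \<gamma> - 1) * (cmod s * 2)" if "w \<in> ball 0 1" for w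
  proof -
    have "cmod (theta M \<gamma> w + \<gamma>) \<le> 2"
      using norm_triangle_ineq[of "theta M \<gamma> w" \<gamma>] norm_theta_less_1[of w \<gamma>] gamma that by simp
    then have "cmod ((cnj \<gamma> - 1) * (s * (theta M \<gamma> w + \<gamma>))) \<le> cmod (cnj \<gamma> - 1) * (cmod s * 2)"
      unfolding norm_mult by (intro mult_left_mono) auto
    then show ?thesis by (intro order_trans[OF norm_triangle_ineq] add_left_mono)
  qed
  ultimately have "AE z in mT. \<not> ((\<lambda>\<rho>. ?h (of_real \<rho> * z)) \<longlongrightarrow> 0) (at_left 1)"
    by (intro AE_radial_limit_nonzero[where h = ?h and ?w0.0 = 0] holomorphic_intros theta_holomorphic gamma) auto
  with AE_theta_tendsto AE_G_one show ?thesis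
  proof eventually_elim
    case (elim z)
    have "((\<lambda>\<rho>. ?h (of_real \<rho> * z)) \<longlongrightarrow> 1 / s + (cnj \<gamma> - 1) * (s * (\<phi> z + \<gamma>))) (at_left 1)"
      using elim(1) by (intro tendsto_intros)
    moreover have "cnj (\<kappa>b z) = 1 / s + (cnj \<gamma> - 1) * (s * (\<phi> z + \<gamma>))"
      unfolding \<kappa>b_def elim(2) by (simp add: cnj_s)
    ultimately show ?case using elim(3) by auto
  qed
qed

text \<open>Divide \<open>L_eq_kappa_T\<close> by \<open>\<kappa>\<close>, which is nonzero along
  the radius near the circle since its limit is, and let r tend to 1.\<close>

lemma AE_Tminus:
  assumes f: "sq_int M f"
  shows "AE z in mT. Tminus M f z = - G f z / \<kappa>b z"
  using AE_L_tendsto[OF f] AE_L_tendsto[OF sq_int_M_const[of 1]] AE_kappa_nonzero AE_mT_circle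
proof eventually_elim
  case (elim z)
  have "((\<lambda>r. \<kappa> (of_real r * z)) \<longlongrightarrow> \<kappa>b z) (at_right 1)"
    unfolding \<kappa>_def \<kappa>b_def using elim(2) by (intro tendsto_intros)
  from tendsto_divide[OF tendsto_minus[OF elim(1)] this elim(3)] tendsto_imp_eventually_ne[OF this elim(3)]
  have lim: "((\<lambda>r. - L f (of_real r * z) / \<kappa> (of_real r * z)) \<longlongrightarrow> - G f z / \<kappa>b z) (at_right 1)"
    and ne: "\<forall>\<^sub>F r in at_right 1. \<kappa> (of_real r * z) \<noteq> 0" .
  have "\<forall>\<^sub>F r in at_right 1. (1::real) < r" by (rule eventually_at_right_less)
  with ne have "\<forall>\<^sub>F r in at_right 1. - L f (of_real r * z) / \<kappa> (of_real r * z) = Tr M r f z"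
  proof eventually_elim
    case (elim r)
    have "L f (of_real r * z) = - \<kappa> (of_real r * z) * T f (of_real r * z)"
      using elim(2) \<open>cmod z = 1\<close> by (intro L_eq_kappa_T f) (simp add: norm_mult)
    moreover have "T f (of_real r * z) = Tr M r f z"
      by (simp add: T_def Tr_def mult.assoc mult.left_commute)
    ultimately show ?case using elim(1) by simp
  qed
  from Lim_transform_eventually[OF lim this]
  show ?case unfolding Tminus_def by (intro tendsto_Lim) simp_all
qed

text \<open>The factor \<open>- 1 / \<kappa>b z\<close> is common to the boundary transforms of f
  and of 1 and cancels in their quotient; the remaining \<open>G 1\<close> is explicit.\<close>

lemma AE_G_eq:
  assumes f: "sq_int M f"
  shows "AE z in mT. G f z = s * (cnj (\<phi> z) + cnj \<gamma>) * (Tminus M f z / Tminus M (\<lambda>_. 1) z)"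
  using AE_Tminus[OF f] AE_Tminus[OF sq_int_M_const[of 1]] AE_G_one AE_kappa_nonzero AE_phi_add_gamma_nonzero
proof eventually_elim
  case (elim z)
  have "cnj (\<phi> z + \<gamma>) \<noteq> 0" using elim(5) unfolding complex_cnj_zero_iff .
  then have "cnj (\<phi> z) + cnj \<gamma> \<noteq> 0" by simp
  then have ne: "s * (cnj (\<phi> z) + cnj \<gamma>) \<noteq> 0" using s_nonzero by simp
  then show ?case
    unfolding elim(1,2) elim(3) using elim(4) by (simp add: divide_simps)
qed

text \<open>Pass to the radial limit in \<open>theta_0_eq\<close>; the limit of the denominator is
  nonzero since \<open>|\<phi>| \<le> 1\<close> and \<open>|\<gamma>| < 1\<close>.\<close>

lemma AE_bval_theta_0: "AE z in mT. bval (theta M 0) z = (\<phi> z + \<gamma>) / (1 + cnj \<gamma> * \<phi> z) \<and> 1 + cnj \<gamma> * \<phi> z \<noteq> 0"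
  using AE_theta_tendsto AE_phi_le_1 AE_mT_circle
proof eventually_elim
  case (elim z)
  have "cmod (cnj \<gamma> * \<phi> z) \<le> cmod \<gamma> * 1"
    unfolding norm_mult using elim(2) by (intro mult_mono) auto
  then have "cmod (cnj \<gamma> * \<phi> z) < 1" using gamma by simp
  then have ne: "1 + cnj \<gamma> * \<phi> z \<noteq> 0"
    by (auto simp: add_eq_0_iff)
  have lim: "((\<lambda>\<rho>. (theta M \<gamma> (of_real \<rho> * z) + \<gamma>) / (1 + cnj \<gamma> * theta M \<gamma> (of_real \<rho> * z))) \<longlongrightarrow>
      (\<phi> z + \<gamma>) / (1 + cnj \<gamma> * \<phi> z)) (at_left 1)"
    using elim(1) ne by (intro tendsto_intros)
  have "\<forall>\<^sub>F \<rho> in at_left 1. 0 < \<rho> \<and> \<rho> < (1::real)"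
    by (rule eventually_at_left_1)
  then have "\<forall>\<^sub>F \<rho> in at_left 1. (theta M \<gamma> (of_real \<rho> * z) + \<gamma>) / (1 + cnj \<gamma> * theta M \<gamma> (of_real \<rho> * z)) =
      theta M 0 (of_real \<rho> * z)"
    by eventually_elim (intro theta_0_eq[symmetric] gamma, use \<open>cmod z = 1\<close> in \<open>simp add: norm_mult\<close>)
  from Lim_transform_eventually[OF lim this]
  have "bval (theta M 0) z = (\<phi> z + \<gamma>) / (1 + cnj \<gamma> * \<phi> z)"
    unfolding bval_def by (intro tendsto_Lim) simp_all
  with ne show ?case by blast
qed

text \<open>With p = \<open>cnj (\<phi> z)\<close> the denominator on the left is
  \<open>(1 - \<gamma> * cnj \<gamma>) / (1 + \<gamma> * p)\<close>. The factor
  \<open>1 + \<gamma> * p\<close> cancels, and \<open>s_square\<close> exchanges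
  \<open>1 / s\<close> for s.\<close>

lemma AE_factor_eq:
  "AE z in mT. 1 / s * cnj (bval (theta M 0) z) / (1 - \<gamma> * cnj (bval (theta M 0) z)) = s * (cnj (\<phi> z) + cnj \<gamma>)"
  using AE_bval_theta_0
proof eventually_elim
  case (elim z)
  define p where "p = cnj (\<phi> z)"
  have "cnj (1 + cnj \<gamma> * \<phi> z) \<noteq> 0" using elim unfolding complex_cnj_zero_iff by simp
  then have ne: "1 + \<gamma> * p \<noteq> 0" by (simp add: p_def)
  have q: "1 - \<gamma> * cnj \<gamma> \<noteq> 0" using s_square by auto
  have b: "cnj (bval (theta M 0) z) = (p + cnj \<gamma>) / (1 + \<gamma> * p)"
    using elim by (simp add: p_def)
  have "1 - \<gamma> * cnj (bval (theta M 0) z) = (1 - \<gamma> * cnj \<gamma>) / (1 + \<gamma> * p)"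
    unfolding b using ne by (simp add: field_simps)
  then have "1 / s * cnj (bval (theta M 0) z) / (1 - \<gamma> * cnj (bval (theta M 0) z)) =
      (p + cnj \<gamma>) * (1 / (s * (1 - \<gamma> * cnj \<gamma>)))"
    unfolding b using ne q by simp
  also have "1 / (s * (1 - \<gamma> * cnj \<gamma>)) = s"
    using s_square s_nonzero q by (simp add: field_simps)
  finally show ?case by (simp add: p_def mult.commute)
qed

end

theorem theorem4p3:
  fixes M :: "complex measure" and \<gamma> :: complex
    and \<Phi> :: "(complex \<Rightarrow> complex) \<Rightarrow> pairfun" and f :: "complex \<Rightarrow> complex"
  assumes "prob_space M" and "sets M = sets borel" and "AE \<xi> in M. cmod \<xi> = 1"
    and "M \<noteq> mT"
    and "cmod \<gamma> < 1"
    and "clark_Phi M \<gamma> \<Phi>"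
    and "sq_int M f"
  defines "g_minus \<equiv> (\<lambda>z. cnj (bval (theta M \<gamma>) z) * fst (\<Phi> f) z
                         + Delta (bval (theta M \<gamma>)) z * snd (\<Phi> f) z)"
  shows "g_minus \<in> H2minus
    \<and> (AE z in mT. g_minus z =
          complex_of_real (1 / sqrt (1 - (cmod \<gamma>)^2))
            * (cnj (bval (theta M \<gamma>) z) + cnj \<gamma>) * (Tminus M f z / Tminus M (\<lambda>_. 1) z))
    \<and> (AE z in mT. g_minus z =
          complex_of_real (sqrt (1 - (cmod \<gamma>)^2)) * cnj (bval (theta M 0) z)
            / (1 - \<gamma> * cnj (bval (theta M 0) z)) * (Tminus M f z / Tminus M (\<lambda>_. 1) z))"
proof -
  interpret prob_space M by fact
  interpret clark_operator M \<gamma> \<Phi>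
    by unfold_locales (fact assms)+
  note f = \<open>sq_int M f\<close>
  have g: "g_minus = G f"
    by (simp add: g_minus_def G_def \<phi>_def \<Delta>_def)
  have "AE z in mT. g_minus z =
      complex_of_real (sqrt (1 - (cmod \<gamma>)\<^sup>2)) * cnj (bval (theta M 0) z)
        / (1 - \<gamma> * cnj (bval (theta M 0) z)) * (Tminus M f z / Tminus M (\<lambda>_. 1) z)"
    using AE_G_eq[OF f] AE_factor_eq unfolding g sqrt_eq by eventually_elim simp
  then show ?thesis
    using G_H2minus[OF f] AE_G_eq[OF f] unfolding g \<phi>_def s_def by blast
qed

end
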